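(* Let $D$ be a knot diagram in the annulus. Apply to $D$ the region-coloring procedure (Method 1) and then the directed-graph procedure (Method 2), both described in the context. Then any reversed path (i.e. a path following directed edges backwards) from the exterior of the projection to the center of the annulus is a minimal meridian, cutting $D$ at exactly $w_{ST}(D)$ points.
   Context: The annulus is regarded as the plane with a marked point, the center. A meridian for $D$ is an arc (not necessarily a line segment) running from the center of the annulus to the exterior (unbounded region) of $D$, crossing $D$ transversally away from its crossings. The wrapping number $w_{ST}(D)$ of the diagram $D$ is the minimal number of intersection points of such a meridian with $D$. Method 1. (0) Start at the region containing the center of the annulus. (1) Color the current region, using a new color, until its bounds are met. (2) Split (smooth) every crossing lying on the boundary of the colored region in the way that keeps the colored region separated from the opposite corner at that crossing (i.e. the two other corners of the crossing, which are adjacent to the colored corner, are merged). The colored region then becomes bounded on the outside by a circuit encircling the center. (3) Advance to the contiguous region on the outer side of this circuit; uncolored inner isolated regions that may have appeared are ignored. (4) If that region is bounded, repeat from (1); if it is unbounded, stop. The resulting diagram is denoted $D^*$. (If the center lies in the unbounded region of $D$, nothing is colored.) Method 2. On $D^*$: starting from the center, connect the regions having a given color to the contiguous regions with the next outer color through all connecting walls (arcs of $D$ separating them) by directed edges pointing outwards, and continue outwards until the unbounded region is reached (edges from the last color to the unbounded region being included). Here the regions are the regions of the diagram $D$, each carrying the color of the colored region of $D^*$ in which it lies. A path in the resulting directed graph is identified with the arc that crosses each corresponding wall once and has no other intersections with $D$. *)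

theory Defs
  imports "HOL-Analysis.Analysis"
begin

text \<open>
  The annulus is the complex plane with a marked point. Diagrams and arcs live in the tame
  topological category: transversality is expressed by local charts that straighten the curves
  to the coordinate axes. Smooth and piecewise linear generic curves are instances.
\<close>

record annular_diagram =
  curve :: "complex \<Rightarrow> complex" \<comment> \<open>only its values on the unit circle \<open>sphere 0 1\<close> matter\<close>
  over :: "complex \<Rightarrow> complex" \<comment> \<open>parameter of the upper strand at each crossing\<close>
  center :: complex

definition shadow :: "annular_diagram \<Rightarrow> complex set" where
  "shadow D = curve D ` sphere 0 1"

definition preimages :: "annular_diagram \<Rightarrow> complex \<Rightarrow> complex set" where
  "preimages D p = {s \<in> sphere 0 1. curve D s = p}"

definition crossings :: "annular_diagram \<Rightarrow> complex set" where
  "crossings D = {p. \<exists>s t. s \<noteq> t \<and> s \<in> preimages D p \<and> t \<in> preimages D p}"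

definition horizontal :: "complex set" where
  "horizontal = {z \<in> cball 0 1. Im z = 0}"

definition vertical :: "complex set" where
  "vertical = {z \<in> cball 0 1. Re z = 0}"

definition disc_chart :: "complex \<Rightarrow> (complex \<Rightarrow> complex) \<Rightarrow> bool" where
  "disc_chart p \<phi> \<longleftrightarrow> continuous_on (cball 0 1) \<phi> \<and> inj_on \<phi> (cball 0 1) \<and> \<phi> 0 = p"

definition flat_at :: "complex set \<Rightarrow> complex \<Rightarrow> bool" where
  "flat_at A p \<longleftrightarrow> (\<exists>\<phi>. disc_chart p \<phi> \<and> A \<inter> \<phi> ` cball 0 1 = \<phi> ` horizontal)"

definition transverse_at :: "complex set \<Rightarrow> complex set \<Rightarrow> complex \<Rightarrow> bool" where
  "transverse_at A B p \<longleftrightarrow> (\<exists>\<phi>. disc_chart p \<phi> \<and>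
     A \<inter> \<phi> ` cball 0 1 = \<phi> ` horizontal \<and> B \<inter> \<phi> ` cball 0 1 = \<phi> ` vertical)"

text \<open>
  The last clause says that each of the two strands follows one axis straight through the
  crossing; it excludes strands that merely touch and turn from one axis to the other.
\<close>

definition crossing_chart :: "annular_diagram \<Rightarrow> complex \<Rightarrow> (complex \<Rightarrow> complex) \<Rightarrow> bool" where
  "crossing_chart D c \<phi> \<longleftrightarrow> disc_chart c \<phi> \<and>
     shadow D \<inter> \<phi> ` cball 0 1 = \<phi> ` (horizontal \<union> vertical) \<and>
     (\<exists>s t. s \<noteq> t \<and> preimages D c = {s, t} \<and>
        (\<forall>\<^sub>F u in at s within sphere 0 1. curve D u \<in> \<phi> ` horizontal) \<and>
        (\<forall>\<^sub>F u in at t within sphere 0 1. curve D u \<in> \<phi> ` vertical))"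

definition knot_diagram :: "annular_diagram \<Rightarrow> bool" where
  "knot_diagram D \<longleftrightarrow>
     continuous_on (sphere 0 1) (curve D) \<and>
     finite (crossings D) \<and>
     (\<forall>c\<in>crossings D. \<exists>\<phi>. crossing_chart D c \<phi>) \<and>
     (\<forall>p\<in>shadow D - crossings D. flat_at (shadow D) p) \<and>
     (\<forall>c\<in>crossings D. over D c \<in> preimages D c) \<and>
     center D \<notin> shadow D"

definition meridian :: "annular_diagram \<Rightarrow> (real \<Rightarrow> complex) \<Rightarrow> bool" where
  "meridian D m \<longleftrightarrow>
     arc m \<and> pathstart m = center D \<and> pathfinish m \<in> outside (shadow D) \<and>
     finite (path_image m \<inter> shadow D) \<and>
     (\<forall>p\<in>path_image m \<inter> shadow D. p \<notin> crossings D \<and> transverse_at (shadow D) (path_image m) p)"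

definition wrapping_number :: "annular_diagram \<Rightarrow> nat" where
  "wrapping_number D = (LEAST n. \<exists>m. meridian D m \<and> card (path_image m \<inter> shadow D) = n)"

definition minimal_meridian :: "annular_diagram \<Rightarrow> (real \<Rightarrow> complex) \<Rightarrow> bool" where
  "minimal_meridian D m \<longleftrightarrow> meridian D m \<and>
     (\<forall>m'. meridian D m' \<longrightarrow> card (path_image m \<inter> shadow D) \<le> card (path_image m' \<inter> shadow D))"

text \<open>
  Splitting is carried out inside fixed disjoint discs around the crossings. In the chart, the
  four corners at a crossing are the open quadrants. \<open>Split_pos\<close> keeps the two quadrants with
  \<open>Re z * Im z > 0\<close> apart and joins the other two through the origin; \<open>Split_neg\<close> does the
  opposite.
\<close>

definition splitting_discs :: "annular_diagram \<Rightarrow> (complex \<Rightarrow> complex \<Rightarrow> complex) \<Rightarrow> bool" where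
  "splitting_discs D \<Phi> \<longleftrightarrow>
     (\<forall>c\<in>crossings D. crossing_chart D c (\<Phi> c) \<and> center D \<notin> \<Phi> c ` cball 0 1) \<and>
     (\<forall>c\<in>crossings D. \<forall>d\<in>crossings D. c \<noteq> d \<longrightarrow> \<Phi> c ` cball 0 1 \<inter> \<Phi> d ` cball 0 1 = {})"

datatype crossing_state = Unsplit | Split_pos | Split_neg

fun local_picture :: "crossing_state \<Rightarrow> complex set" where
  "local_picture Unsplit = horizontal \<union> vertical"
| "local_picture Split_pos = {z. \<bar>Re z\<bar> + \<bar>Im z\<bar> = 1 \<and> Re z * Im z \<ge> 0}"
| "local_picture Split_neg = {z. \<bar>Re z\<bar> + \<bar>Im z\<bar> = 1 \<and> Re z * Im z \<le> 0}"

definition core :: "annular_diagram \<Rightarrow> (complex \<Rightarrow> complex \<Rightarrow> complex) \<Rightarrow> complex set \<Rightarrow> complex set" where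
  "core D \<Phi> X = X - (\<Union>c\<in>crossings D. \<Phi> c ` ball 0 1)"

definition split_shadow ::
  "annular_diagram \<Rightarrow> (complex \<Rightarrow> complex \<Rightarrow> complex) \<Rightarrow> (complex \<Rightarrow> crossing_state) \<Rightarrow> complex set" where
  "split_shadow D \<Phi> \<sigma> =
     core D \<Phi> (shadow D) \<union> (\<Union>c\<in>crossings D. \<Phi> c ` local_picture (\<sigma> c))"

definition regions :: "complex set \<Rightarrow> complex set set" where
  "regions A = components (- A)"

text \<open>
  The order of the two tests below is immaterial: a region never occupies two adjacent corners of
  an unsplit crossing, since the regions of \<open>D\<close> admit a checkerboard colouring and splittings join
  only opposite corners.
\<close>

definition split_boundary ::
  "annular_diagram \<Rightarrow> (complex \<Rightarrow> complex \<Rightarrow> complex) \<Rightarrow> complex set \<Rightarrow>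
   (complex \<Rightarrow> crossing_state) \<Rightarrow> complex \<Rightarrow> crossing_state" where
  "split_boundary D \<Phi> R \<sigma> c =
     (if c \<in> crossings D \<and> \<sigma> c = Unsplit \<and> c \<in> frontier R then
        if R \<inter> \<Phi> c ` {z \<in> ball 0 1. Re z * Im z > 0} \<noteq> {} then Split_pos else Split_neg
      else \<sigma> c)"

text \<open>
  \<open>coloring D \<Phi> \<sigma> Rs R\<close>: a state of the colouring procedure, where \<open>\<sigma>\<close> records the splittings made
  so far, \<open>Rs ! k\<close> is the region with colour \<open>k\<close> (after its boundary has been split) and \<open>R\<close> is the
  current, not yet coloured region. Splitting trims the corners of \<open>R\<close>, and the coloured region
  \<open>R'\<close> is the region of the new diagram that contains the untrimmed part of \<open>R\<close>. The circuit \<open>C\<close>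
  bounds \<open>R'\<close> on the outside.
\<close>

inductive coloring ::
  "annular_diagram \<Rightarrow> (complex \<Rightarrow> complex \<Rightarrow> complex) \<Rightarrow> (complex \<Rightarrow> crossing_state) \<Rightarrow>
   complex set list \<Rightarrow> complex set \<Rightarrow> bool"
  for D \<Phi> where
  start: "R \<in> regions (shadow D) \<Longrightarrow> center D \<in> R \<Longrightarrow> coloring D \<Phi> (\<lambda>_. Unsplit) [] R"
| advance: "coloring D \<Phi> \<sigma> Rs R \<Longrightarrow> bounded R \<Longrightarrow>
    \<sigma>' = split_boundary D \<Phi> R \<sigma> \<Longrightarrow>
    R' \<in> regions (split_shadow D \<Phi> \<sigma>') \<Longrightarrow> core D \<Phi> R \<subseteq> R' \<Longrightarrow>
    C \<in> components (split_shadow D \<Phi> \<sigma>') \<Longrightarrow>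
    C \<subseteq> frontier R' \<Longrightarrow> R' \<subseteq> inside C \<Longrightarrow> center D \<in> inside C \<Longrightarrow>
    N \<in> regions (split_shadow D \<Phi> \<sigma>') \<Longrightarrow> C \<subseteq> frontier N \<Longrightarrow> N \<subseteq> outside C \<Longrightarrow>
    coloring D \<Phi> \<sigma>' (Rs @ [R']) N"

text \<open>The final diagram is \<open>split_shadow D \<Phi> \<sigma>\<close>; its coloured regions are listed in \<open>Rs\<close>.\<close>

definition method1 ::
  "annular_diagram \<Rightarrow> (complex \<Rightarrow> complex \<Rightarrow> complex) \<Rightarrow> (complex \<Rightarrow> crossing_state) \<Rightarrow>
   complex set list \<Rightarrow> bool" where
  "method1 D \<Phi> \<sigma> Rs \<longleftrightarrow> splitting_discs D \<Phi> \<and> (\<exists>R. coloring D \<Phi> \<sigma> Rs R \<and> \<not> bounded R)"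

text \<open>
  A region of \<open>D\<close> lies in a region of the split diagram up to the corners cut off inside the
  splitting discs.
\<close>

definition has_color ::
  "annular_diagram \<Rightarrow> (complex \<Rightarrow> complex \<Rightarrow> complex) \<Rightarrow> complex set list \<Rightarrow> complex set \<Rightarrow> nat \<Rightarrow> bool" where
  "has_color D \<Phi> Rs F k \<longleftrightarrow> F \<in> regions (shadow D) \<and> k < length Rs \<and> core D \<Phi> F \<subseteq> Rs ! k"

definition walls :: "annular_diagram \<Rightarrow> complex set set" where
  "walls D = components (shadow D - crossings D)"

definition method2_edge ::
  "annular_diagram \<Rightarrow> (complex \<Rightarrow> complex \<Rightarrow> complex) \<Rightarrow> complex set list \<Rightarrow>
   complex set \<Rightarrow> complex set \<Rightarrow> complex set \<Rightarrow> bool" where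
  "method2_edge D \<Phi> Rs F e G \<longleftrightarrow>
     F \<in> regions (shadow D) \<and> G \<in> regions (shadow D) \<and>
     e \<in> walls D \<and> e \<subseteq> frontier F \<and> e \<subseteq> frontier G \<and>
     (\<exists>k. has_color D \<Phi> Rs F k \<and>
        (has_color D \<Phi> Rs G (Suc k) \<or> Suc k = length Rs \<and> \<not> bounded G))"

text \<open>
  A path in the graph backwards along the edges, from the exterior to the center: \<open>Fs\<close> lists the
  regions visited and \<open>es\<close> the walls between them.
\<close>

definition reversed_path ::
  "annular_diagram \<Rightarrow> (complex \<Rightarrow> complex \<Rightarrow> complex) \<Rightarrow> complex set list \<Rightarrow>
   complex set list \<Rightarrow> complex set list \<Rightarrow> bool" where
  "reversed_path D \<Phi> Rs Fs es \<longleftrightarrow>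
     length Fs = Suc (length es) \<and> set Fs \<subseteq> regions (shadow D) \<and>
     \<not> bounded (hd Fs) \<and> center D \<in> last Fs \<and>
     (\<forall>i<length es. method2_edge D \<Phi> Rs (Fs ! Suc i) (es ! i) (Fs ! i))"

definition arc_of_path ::
  "annular_diagram \<Rightarrow> complex set list \<Rightarrow> complex set list \<Rightarrow> (real \<Rightarrow> complex) \<Rightarrow> bool" where
  "arc_of_path D Fs es m \<longleftrightarrow>
     arc m \<and> pathstart m \<in> hd Fs \<and> pathfinish m = center D \<and>
     (\<exists>t::nat \<Rightarrow> real. t 0 = 0 \<and> t (length Fs) = 1 \<and>
        (\<forall>i<length Fs. t i < t (Suc i) \<and> m ` {t i<..<t (Suc i)} \<subseteq> Fs ! i) \<and>
        (\<forall>i<length es. m (t (Suc i)) \<in> es ! i \<and>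
           transverse_at (shadow D) (path_image m) (m (t (Suc i)))))"

end

theory Submission
  imports Defs "HOL-Complex_Analysis.Winding_Numbers"
begin

text \<open>
Every colouring step of Method 1 produces a region together with the circuit \<open>C\<^sub>k\<close> that bounds it on
the outside. These circuits encircle the center and are pairwise disjoint, so an arc from the center
to the exterior has to cross each of them; if there are \<open>n\<close> colours, every meridian meets the
diagram in at least \<open>n\<close> points. On the other hand, an edge of the directed graph changes the colour
by exactly one, a region has at most one colour, and the exterior has none. A path from the exterior
to the center therefore has exactly \<open>n\<close> edges, and the arc it describes crosses the diagram exactly
\<open>n\<close> times. It attains the bound.

Three points need an argument.

The circuits lie on split diagrams, whereas a meridian crosses \<open>D\<close> itself, possibly inside a
splitting disc. The map \<open>push\<close> retracts every disc, without its crossing, radially onto its rim. It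
preserves the shadow and its complement, and on its image the diagram and all its splittings
coincide. A pushed meridian meets each circuit in a pushed point of \<open>D\<close>, and disjoint circuits give
different points (\<open>meridian_meets_circuit\<close>, \<open>meridian_card_ge\<close>).

The circuits are disjoint because each colouring step stays inside the region it colours
(\<open>coloured_region_shrinks\<close>), which lies outside all earlier circuits, while later splittings leave
earlier circuits untouched (\<open>circuit_persists\<close>). The first of these would break down if a region
occupied two adjacent corners of a crossing, for the splitting could then join it to a
new region. The checkerboard colouring excludes this: the parity of the winding number of the knot
projection changes across every strand (\<open>winding_number_flip\<close>), so opposite corners have equal
parity and adjacent ones do not, and splittings join opposite corners only
(\<open>region_avoids_adjacent_corners\<close>).

Finally, a path in the graph has to be realised by an arc. Its regions are pairwise different, since
their colours are. Inside each of them two prescribed boundary points are joined by an arc that near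
its ends runs along the vertical axes of charts of the diagram (\<open>arc_through_region\<close>), and these
arcs meet only at the prescribed points, so they can be concatenated.
\<close>

section \<open>Nested circuits in the plane\<close>

text \<open>
Components of compact sets are intersections of clopen sets, so \<open>K\<close> has a clopen neighbourhood in \<open>S\<close>
that avoids \<open>L\<close>. Changing \<open>S\<close> inside \<open>L\<close> keeps this neighbourhood clopen, and a connected subset of
\<open>T\<close> around \<open>K\<close> cannot leave it. This carries a circuit through the splittings made later.
\<close>

lemma component_persists:
  fixes S T :: "complex set"
  assumes "compact S" and K: "K \<in> components S" and "closed L"
    and diff: "S - L = T - L" and "K \<inter> L = {}"
  shows "K \<in> components T"
proof -
  have KS: "K \<subseteq> S" "K \<noteq> {}" "connected K"
    using K in_components_subset in_components_nonempty in_components_connected by blast+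
  have "compact K" using \<open>compact S\<close> K compact_components by blast
  have "locally compact S"
    using \<open>compact S\<close> closed_imp_locally_compact compact_imp_closed by blast
  then obtain V where V: "openin (top_of_set S) V" "compact V" "K \<subseteq> V" "V \<subseteq> - L"
    using Sura_Bura_clopen_subset[OF _ K \<open>compact K\<close>, of "- L"] \<open>closed L\<close> \<open>K \<inter> L = {}\<close>
    by (metis disjoint_eq_subset_Compl open_Compl)
  have "V \<subseteq> S" using V(1) openin_imp_subset by blast
  have VT: "V \<subseteq> T" using \<open>V \<subseteq> S\<close> V(4) diff by blast
  have "closed (S - V)"
  proof -
    have "closedin (top_of_set S) (S - V)" using V(1) by (simp add: closedin_diff)
    then show ?thesis using \<open>compact S\<close> closedin_closed_trans compact_imp_closed by blast
  qed
  have "V = T \<inter> - ((S - V) \<union> L)" using VT V(4) diff by blast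
  then have opV: "openin (top_of_set T) V"
    using \<open>closed (S - V)\<close> \<open>closed L\<close> by (metis closed_Un openin_open_Int open_Compl)
  have clV: "closedin (top_of_set T) V"
    using VT V(2) closed_subset compact_imp_closed by blast
  have maximal: "X = K" if X: "connected X" "X \<subseteq> T" "K \<subseteq> X" for X
  proof -
    have "openin (top_of_set X) (X \<inter> V)" "closedin (top_of_set X) (X \<inter> V)"
      using opV clV X(2) \<open>compact V\<close>
      by (auto simp: openin_open closedin_closed)
    then have "X \<inter> V = X"
      using X KS(2) V(3) connected_clopen by blast
    then have "X \<subseteq> S" using \<open>V \<subseteq> S\<close> by blast
    then show ?thesis using X K KS components_maximal by (metis Int_absorb2 subset_antisym)
  qed
  show ?thesis
    unfolding in_components_maximal using KS VT V(3) maximal by blast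
qed

lemma connected_component_frontier_in:
  fixes K :: "complex set"
  assumes "compact K" "x \<in> inside K"
  obtains V where "open V" "connected V" "x \<in> V" "V \<subseteq> inside K" "frontier V \<subseteq> K" "frontier V \<noteq> {}"
proof -
  define V where "V = connected_component_set (- K) x"
  have xK: "x \<notin> K" and bV: "bounded V" using assms(2) by (auto simp: inside_def V_def)
  have "open (- K)" using assms(1) compact_imp_closed by blast
  then have 1: "open V" by (simp add: V_def open_connected_component)
  have 2: "x \<in> V" using xK by (simp add: V_def)
  have 3: "V \<subseteq> inside K"
    using inside_same_component assms(2) unfolding V_def by blast
  have "V \<in> components (- K)" using xK unfolding V_def components_def by blast
  then have 4: "frontier V \<subseteq> K"
    using assms(1) frontier_of_components_closed_complement compact_imp_closed by blast
  have "V \<noteq> UNIV" using bV not_bounded_UNIV by metis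
  then have "frontier V \<noteq> {}" using 2 frontier_eq_empty by blast
  then show ?thesis using that[OF 1 _ 2 3 4] by (simp add: V_def)
qed

text \<open>
The component \<open>V\<close> of \<open>x\<close> in the complement of \<open>K\<close> does not meet \<open>C\<close>, so its closure stays inside \<open>C\<close>; as
this closure contains points of \<open>K\<close>, the whole of \<open>K\<close> lies inside \<open>C\<close>. Two disjoint circuits around the
center are thus nested.
\<close>

lemma outside_nested:
  fixes K C :: "complex set"
  assumes "compact K" "compact C" "connected K" "K \<inter> C = {}" "C \<subseteq> outside K"
    and x: "x \<in> inside K" "x \<in> inside C"
  shows "outside C \<subseteq> outside K"
proof -
  obtain V where V: "open V" "connected V" "x \<in> V" "V \<subseteq> inside K" "frontier V \<subseteq> K" "frontier V \<noteq> {}"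
    using connected_component_frontier_in assms(1) x(1) by metis
  have oK: "open (inside C)" "open (outside C)"
    using assms(2) by (auto simp: open_inside open_outside compact_imp_closed)
  have clV: "connected (closure V)" "closure V \<inter> C = {}"
  proof -
    show "connected (closure V)" using V(2) connected_imp_connected_closure by blast
    have "closure V \<subseteq> inside K \<union> K"
      using V(1,4,5) by (auto simp: frontier_def interior_open)
    then show "closure V \<inter> C = {}" using assms(4,5) inside_Int_outside by blast
  qed
  have "closure V \<subseteq> inside C"
  proof -
    have "x \<in> closure V" using V(3) closure_subset by blast
    moreover have "closure V \<subseteq> - C" using clV by blast
    ultimately have "closure V \<subseteq> connected_component_set (- C) x"
      using clV(1) connected_component_maximal by metis
    then show ?thesis using x(2) inside_same_component by blast
  qed
  then have "K \<inter> inside C \<noteq> {}" using V(5,6) frontier_subset_closed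
    by (metis DiffD1 disjoint_iff frontier_def subset_iff subsetI subset_empty)
  then have Kin: "K \<subseteq> inside C"
    using assms(3,4) inside_same_component
    by (metis (no_types, lifting) connected_component_def disjoint_eq_subset_Compl disjoint_iff subsetI)
  show ?thesis
  proof
    fix y assume y: "y \<in> outside C"
    have "connected_component_set (- C) y \<subseteq> outside C"
      using y outside_same_component by blast
    then have "connected_component_set (- C) y \<subseteq> - K"
      using Kin inside_Int_outside by blast
    moreover have "y \<in> connected_component_set (- C) y"
      using y by (simp add: outside_def)
    ultimately have "connected_component_set (- C) y \<subseteq> connected_component_set (- K) y"
      by (metis connected_component_maximal connected_connected_component)
    then show "y \<in> outside K"
      using y outside bounded_subset unfolding outside by blast
  qed
qed

section \<open>The radial push out of the splitting discs\<close>

lemma open_inj_image: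
  fixes \<phi> :: "complex \<Rightarrow> complex"
  assumes "continuous_on (cball 0 1) \<phi>" "inj_on \<phi> (cball 0 1)" "open U" "U \<subseteq> ball 0 1"
  shows "open (\<phi> ` U)"
proof (rule invariance_of_domain)
  show "continuous_on U \<phi>" "inj_on \<phi> U"
    using assms ball_subset_cball continuous_on_subset inj_on_subset by (metis subset_trans)+
qed fact

locale split_diagram =
  fixes D :: annular_diagram and \<Phi> :: "complex \<Rightarrow> complex \<Rightarrow> complex"
  assumes knot: "knot_diagram D" and discs: "splitting_discs D \<Phi>"
begin

lemma finite_crossings [simp]: "finite (crossings D)"
  using knot by (simp add: knot_diagram_def)

lemma center_not_shadow: "center D \<notin> shadow D"
  using knot by (simp add: knot_diagram_def)

lemma compact_shadow: "compact (shadow D)"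
  using knot unfolding knot_diagram_def shadow_def
  by (metis compact_continuous_image compact_sphere)

lemma crossings_subset_shadow: "crossings D \<subseteq> shadow D"
  by (auto simp: crossings_def shadow_def preimages_def)

context
  fixes c assumes c: "c \<in> crossings D"
begin

lemma chart: "crossing_chart D c (\<Phi> c)" and center_not_disc: "center D \<notin> \<Phi> c ` cball 0 1"
  using discs c by (auto simp: splitting_discs_def)

lemma chart_cont: "continuous_on (cball 0 1) (\<Phi> c)"
  and chart_inj: "inj_on (\<Phi> c) (cball 0 1)"
  and chart_zero: "\<Phi> c 0 = c"
  and chart_shadow: "shadow D \<inter> \<Phi> c ` cball 0 1 = \<Phi> c ` (horizontal \<union> vertical)"
  using chart by (auto simp: crossing_chart_def disc_chart_def)

lemma chart_eq_iff: "z \<in> cball 0 1 \<Longrightarrow> w \<in> cball 0 1 \<Longrightarrow> \<Phi> c z = \<Phi> c w \<longleftrightarrow> z = w"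
  using chart_inj by (auto simp: inj_on_def)

lemma chart_in_shadow_iff: "z \<in> cball 0 1 \<Longrightarrow> \<Phi> c z \<in> shadow D \<longleftrightarrow> Re z = 0 \<or> Im z = 0"
proof
  assume z: "z \<in> cball 0 1" "\<Phi> c z \<in> shadow D"
  then have "\<Phi> c z \<in> \<Phi> c ` (horizontal \<union> vertical)" using chart_shadow by blast
  then obtain w where "w \<in> horizontal \<union> vertical" "\<Phi> c z = \<Phi> c w" by blast
  then show "Re z = 0 \<or> Im z = 0" using chart_eq_iff[of z w] z by (auto simp: horizontal_def vertical_def)
next
  assume z: "z \<in> cball 0 1" "Re z = 0 \<or> Im z = 0"
  then have "z \<in> horizontal \<union> vertical" by (auto simp: horizontal_def vertical_def)
  then show "\<Phi> c z \<in> shadow D" using chart_shadow by blast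
qed

lemma open_chart_image: "open U \<Longrightarrow> U \<subseteq> ball 0 1 \<Longrightarrow> open (\<Phi> c ` U)"
  using open_inj_image chart_cont chart_inj by blast

lemma compact_chart_image: "compact A \<Longrightarrow> A \<subseteq> cball 0 1 \<Longrightarrow> compact (\<Phi> c ` A)"
  using chart_cont by (meson compact_continuous_image continuous_on_subset)

end

lemma disc_unique:
  "\<lbrakk>c \<in> crossings D; d \<in> crossings D; z \<in> cball 0 1; w \<in> cball 0 1; \<Phi> c z = \<Phi> d w\<rbrakk> \<Longrightarrow> c = d \<and> z = w"
proof -
  assume a: "c \<in> crossings D" "d \<in> crossings D" "z \<in> cball 0 1" "w \<in> cball 0 1" "\<Phi> c z = \<Phi> d w"
  have "c = d"
  proof (rule ccontr)
    assume "c \<noteq> d"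
    then have "\<Phi> c ` cball 0 1 \<inter> \<Phi> d ` cball 0 1 = {}"
      using discs a by (auto simp: splitting_discs_def)
    moreover have "\<Phi> c z \<in> \<Phi> c ` cball 0 1" "\<Phi> c z \<in> \<Phi> d ` cball 0 1"
      using imageI[OF a(3), of "\<Phi> c"] imageI[OF a(4), of "\<Phi> d"] unfolding a(5) by -
    ultimately show False by blast
  qed
  then show ?thesis using a chart_eq_iff by auto
qed

lemma chart_crossing_iff: "\<lbrakk>c \<in> crossings D; z \<in> cball 0 1\<rbrakk> \<Longrightarrow> \<Phi> c z \<in> crossings D \<longleftrightarrow> z = 0"
proof
  assume a: "c \<in> crossings D" "z \<in> cball 0 1" "\<Phi> c z \<in> crossings D"
  then show "z = 0" using disc_unique[of c "\<Phi> c z" z 0] chart_zero[of "\<Phi> c z"] by auto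
next
  assume "c \<in> crossings D" "z = 0"
  then show "\<Phi> c z \<in> crossings D" using chart_zero by simp
qed

text \<open>
Only the open discs count: their rims belong to the part of the plane on which the diagram and all
its splittings agree.
\<close>

definition in_disc :: "complex \<Rightarrow> bool" where
  "in_disc x \<longleftrightarrow> (\<exists>c\<in>crossings D. x \<in> \<Phi> c ` ball 0 1)"

lemma core_eq: "core D \<Phi> X = {x \<in> X. \<not> in_disc x}"
  by (auto simp: core_def in_disc_def)

lemma disc_cases:
  obtains "\<not> in_disc x" | c z where "c \<in> crossings D" "z \<in> ball 0 1" "x = \<Phi> c z"
  unfolding in_disc_def by blast

lemma chart_in_disc_iff:
  assumes "c \<in> crossings D" "z \<in> cball 0 1"
  shows "in_disc (\<Phi> c z) \<longleftrightarrow> norm z < 1"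
proof
  assume "in_disc (\<Phi> c z)"
  then obtain d w where d: "d \<in> crossings D" "w \<in> ball 0 1" "\<Phi> c z = \<Phi> d w"
    unfolding in_disc_def by blast
  then have "z = w" using disc_unique[OF assms(1) d(1) assms(2) _ d(3)] ball_subset_cball by blast
  then show "norm z < 1" using d(2) by simp
next
  assume "norm z < 1"
  then show "in_disc (\<Phi> c z)" unfolding in_disc_def using assms(1) by (intro bexI[of _ c]) auto
qed

lemma center_not_in_disc: "\<not> in_disc (center D)"
proof
  assume "in_disc (center D)"
  then obtain c z where "c \<in> crossings D" "z \<in> ball 0 1" "center D = \<Phi> c z"
    unfolding in_disc_def by blast
  then show False using center_not_disc[of c] ball_subset_cball by blast
qed

lemma open_discs: "open {x. in_disc x}"
proof -
  have "{x. in_disc x} = (\<Union>c\<in>crossings D. \<Phi> c ` ball 0 1)" by (auto simp: in_disc_def)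
  moreover have "open (\<Phi> c ` ball 0 1)" if "c \<in> crossings D" for c
    using open_chart_image[OF that open_ball order_refl] .
  ultimately show ?thesis by auto
qed

lemma bounded_discs: "bounded {x. in_disc x}"
proof -
  have "{x. in_disc x} \<subseteq> (\<Union>c\<in>crossings D. \<Phi> c ` cball 0 1)" by (auto simp: in_disc_def)
  moreover have "compact (\<Union>c\<in>crossings D. \<Phi> c ` cball 0 1)"
    using compact_chart_image[OF _ compact_cball order_refl] by (rule compact_UN[OF finite_crossings])
  ultimately show ?thesis using bounded_subset compact_imp_bounded by blast
qed

text \<open>
In a chart the push is \<open>z \<mapsto> z / |z|\<close>. This has no continuous extension to the crossing itself, but
meridians avoid crossings.
\<close>

definition push :: "complex \<Rightarrow> complex" where
  "push x = (if in_disc x then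
     (let c = SOME c. c \<in> crossings D \<and> x \<in> \<Phi> c ` ball 0 1
      in \<Phi> c (sgn (inv_into (cball 0 1) (\<Phi> c) x))) else x)"

lemma push_chart:
  assumes c: "c \<in> crossings D" and z: "z \<in> cball 0 1"  and nz: "z \<noteq> 0"
  shows "push (\<Phi> c z) = \<Phi> c (sgn z)"
proof (cases "norm z < 1")
  case True
  have "(SOME d. d \<in> crossings D \<and> \<Phi> c z \<in> \<Phi> d ` ball 0 1) = c"
  proof (rule some_equality)
    show "c \<in> crossings D \<and> \<Phi> c z \<in> \<Phi> c ` ball 0 1" using True c by auto
    fix d assume "d \<in> crossings D \<and> \<Phi> c z \<in> \<Phi> d ` ball 0 1"
    then obtain w where w: "d \<in> crossings D" "w \<in> ball 0 1" "\<Phi> c z = \<Phi> d w" by blast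
    then show "d = c" using disc_unique[OF c w(1) z _ w(3)] ball_subset_cball by blast
  qed
  then show ?thesis
    using True chart_in_disc_iff[OF c z] chart_inj[OF c] z by (simp add: push_def inv_into_f_f)
next
  case False
  then have "norm z = 1" using z by auto
  then have "sgn z = z" by (simp add: sgn_eq)
  then show ?thesis using chart_in_disc_iff[OF c z] False by (simp add: push_def)
qed

lemma push_id: "\<not> in_disc x \<Longrightarrow> push x = x"
  by (simp add: push_def)

lemma sgn_cball: "sgn z \<in> cball (0::complex) 1"
  by (simp add: norm_sgn)

lemma push_not_in_disc: assumes "x \<notin> crossings D" shows "\<not> in_disc (push x)"
proof (cases rule: disc_cases[of x])
  case 1 then show ?thesis by (simp add: push_id)
next
  case (2 c z)
  then have nz: "z \<noteq> 0" using assms chart_zero by auto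
  then show ?thesis using 2 push_chart[of c z] chart_in_disc_iff[OF 2(1) sgn_cball] by (simp add: norm_sgn)
qed

lemma push_shadow_iff: assumes "x \<notin> crossings D" shows "push x \<in> shadow D \<longleftrightarrow> x \<in> shadow D"
proof (cases rule: disc_cases[of x])
  case 1 then show ?thesis by (simp add: push_id)
next
  case (2 c z)
  then have nz: "z \<noteq> 0" using assms chart_zero by auto
  then show ?thesis
    using 2 push_chart[of c z] chart_in_shadow_iff[OF 2(1) sgn_cball, of z] chart_in_shadow_iff[OF 2(1), of z]
    by (simp add: sgn_eq)
qed

text \<open>
The push is the identity on the closed complement of the open discs and a radial projection on every
closed disc; these finitely many closed pieces agree on the rims.
\<close>

lemma continuous_on_push: "continuous_on (- crossings D) push"
proof -
  let ?B = "- {x. in_disc x} - crossings D"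
  have disc: "continuous_on (\<Phi> c ` cball 0 1 - crossings D) push" if c: "c \<in> crossings D" for c
  proof -
    have "continuous_on (\<Phi> c ` cball 0 1) (inv_into (cball 0 1) (\<Phi> c))"
      using chart_inj[OF c] by (intro continuous_on_inv[OF chart_cont[OF c]]) (auto simp: inv_into_f_f)
    then have "continuous_on (\<Phi> c ` cball 0 1 - crossings D) (inv_into (cball 0 1) (\<Phi> c))"
      by (rule continuous_on_subset) auto
    moreover have "inv_into (cball 0 1) (\<Phi> c) x \<noteq> 0" if "x \<in> \<Phi> c ` cball 0 1 - crossings D" for x
    proof
      assume 0: "inv_into (cball 0 1) (\<Phi> c) x = 0"
      have "x = \<Phi> c (inv_into (cball 0 1) (\<Phi> c) x)" using that by (simp add: f_inv_into_f)
      then show False using 0 that chart_zero c by auto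
    qed
    ultimately have "continuous_on (\<Phi> c ` cball 0 1 - crossings D) (\<lambda>x. sgn (inv_into (cball 0 1) (\<Phi> c) x))"
      unfolding sgn_div_norm by (intro continuous_intros) auto
    then have "continuous_on (\<Phi> c ` cball 0 1 - crossings D) (\<lambda>x. \<Phi> c (sgn (inv_into (cball 0 1) (\<Phi> c) x)))"
      using sgn_cball by (intro continuous_on_compose2[OF chart_cont[OF c]]) blast+
    then show ?thesis
    proof (rule continuous_on_eq)
      fix x assume x: "x \<in> \<Phi> c ` cball 0 1 - crossings D"
      then obtain z where z: "z \<in> cball 0 1" "x = \<Phi> c z" by blast
      then have "z \<noteq> 0" using x chart_zero c by auto
      then show "\<Phi> c (sgn (inv_into (cball 0 1) (\<Phi> c) x)) = push x"
        using z push_chart[OF c] chart_inj[OF c] by (simp add: inv_into_f_f)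
    qed
  qed
  have step: "continuous_on (?B \<union> (\<Union>c\<in>X. \<Phi> c ` cball 0 1 - crossings D)) push"
    if "X \<subseteq> crossings D" for X
    using finite_subset[OF that finite_crossings] that
  proof (induction X)
    case empty
    have "continuous_on ?B (\<lambda>x. x)" by (rule continuous_on_id)
    then have "continuous_on ?B push" by (rule continuous_on_eq) (simp add: push_id)
    then show ?case by simp
  next
    case (insert c X)
    let ?S = "?B \<union> (\<Union>c\<in>X. \<Phi> c ` cball 0 1 - crossings D)" and ?T = "\<Phi> c ` cball 0 1 - crossings D"
    have c: "c \<in> crossings D" and X: "X \<subseteq> crossings D" using insert by auto
    have 1: "?S = (?S \<union> ?T) \<inter> (- {x. in_disc x} \<union> (\<Union>c\<in>X. \<Phi> c ` cball 0 1))"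
      by auto
    have "compact (\<Phi> c ` cball 0 1)" if "c \<in> crossings D" for c
      using that compact_chart_image by auto
    then have cl: "closed (- {x. in_disc x} \<union> (\<Union>c\<in>X. \<Phi> c ` cball 0 1))" "closed (\<Phi> c ` cball 0 1)"
      using open_discs X c insert.hyps compact_imp_closed
      by (force intro!: closed_Un closed_UN simp: subset_iff)+
    have 2: "?T = (?S \<union> ?T) \<inter> \<Phi> c ` cball 0 1" by auto
    have "continuous_on (?S \<union> ?T) push"
    proof (rule continuous_on_Un_local)
      show "closedin (top_of_set (?S \<union> ?T)) ?S"
        by (subst 1) (rule closedin_closed_Int[OF cl(1)])
      show "closedin (top_of_set (?S \<union> ?T)) ?T"
        by (subst (2) 2) (rule closedin_closed_Int[OF cl(2)])
      show "continuous_on ?S push" by (rule insert.IH[OF X])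
    qed (rule disc[OF c])
    moreover have "?S \<union> ?T = ?B \<union> (\<Union>c\<in>insert c X. \<Phi> c ` cball 0 1 - crossings D)" by auto
    ultimately show ?case by metis
  qed
  have "- crossings D = ?B \<union> (\<Union>c\<in>crossings D. \<Phi> c ` cball 0 1 - crossings D)"
    by (auto simp: in_disc_def)
  then show ?thesis using step[of "crossings D"] by auto
qed

abbreviation split where "split \<sigma> \<equiv> split_shadow D \<Phi> \<sigma>"

lemma local_picture_cball: "local_picture s \<subseteq> cball 0 1"
proof -
  have "norm z \<le> 1" if "\<bar>Re z\<bar> + \<bar>Im z\<bar> = 1" for z
    using cmod_le[of z] that by simp
  then show ?thesis by (cases s) (auto simp: horizontal_def vertical_def)
qed

lemma closed_local_picture: "closed (local_picture s)"
proof (cases s)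
  case Unsplit
  have "horizontal = cball 0 1 \<inter> {z. Im z = 0}" "vertical = cball 0 1 \<inter> {z. Re z = 0}"
    by (auto simp: horizontal_def vertical_def)
  moreover have "closed {z. Im z = 0}" "closed {z. Re z = 0}"
    by (auto intro!: closed_Collect_eq continuous_intros)
  ultimately have "closed horizontal" and "closed vertical"
    by (metis closed_Int closed_cball)+
  then show ?thesis using Unsplit by (auto intro: closed_Un)
qed (auto intro!: closed_Collect_conj closed_Collect_eq closed_Collect_le continuous_intros)

lemma compact_local_picture: "compact (local_picture s)"
  using closed_local_picture local_picture_cball by (meson closed_subset compact_cball compact_eq_bounded_closed bounded_subset)

text \<open>
All local pictures have the same four points on the rim, the end points of the axes. This is why
splitting changes nothing outside the open discs.
\<close>

lemma rim_local_picture: "norm z = 1 \<Longrightarrow> z \<in> local_picture s \<longleftrightarrow> Re z = 0 \<or> Im z = 0"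
proof -
  assume n: "norm z = 1"
  then have *: "(Re z)\<^sup>2 + (Im z)\<^sup>2 = 1" by (simp add: cmod_def)
  have "\<bar>Re z\<bar> + \<bar>Im z\<bar> = 1 \<longleftrightarrow> Re z = 0 \<or> Im z = 0"
  proof
    assume "\<bar>Re z\<bar> + \<bar>Im z\<bar> = 1"
    then have "(\<bar>Re z\<bar> + \<bar>Im z\<bar>)^2 = 1" by simp
    then have "\<bar>Re z\<bar> * \<bar>Im z\<bar> = 0" using * by (simp add: power2_sum)
    then show "Re z = 0 \<or> Im z = 0" by simp
  next
    assume "Re z = 0 \<or> Im z = 0"
    then show "\<bar>Re z\<bar> + \<bar>Im z\<bar> = 1" using * by (auto simp: power2_eq_1_iff abs_if)
  qed
  then show ?thesis using n by (cases s) (auto simp: horizontal_def vertical_def)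
qed

lemma split_off_discs: "\<not> in_disc x \<Longrightarrow> x \<in> split \<sigma> \<longleftrightarrow> x \<in> shadow D"
proof
  assume x: "\<not> in_disc x" "x \<in> split \<sigma>"
  then consider "x \<in> shadow D" | c z where "c \<in> crossings D" "z \<in> local_picture (\<sigma> c)" "x = \<Phi> c z"
    by (auto simp: split_shadow_def core_eq)
  then show "x \<in> shadow D"
  proof cases
    case 2
    then have z: "z \<in> cball 0 1" using local_picture_cball by blast
    then have "norm z = 1" using x 2 chart_in_disc_iff[of c z] by auto
    then show ?thesis using 2 z rim_local_picture chart_in_shadow_iff by auto
  qed
qed (auto simp: split_shadow_def core_eq)

lemma chart_in_split_iff:
  "\<lbrakk>c \<in> crossings D; z \<in> cball 0 1\<rbrakk> \<Longrightarrow> \<Phi> c z \<in> split \<sigma> \<longleftrightarrow> z \<in> local_picture (\<sigma> c)"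
proof
  assume a: "c \<in> crossings D" "z \<in> cball 0 1" "\<Phi> c z \<in> split \<sigma>"
  show "z \<in> local_picture (\<sigma> c)"
  proof (cases "norm z < 1")
    case True
    then have "\<not> \<Phi> c z \<in> core D \<Phi> (shadow D)" using a chart_in_disc_iff by (auto simp: core_eq)
    then obtain d w where d: "d \<in> crossings D" "w \<in> local_picture (\<sigma> d)" "\<Phi> c z = \<Phi> d w"
      using a(3) by (auto simp: split_shadow_def)
    then show ?thesis using disc_unique[of c d z w] a local_picture_cball by blast
  next
    case False
    then have "norm z = 1" using a by auto
    moreover have "\<not> in_disc (\<Phi> c z)" using a False chart_in_disc_iff by auto
    ultimately show ?thesis using a split_off_discs chart_in_shadow_iff rim_local_picture by blast
  qed
qed (auto simp: split_shadow_def)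

lemma compact_split: "compact (split \<sigma>)"
proof -
  have "core D \<Phi> (shadow D) = shadow D \<inter> - {x. in_disc x}" by (auto simp: core_eq)
  then have "compact (core D \<Phi> (shadow D))"
    using compact_shadow open_discs by (metis closed_Compl compact_Int_closed)
  moreover have "compact (\<Union>c\<in>crossings D. \<Phi> c ` local_picture (\<sigma> c))"
    by (rule compact_UN[OF finite_crossings])
       (rule compact_chart_image, auto intro: compact_local_picture local_picture_cball[THEN subsetD])
  ultimately show ?thesis unfolding split_shadow_def by (rule compact_Un)
qed

lemma split_Unsplit: "split (\<lambda>_. Unsplit) = shadow D"
proof (rule set_eqI)
  fix x show "x \<in> split (\<lambda>_. Unsplit) \<longleftrightarrow> x \<in> shadow D"
  proof (cases rule: disc_cases[of x])
    case 1 then show ?thesis by (simp add: split_off_discs)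
  next
    case (2 c z)
    then show ?thesis using chart_in_split_iff[of c z] chart_in_shadow_iff[of c z]
      by (auto simp: horizontal_def vertical_def)
  qed
qed

section \<open>Disjoint circuits bound the number of crossings of a meridian\<close>

text \<open>
The pushed meridian starts inside \<open>K\<close>. It ends outside \<open>K\<close>: the unbounded region of the diagram stays
unbounded and off \<open>K\<close> when it is pushed. So the pushed meridian meets \<open>K\<close>, and since it avoids the open
discs, it does so at the image of a point of the diagram.
\<close>

lemma meridian_meets_circuit:
  assumes m: "meridian D m" and K: "connected K" "K \<subseteq> split \<sigma>" "compact K"
    and inside: "center D \<in> inside K"
  shows "\<exists>p. p \<in> path_image m \<inter> shadow D \<and> push p \<in> K"
proof -
  have arc: "arc m" and st: "pathstart m = center D" and fin: "pathfinish m \<in> outside (shadow D)"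
    and nc: "\<And>p. p \<in> path_image m \<inter> shadow D \<Longrightarrow> p \<notin> crossings D"
    using m by (auto simp: meridian_def)
  have sub: "path_image m \<subseteq> - crossings D" using nc crossings_subset_shadow by blast
  let ?q = "pathfinish m"
  define U where "U = connected_component_set (- shadow D) ?q"
  have U: "connected U" "\<not> bounded U" "?q \<in> U" "U \<subseteq> - shadow D"
    using fin connected_component_subset by (auto simp: U_def outside_def)
  have "U \<subseteq> - crossings D" using U(4) crossings_subset_shadow by blast
  then have "connected (push ` U)"
    using U(1) continuous_on_push continuous_on_subset connected_continuous_image by metis
  have offK: "push ` U \<inter> K = {}"
  proof -
    have "push x \<notin> split \<sigma>" if "x \<in> U" for x
      using that \<open>U \<subseteq> - crossings D\<close> U(4) push_not_in_disc push_shadow_iff split_off_discs by blast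
    then show ?thesis using K(2) by blast
  qed
  \<comment> \<open>Pushing moves points only within the bounded union of the discs.\<close>
  have "\<not> bounded (push ` U)"
  proof
    assume "bounded (push ` U)"
    moreover have "U \<subseteq> push ` U \<union> {x. in_disc x}"
      using push_id by (metis (mono_tags, lifting) Un_iff imageI mem_Collect_eq subsetI)
    ultimately show False using U(2) bounded_discs bounded_subset by (metis bounded_Un)
  qed
  then have "push ?q \<in> outside K"
    using \<open>connected (push ` U)\<close> offK U(3) unfolding outside
    by (metis (no_types, lifting) bounded_subset connected_component_maximal disjoint_eq_subset_Compl imageI mem_Collect_eq)
  moreover have "push (center D) = center D" by (simp add: push_id center_not_in_disc)
  moreover have "connected (push ` path_image m)"
    using sub arc continuous_on_push continuous_on_subset connected_continuous_image
      arc_imp_path connected_path_image by metis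
  ultimately have "push ` path_image m \<inter> K \<noteq> {}"
  proof -
    assume a: "push ?q \<in> outside K" "push (center D) = center D" "connected (push ` path_image m)"
    show ?thesis
    proof
      assume "push ` path_image m \<inter> K = {}"
      then have "push ` path_image m \<subseteq> connected_component_set (- K) (center D)"
        using a st by (intro connected_component_maximal) (auto simp: image_iff, metis pathstart_in_path_image)
      then have "push ?q \<in> inside K"
        using inside inside_same_component by blast
      then show False using a(1) inside_Int_outside by blast
    qed
  qed
  then obtain p where p: "p \<in> path_image m" "push p \<in> K" by blast
  then have "push p \<in> shadow D"
    using K(2) split_off_discs push_not_in_disc sub by blast
  then have "p \<in> shadow D" using p sub push_shadow_iff by blast
  then show ?thesis using p by blast
qed

lemma meridian_card_ge:
  assumes m: "meridian D m"
    and Cs: "\<And>k. k < n \<Longrightarrow> C k \<in> components (split \<sigma>)" "\<And>k. k < n \<Longrightarrow> center D \<in> inside (C k)"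
    and disj: "\<And>j k. j < k \<Longrightarrow> k < n \<Longrightarrow> C j \<inter> C k = {}"
  shows "n \<le> card (path_image m \<inter> shadow D)"
proof -
  have "\<exists>p. p \<in> path_image m \<inter> shadow D \<and> push p \<in> C k" if "k < n" for k
  proof -
    note C = Cs(1)[OF that]
    have "connected (C k)" "C k \<subseteq> split \<sigma>" "compact (C k)"
      using in_components_connected[OF C] in_components_subset[OF C] compact_components[OF compact_split C] .
    then show ?thesis using meridian_meets_circuit[OF m _ _ _ Cs(2)[OF that]] by blast
  qed
  then have "\<forall>k. \<exists>p. k < n \<longrightarrow> p \<in> path_image m \<inter> shadow D \<and> push p \<in> C k" by blast
  from choice[OF this] obtain p where
    p: "\<And>k. k < n \<Longrightarrow> p k \<in> path_image m \<inter> shadow D" "\<And>k. k < n \<Longrightarrow> push (p k) \<in> C k"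
    by blast
  have "inj_on p {..<n}"
  proof (rule linorder_inj_onI')
    fix x y assume "x < y" "x \<in> {..<n}" "y \<in> {..<n}"
    then have "push (p x) \<in> C x" "push (p y) \<in> C y" "C x \<inter> C y = {}" using p(2) disj by auto
    then show "p x \<noteq> p y" by auto
  qed
  then have "n = card (p ` {..<n})" by (simp add: card_image)
  also have "\<dots> \<le> card (path_image m \<inter> shadow D)"
    using m p(1) by (intro card_mono image_subsetI) (simp_all add: meridian_def)
  finally show ?thesis .
qed

end

section \<open>Checkerboard parity\<close>

text \<open>
The closed set \<open>W\<close> certifies that \<open>U\<close> is closed relative to \<open>T\<close>.
\<close>

lemma connected_within_clopen:
  assumes "connected T" "T \<inter> U \<noteq> {}" "open U" "closed W" "T \<inter> U = T \<inter> W"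
  shows "T \<subseteq> U"
proof -
  have "openin (top_of_set T) (T \<inter> U)" "closedin (top_of_set T) (T \<inter> U)"
    using openin_open_Int[OF assms(3), of T] closedin_closed_Int[OF assms(4), of T] assms(5) by simp_all
  then have "T \<inter> U = T" using assms(1,2) connected_clopen by blast
  then show ?thesis by blast
qed

text \<open>
In the chart the curve \<open>g\<close> runs once along the horizontal diameter. Replacing this piece by the upper
half of the rim gives a loop that misses the open disc, so its winding number is the same on
both sides of the diameter. The difference of the two loops is the boundary \<open>J\<close> of the upper half disc,
a simple closed curve that winds once around the upper point and not at all around the lower one.
\<close>

lemma winding_number_flip:
  fixes \<phi> :: "complex \<Rightarrow> complex" and g :: "real \<Rightarrow> complex"
  assumes g: "path g" "pathfinish g = pathstart g"
    and \<phi>: "continuous_on (cball 0 1) \<phi>" "inj_on \<phi> (cball 0 1)"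
    and flat: "path_image g \<inter> \<phi> ` cball 0 1 = \<phi> ` horizontal"
    and simple: "\<And>s t. \<lbrakk>s \<in> {0..1}; t \<in> {0..1}; g s \<in> \<phi> ` horizontal; g s = g t\<rbrakk> \<Longrightarrow> s = t"
  shows "norm (winding_number g (\<phi> (\<i>/2)) - winding_number g (\<phi> (-\<i>/2))) = 1"
proof -
  have H: "horizontal = of_real ` {-1..1}" "horizontal \<subseteq> cball 0 1" "compact horizontal"
  proof -
    show *: "horizontal = of_real ` {-1..1}"
    proof (intro equalityI subsetI)
      fix z assume "z \<in> horizontal"
      then have z: "norm z \<le> 1" "Im z = 0" by (auto simp: horizontal_def)
      then have "z = of_real (Re z)" "\<bar>Re z\<bar> \<le> 1"
        using abs_Re_le_cmod[of z] by (auto simp: complex_eq_iff)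
      then show "z \<in> of_real ` {-1..1}" by (intro image_eqI[of _ _ "Re z"]) auto
    qed (auto simp: horizontal_def)
    show "horizontal \<subseteq> cball 0 1" by (auto simp: horizontal_def)
    show "compact horizontal"
      unfolding * by (intro compact_continuous_image continuous_intros) auto
  qed
  have \<phi>eq: "\<phi> z = \<phi> w \<longleftrightarrow> z = w" if "z \<in> cball 0 1" "w \<in> cball 0 1" for z w
    using that \<phi>(2) by (auto simp: inj_on_def)
  have cg: "continuous_on {0..1} g" using g(1) by (simp add: path_def)
  \<comment> \<open>The times spent in the disc form an interval \<open>A = {a..b}\<close>, as \<open>g\<close> is a homeomorphism from \<open>A\<close> to the diameter.\<close>
  define A where "A = {t \<in> {0..1}. g t \<in> \<phi> ` horizontal}"
  have "compact (\<phi> ` horizontal)"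
    using \<phi>(1) H continuous_on_subset compact_continuous_image by metis
  then have "closed (\<phi> ` horizontal)" by (rule compact_imp_closed)
  then have "closedin (top_of_set {0..1}) ({0..1} \<inter> g -` \<phi> ` horizontal)"
    by (rule continuous_closedin_preimage[OF cg])
  then have "compact A"
    using closedin_compact[of "{0..1}"] by (auto simp: A_def vimage_def Int_def)
  have A01: "A \<subseteq> {0..1}" by (auto simp: A_def)
  have gA: "g ` A = \<phi> ` horizontal"
  proof
    show "\<phi> ` horizontal \<subseteq> g ` A"
    proof
      fix y assume "y \<in> \<phi> ` horizontal"
      moreover from this obtain t where "t \<in> {0..1}" "y = g t"
        using flat unfolding path_image_def by blast
      ultimately show "y \<in> g ` A" unfolding A_def by (intro image_eqI[of _ _ t]) simp_all
    qed
  qed (auto simp: A_def)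
  have injA: "inj_on g A"
    by (rule inj_onI) (use simple in \<open>auto simp: A_def\<close>)
  have cgA: "continuous_on A g" using cg A01 continuous_on_subset by blast
  have "continuous_on (g ` A) (the_inv_into A g)"
    by (rule continuous_on_inv_into[OF cgA \<open>compact A\<close> injA])
  moreover have "connected (g ` A)"
  proof -
    have "connected horizontal" unfolding H(1)
      by (intro connected_continuous_image continuous_intros) auto
    then show ?thesis unfolding gA
      using \<phi>(1) H(2) by (meson connected_continuous_image continuous_on_subset)
  qed
  ultimately have "connected (the_inv_into A g ` g ` A)"
    by (rule connected_continuous_image)
  then have "connected A" using injA by (simp add: the_inv_into_onto)
  then obtain a b where ab: "A = {a..b}"
    using \<open>compact A\<close> connected_compact_interval_1 by blast
  define h where "h = Re \<circ> the_inv_into (cball 0 1) \<phi> \<circ> g"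
  have hg: "g t = \<phi> (of_real (h t))" "h t \<in> {-1..1}" if t: "t \<in> A" for t
  proof -
    obtain x where x: "x \<in> {-1..1}" "g t = \<phi> (of_real x)"
      using gA H(1) t by (metis (no_types, lifting) image_iff)
    then have "(of_real x :: complex) \<in> cball 0 1" by auto
    then have "h t = x" using x(2) \<phi>(2) by (simp add: h_def the_inv_into_f_f)
    then show "g t = \<phi> (of_real (h t))" "h t \<in> {-1..1}" using x by auto
  qed
  have conth: "continuous_on A h"
  proof -
    have "continuous_on (\<phi> ` cball 0 1) (the_inv_into (cball 0 1) \<phi>)"
      by (rule continuous_on_inv_into[OF \<phi>(1) _ \<phi>(2)]) simp
    moreover have "g ` A \<subseteq> \<phi> ` cball 0 1" using gA H(2) by blast
    ultimately have "continuous_on A (\<lambda>t. the_inv_into (cball 0 1) \<phi> (g t))"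
      using continuous_on_compose2[OF _ cgA] by blast
    then show ?thesis unfolding h_def o_def by (rule continuous_on_Re)
  qed
  have injh: "inj_on h A"
    by (rule inj_onI) (metis hg(1) injA inj_onD)
  have hA: "h ` A = {-1..1}"
  proof
    show "{-1..1} \<subseteq> h ` A"
    proof
      fix x :: real assume x: "x \<in> {-1..1}"
      then have "\<phi> (of_real x) \<in> g ` A" unfolding gA H(1) by blast
      then obtain t where t: "t \<in> A" "\<phi> (of_real x) = g t" by (rule imageE)
      have "\<bar>x\<bar> \<le> 1" "\<bar>h t\<bar> \<le> 1" using x hg(2)[OF t(1)] by auto
      then have "(of_real x :: complex) = of_real (h t)"
        using t(2) hg(1)[OF t(1)] \<phi>eq[of "of_real x" "of_real (h t)"] by simp
      then have "x = h t" by (simp only: of_real_eq_iff)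
      then show "x \<in> h ` A" using t(1) by (rule image_eqI)
    qed
  qed (use hg in blast)
  have "A \<noteq> {}" using hA by auto
  then have "a \<le> b" using ab by simp
  \<comment> \<open>A monotone bijection takes the end points of \<open>A\<close> to those of the diameter; the direction is unknown.\<close>
  have ends: "(h a = 1 \<and> h b = -1) \<or> (h a = -1 \<and> h b = 1)"
  proof -
    have "1 \<in> h ` A" "-1 \<in> h ` A" unfolding hA by auto
    then obtain s r where s: "s \<in> A" "h s = 1" and r: "r \<in> A" "h r = -1" by (auto simp: image_iff)
    have b: "h a \<le> 1" "h a \<ge> -1" "h b \<le> 1" "h b \<ge> -1"
      using hg(2)[of a] hg(2)[of b] ab \<open>a \<le> b\<close> by auto
    have "strict_mono_on A h \<or> strict_antimono_on A h"
    proof -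
      have "is_interval A" unfolding ab by (rule is_interval_cc)
      from injective_eq_monotone_map[OF this conth] injh show ?thesis by blast
    qed
    then show ?thesis
    proof
      assume *: "strict_mono_on A h"
      have "h x \<le> h y" if "x \<in> A" "y \<in> A" "x \<le> y" for x y
        using monotone_onD[OF *, of x y] that by (cases "x = y") auto
      from this[of s b] this[of a r] show ?thesis using s r b ab \<open>a \<le> b\<close> by auto
    next
      assume *: "strict_antimono_on A h"
      have "h y \<le> h x" if "x \<in> A" "y \<in> A" "x \<le> y" for x y
        using monotone_onD[OF *, of x y] that by (cases "x = y") auto
      from this[of a s] this[of r b] show ?thesis using s r b ab \<open>a \<le> b\<close> by auto
    qed
  qed
  then have "a < b" using \<open>a \<le> b\<close> by (cases "a = b") auto
  have ab01: "a \<in> {0..1}" "b \<in> {0..1}" using A01 ab \<open>a \<le> b\<close> by auto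
  define arcp where "arcp = (if h a = 1 then part_circlepath 0 1 0 pi else reversepath (part_circlepath 0 1 0 pi))"
  have p: "arc arcp" "pathstart arcp = of_real (h a)" "pathfinish arcp = of_real (h b)"
      "path_image arcp = {z. norm z = 1 \<and> Im z \<ge> 0}"
  proof -
    show "arc arcp" by (auto simp: arcp_def intro!: arc_part_circlepath arc_reversepath)
    show "pathstart arcp = of_real (h a)" "pathfinish arcp = of_real (h b)"
      using ends by (auto simp: arcp_def)
    have "path_image arcp = cis ` {0..pi}"
      using pi_ge_zero by (auto simp: arcp_def path_image_part_circlepath' closed_segment_eq_real_ivl simp del: pi_ge_zero)
    also have "\<dots> = {z. norm z = 1 \<and> Im z \<ge> 0}"
    proof (intro equalityI subsetI)
      fix z :: complex assume z: "z \<in> {z. norm z = 1 \<and> Im z \<ge> 0}"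
      then have "z \<noteq> 0" "sgn z = z" by (auto simp: sgn_eq)
      then have "z = cis (Arg z)" using cis_Arg[of z] by simp
      moreover have "Arg z \<in> {0..pi}" using z Arg_bounded[of z] Arg_less_0[of z] by simp
      ultimately show "z \<in> cis ` {0..pi}" by (rule image_eqI)
    qed (auto simp: sin_ge_zero)
    finally show "path_image arcp = {z. norm z = 1 \<and> Im z \<ge> 0}" .
  qed
  have pc: "path_image arcp \<subseteq> cball 0 1" using p(4) by auto
  define s where "s = \<phi> \<circ> arcp"
  have s: "arc s" "pathstart s = g a" "pathfinish s = g b" "path_image s = \<phi> ` {z. norm z = 1 \<and> Im z \<ge> 0}"
  proof -
    show "arc s"
      using p(1) pc \<phi> unfolding s_def arc_def
      by (metis comp_inj_on continuous_on_subset inj_on_subset path_continuous_image path_image_def)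
    show "pathstart s = g a" "pathfinish s = g b"
      using p hg(1)[of a] hg(1)[of b] ab \<open>a \<le> b\<close> by (auto simp: s_def pathstart_compose pathfinish_compose)
    show "path_image s = \<phi> ` {z. norm z = 1 \<and> Im z \<ge> 0}"
      using p(4) by (simp add: s_def path_image_compose)
  qed
  define g1 g2 g3 where "g1 = subpath 0 a g" and "g2 = subpath a b g" and "g3 = subpath b 1 g"
  have gs: "path g1" "path g2" "path g3" using g(1) ab01 by (auto simp: g1_def g2_def g3_def)
  have img2: "path_image g2 = \<phi> ` horizontal"
    using gA ab \<open>a \<le> b\<close> by (simp add: g2_def path_image_subpath)
  have "arc g2"
    unfolding g2_def arc_subpath_eq using gs(2) \<open>a < b\<close> injA ab
    by (auto simp: g2_def closed_segment_eq_real_ivl)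
  define J where "J = g2 +++ reversepath s"
  have J: "simple_path J" "pathfinish J = pathstart J"
  proof -
    have "\<phi> ` horizontal \<inter> \<phi> ` {z. norm z = 1 \<and> Im z \<ge> 0} \<subseteq> {\<phi> 1, \<phi> (-1)}"
    proof
      fix y assume "y \<in> \<phi> ` horizontal \<inter> \<phi> ` {z. norm z = 1 \<and> Im z \<ge> 0}"
      then obtain z w where zw: "z \<in> horizontal" "norm w = 1" "y = \<phi> z" "y = \<phi> w" by auto
      then have "z = w" using \<phi>eq[of z w] H(2) by auto
      then have "\<bar>Re z\<bar> = 1" "Im z = 0" using zw by (auto simp: horizontal_def cmod_def)
      then have "z = 1 \<or> z = -1" by (auto simp: complex_eq_iff)
      then show "y \<in> {\<phi> 1, \<phi> (-1)}" using zw by auto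
    qed
    moreover have "g a \<in> {\<phi> 1, \<phi> (-1)}" "g b \<in> {\<phi> 1, \<phi> (-1)}" "{g a, g b} = {\<phi> 1, \<phi> (-1)}"
      using ends hg(1)[of a] hg(1)[of b] ab \<open>a \<le> b\<close> by auto
    ultimately have "path_image g2 \<inter> path_image (reversepath s) \<subseteq> {pathstart g2, pathstart (reversepath s)}"
      using img2 s(3,4) by (simp add: g2_def)
    then show "simple_path J" unfolding J_def
      using \<open>arc g2\<close> s by (intro simple_path_join_loop) (auto simp: g2_def arc_reversepath)
    show "pathfinish J = pathstart J" using s by (simp add: J_def g2_def)
  qed
  have imJ: "path_image J = \<phi> ` (horizontal \<union> {z. norm z = 1 \<and> Im z \<ge> 0})"
    using s img2 by (simp add: J_def path_image_join g2_def image_Un)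
  \<comment> \<open>The inside of \<open>J\<close> is the open upper half disc: connected sets that miss \<open>J\<close> cannot leave it.\<close>
  define U where "U = \<phi> ` {z \<in> ball 0 1. Im z > 0}"
  define W where "W = \<phi> ` {z \<in> cball 0 1. Im z \<ge> 0}"
  have "{z::complex \<in> ball 0 1. Im z > 0} = ball 0 1 \<inter> {z. Im z > 0}" by auto
  then have "open {z::complex \<in> ball 0 1. Im z > 0}" by (simp add: open_halfspace_Im_gt open_Int)
  then have oU: "open U" unfolding U_def by (intro open_inj_image[OF \<phi>]) auto
  have "{z::complex \<in> cball 0 1. Im z \<ge> 0} = cball 0 1 \<inter> {z. Im z \<ge> 0}" by auto
  then have "compact {z::complex \<in> cball 0 1. Im z \<ge> 0}"
    by (simp add: closed_halfspace_Im_ge compact_Int_closed)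
  then have "compact W" unfolding W_def
    by (rule compact_continuous_image[rotated]) (rule continuous_on_subset[OF \<phi>(1)], auto)
  have UW: "W = U \<union> path_image J"
    unfolding imJ U_def W_def image_Un[symmetric] by (rule arg_cong[of _ _ "(`) \<phi>"]) (auto simp: horizontal_def)
  have UJ: "U \<inter> path_image J = {}"
  proof -
    have "\<phi> z \<noteq> \<phi> w" if "z \<in> ball 0 1" "Im z > 0" "w \<in> horizontal \<union> {z. norm z = 1 \<and> Im z \<ge> 0}" for z w
    proof -
      have "z \<in> cball 0 1" "w \<in> cball 0 1" "z \<noteq> w" using that by (auto simp: horizontal_def)
      then show ?thesis using \<phi>eq by blast
    qed
    then show ?thesis unfolding imJ U_def by blast
  qed
  have sub: "T \<subseteq> U" if "connected T" "T \<inter> path_image J = {}" "T \<inter> U \<noteq> {}" for T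
    using connected_within_clopen[OF that(1,3) oU compact_imp_closed[OF \<open>compact W\<close>]] that(2) UW by blast
  have half: "\<i>/2 \<in> ball (0::complex) 1" "-\<i>/2 \<in> ball (0::complex) 1" "Im (\<i>/2) > 0" by (auto simp: norm_divide)
  have zU: "\<phi> (\<i>/2) \<in> U" using half by (auto simp: U_def)
  have "bounded U" using \<open>compact W\<close> UW compact_imp_bounded bounded_subset by (metis Un_upper1)
  have zin: "\<phi> (\<i>/2) \<in> inside (path_image J)"
  proof -
    have nJ: "\<phi> (\<i>/2) \<notin> path_image J" using zU UJ by blast
    have "connected_component_set (- path_image J) (\<phi> (\<i>/2)) \<subseteq> U"
    proof (rule sub)
      show "connected_component_set (- path_image J) (\<phi> (\<i>/2)) \<inter> path_image J = {}"
        using connected_component_subset[of "- path_image J" "\<phi> (\<i>/2)"] by blast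
      have "\<phi> (\<i>/2) \<in> connected_component_set (- path_image J) (\<phi> (\<i>/2))"
        using nJ by (simp add: connected_component_refl_eq)
      then show "connected_component_set (- path_image J) (\<phi> (\<i>/2)) \<inter> U \<noteq> {}"
        using zU by blast
    qed simp
    then show ?thesis using nJ \<open>bounded U\<close> bounded_subset by (auto simp: inside_def)
  qed
  have "inside (path_image J) \<subseteq> U"
    using zin zU Jordan_inside_outside[OF J] by (intro sub) auto
  moreover have "\<phi> (-\<i>/2) \<notin> W"
  proof
    assume "\<phi> (-\<i>/2) \<in> W"
    then obtain w where w: "w \<in> cball 0 1" "Im w \<ge> 0" "\<phi> (-\<i>/2) = \<phi> w" by (auto simp: W_def)
    then have "-\<i>/2 = w" using \<phi>eq[of "-\<i>/2" w] half by auto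
    then show False using w(2) by auto
  qed
  ultimately have wout: "\<phi> (-\<i>/2) \<in> outside (path_image J)"
    using UW inside_Un_outside[of "path_image J"] by blast
  have wJ: "norm (winding_number J (\<phi> (\<i>/2))) = 1" "winding_number J (\<phi> (-\<i>/2)) = 0"
  proof -
    show "norm (winding_number J (\<phi> (\<i>/2))) = 1"
      using J(1) zin by (rule simple_closed_path_norm_winding_number_inside)
    show "winding_number J (\<phi> (-\<i>/2)) = 0"
      using J wout by (intro winding_number_zero_in_outside) (auto simp: simple_path_imp_path)
  qed
  define g' where "g' = g1 +++ s +++ g3"
  have ps: "path s" using s(1) by (rule arc_imp_path)
  have g': "path g'" "pathfinish g' = pathstart g'"
    using gs ps s g(2) unfolding g'_def by (simp_all add: g1_def g3_def) (simp add: pathfinish_def pathstart_def)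
  have off: "\<phi> ` ball 0 1 \<inter> path_image g' = {}"
  proof -
    have n1: "g t \<noteq> \<phi> z" if t: "t \<in> {0..a} \<union> {b..1}" and z: "z \<in> ball 0 1" for t z
    proof
      assume eq: "g t = \<phi> z"
      have t01: "t \<in> {0..1}" using t ab01 by auto
      have "g t \<in> \<phi> ` horizontal"
        using flat eq z t01 by (metis IntI ball_subset_cball image_eqI path_image_def subsetD)
      then have "t \<in> A" using t01 by (simp add: A_def)
      then have "t = a \<or> t = b" using t ab by auto
      then have "h t = 1 \<or> h t = -1" using ends by blast
      then have "\<phi> z = \<phi> 1 \<or> \<phi> z = \<phi> (-1)" using eq hg(1)[OF \<open>t \<in> A\<close>] by auto
      then have "z = 1 \<or> z = -1" using \<phi>eq[of z 1] \<phi>eq[of z "-1"] z by auto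
      then show False using z by auto
    qed
    have n2: "\<phi> w \<noteq> \<phi> z" if "norm w = 1" "z \<in> ball 0 1" for w z
      using \<phi>eq[of w z] that by auto
    have n3: "path_image g' \<subseteq> g ` ({0..a} \<union> {b..1}) \<union> \<phi> ` {z. norm z = 1 \<and> Im z \<ge> 0}"
    proof -
      have "path_image g' \<subseteq> path_image g1 \<union> (path_image s \<union> path_image g3)"
        unfolding g'_def using path_image_join_subset by (metis (no_types, lifting) Un_mono order_refl subset_trans)
      then show ?thesis using ab01 s(4) by (auto simp: g1_def g3_def path_image_subpath)
    qed
    show ?thesis
    proof (rule ccontr)
      assume "\<phi> ` ball 0 1 \<inter> path_image g' \<noteq> {}"
      then obtain z where z: "z \<in> ball 0 1" "\<phi> z \<in> path_image g'" by blast
      then consider t where "t \<in> {0..a} \<union> {b..1}" "\<phi> z = g t" | w where "norm w = 1" "\<phi> z = \<phi> w"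
        using n3 by blast
      then show False using n1 n2 z(1) by cases metis+
    qed
  qed
  have img: "path_image g1 \<subseteq> path_image g" "path_image g2 \<subseteq> path_image g" "path_image g3 \<subseteq> path_image g"
    unfolding g1_def g2_def g3_def using ab01 by (intro path_image_subpath_subset; simp)+
  have diff: "winding_number g z - winding_number g' z = winding_number J z"
    if z: "z = \<phi> w" "w \<in> ball 0 1" "Im w \<noteq> 0" for z w
  proof -
    have zg: "z \<notin> path_image g"
    proof
      assume "z \<in> path_image g"
      then have "\<phi> w \<in> \<phi> ` horizontal" using flat z ball_subset_cball by blast
      then obtain v where "v \<in> horizontal" "\<phi> w = \<phi> v" by blast
      then have "w = v" using \<phi>eq[of w v] z H(2) by auto
      then show False using z \<open>v \<in> horizontal\<close> by (auto simp: horizontal_def)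
    qed
    have zs: "z \<notin> path_image s"
    proof
      assume "z \<in> path_image s"
      then obtain v where "norm v = 1" "\<phi> w = \<phi> v" using s(4) z by auto
      then have "w = v" using \<phi>eq[of w v] z by auto
      then show False using z \<open>norm v = 1\<close> by auto
    qed
    have z123: "z \<notin> path_image g1" "z \<notin> path_image g2" "z \<notin> path_image g3" using zg img by blast+
    have fin: "pathfinish g1 = pathstart s" "pathfinish s = pathstart g3" "pathfinish g2 = pathstart (reversepath s)"
      using s by (auto simp: g1_def g2_def g3_def)
    have "winding_number g z = winding_number g1 z + winding_number g2 z + winding_number g3 z"
      using winding_number_subpath_combine[OF g(1) zg, of 0 a b] winding_number_subpath_combine[OF g(1) zg, of 0 b 1] ab01
      by (simp add: g1_def g2_def g3_def)
    moreover have "winding_number g' z = winding_number g1 z + (winding_number s z + winding_number g3 z)"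
      unfolding g'_def using gs ps z123 zs fin
      by (subst winding_number_join; (subst winding_number_join)?) (auto simp: path_image_join)
    moreover have "winding_number J z = winding_number g2 z - winding_number s z"
      unfolding J_def using gs ps z123 zs fin
      by (subst winding_number_join) (auto simp: winding_number_reversepath)
    ultimately show ?thesis by simp
  qed
  have "connected (\<phi> ` ball 0 1)"
    by (rule connected_continuous_image[OF continuous_on_subset[OF \<phi>(1)]]) auto
  then have "winding_number g' (\<phi> (\<i>/2)) = winding_number g' (\<phi> (-\<i>/2))"
    using winding_number_eq[OF g' imageI[OF half(1)] imageI[OF half(2)] _ off] by blast
  then have "winding_number g (\<phi> (\<i>/2)) - winding_number g (\<phi> (-\<i>/2)) = winding_number J (\<phi> (\<i>/2))"
    using diff[of "\<phi> (\<i>/2)" "\<i>/2"] diff[of "\<phi> (-\<i>/2)" "-\<i>/2"] half wJ(2) by (simp add: algebra_simps)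
  then show ?thesis using wJ(1) by simp
qed

context split_diagram
begin

definition loop :: "real \<Rightarrow> complex" where
  "loop = curve D \<circ> circlepath 0 1"

text \<open>
The two classes of the checkerboard colouring of the regions of the diagram.
\<close>

definition odd_winding :: "complex \<Rightarrow> bool" where
  "odd_winding z \<longleftrightarrow> (\<exists>n. odd n \<and> winding_number loop z = of_int n)"

lemma path_image_loop: "path_image loop = shadow D"
  by (simp add: loop_def path_image_compose shadow_def)

lemma path_loop: "path loop"
  unfolding loop_def
  by (rule path_continuous_image) (use knot in \<open>auto simp: knot_diagram_def\<close>)

lemma closed_loop: "pathfinish loop = pathstart loop"
  by (simp add: loop_def pathfinish_compose pathstart_compose)

lemma winding_loop_int: assumes "z \<notin> shadow D" obtains n where "winding_number loop z = of_int n"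
  using integer_winding_number[OF path_loop closed_loop] assms path_image_loop by (metis Ints_cases)

lemma odd_winding_const:
  assumes "connected S" "S \<inter> shadow D = {}" "x \<in> S" "y \<in> S"
  shows "odd_winding x = odd_winding y"
  using winding_number_eq[OF path_loop closed_loop assms(3,4,1)] assms(2) path_image_loop
  by (simp add: odd_winding_def)

lemma open_odd_winding: "open {z. z \<notin> shadow D \<and> odd_winding z = q}"
proof -
  let ?L = "\<lambda>n::int. {z. z \<notin> path_image loop \<and> winding_number loop z = of_int n}"
  have "{z. z \<notin> shadow D \<and> odd_winding z = q} = (\<Union>n\<in>{n. odd n = q}. ?L n)"
  proof (intro equalityI subsetI)
    fix z assume z: "z \<in> {z. z \<notin> shadow D \<and> odd_winding z = q}"
    then obtain n where n: "winding_number loop z = of_int n" using winding_loop_int by blast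
    then have "odd n = q" using z unfolding odd_winding_def by auto
    then show "z \<in> (\<Union>n\<in>{n. odd n = q}. ?L n)" using z n path_image_loop by auto
  next
    fix z assume "z \<in> (\<Union>n\<in>{n. odd n = q}. ?L n)"
    then obtain n where "odd n = q" "z \<notin> shadow D" "winding_number loop z = of_int n"
      using path_image_loop by auto
    then show "z \<in> {z. z \<notin> shadow D \<and> odd_winding z = q}" by (auto simp: odd_winding_def)
  qed
  moreover have "open (?L n)" for n by (rule open_winding_number_levelsets[OF path_loop closed_loop])
  ultimately show ?thesis by auto
qed

text \<open>
Away from crossings and from its base point, the loop passes through every point of the shadow once.
\<close>

lemma loop_inj:
  assumes st: "s \<in> {0..1}" "t \<in> {0..1}" and eq: "loop s = loop t"
    and nc: "loop s \<notin> crossings D" and base: "loop s \<noteq> loop 0"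
  shows "s = t"
proof -
  let ?e = "circlepath 0 1"
  have on: "?e r \<in> sphere 0 1" if "r \<in> {0..1}" for r
  proof -
    have "?e r \<in> path_image ?e" unfolding path_image_def using that by (rule imageI)
    then show ?thesis by simp
  qed
  have "?e s = ?e t"
  proof (rule ccontr)
    assume "?e s \<noteq> ?e t"
    moreover have "?e s \<in> preimages D (loop s)" "?e t \<in> preimages D (loop s)"
      using on st eq by (auto simp: preimages_def loop_def)
    ultimately show False using nc unfolding crossings_def by blast
  qed
  moreover have "simple_path ?e" by (simp add: simple_path_circlepath)
  ultimately have "s = t \<or> s = 0 \<and> t = 1 \<or> s = 1 \<and> t = 0"
    using st unfolding simple_path_def loop_free_def by blast
  moreover have "loop 1 = loop 0"
    using closed_loop by (simp add: pathfinish_def pathstart_def)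
  ultimately show ?thesis using base eq by auto
qed

text \<open>
A small disc around a point of the half axis \<open>u * {0<..1}\<close> is a chart without crossings. Two disjoint
candidates are offered because one of them may contain the base point of the loop, where
\<open>winding_number_flip\<close> does not apply.
\<close>

lemma half_axis_flip:
  assumes c: "c \<in> crossings D" and u: "u = 1 \<or> u = \<i> \<or> u = -1"
  obtains x :: real where "x \<in> {1/3, 2/3}"
    "odd_winding (\<Phi> c (u * (of_real x + \<i>/16))) \<noteq> odd_winding (\<Phi> c (u * (of_real x - \<i>/16)))"
proof -
  have small: "norm (u * (of_real x + z/8)) < 1" "Re (of_real x + z/8) > 0"
    if "x \<in> {1/3, 2/3::real}" "z \<in> cball 0 1" for x z
  proof -
    have "norm (of_real x + z/8) \<le> \<bar>x\<bar> + norm z / 8"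
      using norm_triangle_ineq[of "of_real x :: complex" "z/8"] by (simp add: norm_divide)
    then show "norm (u * (of_real x + z/8)) < 1" using that u by (auto simp: norm_mult)
    show "Re (of_real x + z/8) > 0" using that abs_Re_le_cmod[of z] by auto
  qed
  have "\<exists>x\<in>{1/3, 2/3::real}. loop 0 \<notin> (\<lambda>z. \<Phi> c (u * (of_real x + z/8))) ` cball 0 1"
  proof (rule ccontr)
    assume "\<not> ?thesis"
    then have "loop 0 \<in> (\<lambda>z. \<Phi> c (u * (of_real (1/3) + z/8))) ` cball 0 1"
      "loop 0 \<in> (\<lambda>z. \<Phi> c (u * (of_real (2/3) + z/8))) ` cball 0 1"
      by blast+
    then obtain z w where zw: "z \<in> cball 0 1" "w \<in> cball 0 1"
      "\<Phi> c (u * (of_real (1/3) + z/8)) = \<Phi> c (u * (of_real (2/3) + w/8))" by force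
    then have "u * (of_real (1/3) + z/8) = u * (of_real (2/3) + w/8)"
      using small(1)[of "1/3" z] small(1)[of "2/3" w] chart_eq_iff[OF c] by simp
    then have "of_real (1/3) + z/8 = of_real (2/3) + w/8" using u by auto
    then have "Re (of_real (1/3) + z/8) = Re (of_real (2/3) + w/8)" by simp
    then show False using zw(1,2) abs_Re_le_cmod[of z] abs_Re_le_cmod[of w] by auto
  qed
  then obtain x :: real where x: "x \<in> {1/3, 2/3}"
    and base: "loop 0 \<notin> (\<lambda>z. \<Phi> c (u * (of_real x + z/8))) ` cball 0 1" by blast
  define \<phi> where "\<phi> = (\<lambda>z. \<Phi> c (u * (of_real x + z/8)))"
  have into: "u * (of_real x + z/8) \<in> cball 0 1" if "z \<in> cball 0 1" for z
    using small(1)[OF x that] by simp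
  have cont: "continuous_on (cball 0 1) \<phi>"
    unfolding \<phi>_def by (rule continuous_on_compose2[OF chart_cont[OF c]]) (auto intro!: continuous_intros into simp del: mem_cball_0)
  have inj: "inj_on \<phi> (cball 0 1)"
  proof (rule inj_onI)
    fix z w assume zw: "z \<in> cball 0 1" "w \<in> cball 0 1" "\<phi> z = \<phi> w"
    then have "u * (of_real x + z/8) = u * (of_real x + w/8)"
      unfolding \<phi>_def using chart_eq_iff[OF c into into] by blast
    then show "z = w" using u by auto
  qed
  have sh: "\<phi> z \<in> shadow D \<longleftrightarrow> Im z = 0" if "z \<in> cball 0 1" for z
    unfolding \<phi>_def using chart_in_shadow_iff[OF c into[OF that]] small(2)[OF x that] u by auto
  have flat: "shadow D \<inter> \<phi> ` cball 0 1 = \<phi> ` horizontal"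
    using sh by (auto simp: horizontal_def)
  have nc: "\<phi> z \<notin> crossings D" if "z \<in> cball 0 1" for z
  proof -
    have "of_real x + z/8 \<noteq> 0" using small(2)[OF x that] by (metis less_irrefl zero_complex.simps(1))
    then have "u * (of_real x + z/8) \<noteq> 0" using u by auto
    then show ?thesis unfolding \<phi>_def using chart_crossing_iff[OF c into[OF that]] by blast
  qed
  have "norm (winding_number loop (\<phi> (\<i>/2)) - winding_number loop (\<phi> (-\<i>/2))) = 1"
  proof (rule winding_number_flip[OF path_loop closed_loop cont inj])
    show "path_image loop \<inter> \<phi> ` cball 0 1 = \<phi> ` horizontal"
      using flat path_image_loop by simp
    fix s t :: real assume st: "s \<in> {0..1}" "t \<in> {0..1}" "loop s \<in> \<phi> ` horizontal" "loop s = loop t"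
    then obtain z where "z \<in> cball 0 1" "loop s = \<phi> z" by (auto simp: horizontal_def)
    moreover from this have "loop s \<noteq> loop 0" using base[folded \<phi>_def] by (metis imageI)
    ultimately show "s = t" using loop_inj[OF st(1,2,4)] nc by simp
  qed
  moreover have half: "\<i>/2 \<in> cball (0::complex) 1" "-\<i>/2 \<in> cball (0::complex) 1" by (auto simp: norm_divide)
  obtain m where m: "winding_number loop (\<phi> (\<i>/2)) = of_int m"
    using winding_loop_int sh[OF half(1)] by auto
  moreover obtain n where n: "winding_number loop (\<phi> (-\<i>/2)) = of_int n"
    using winding_loop_int sh[OF half(2)] by auto
  ultimately have "norm (of_int (m - n) :: complex) = 1" by simp
  then have "\<bar>m - n\<bar> = 1" unfolding norm_of_int by linarith
  then have "odd m \<noteq> odd n" by (auto simp: abs_if split: if_splits) presburger+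
  then have "odd_winding (\<phi> (\<i>/2)) \<noteq> odd_winding (\<phi> (-\<i>/2))"
    unfolding odd_winding_def m n of_int_eq_iff by auto
  then show ?thesis using that[OF x] by (simp add: \<phi>_def)
qed

text \<open>
Each quadrant has constant parity, and the parity changes across each half axis; three of the four
half axes determine all quadrants.
\<close>

lemma quadrant_winding:
  assumes c: "c \<in> crossings D"
  obtains q where "\<And>z. z \<in> ball 0 1 \<Longrightarrow> Re z * Im z > 0 \<Longrightarrow> odd_winding (\<Phi> c z) = q"
    "\<And>z. z \<in> ball 0 1 \<Longrightarrow> Re z * Im z < 0 \<Longrightarrow> odd_winding (\<Phi> c z) \<noteq> q"
proof -
  define Q where "Q a b = {z::complex. z \<in> ball 0 1 \<and> 0 < a * Re z \<and> 0 < b * Im z}" for a b :: real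
  have const: "odd_winding (\<Phi> c z) = odd_winding (\<Phi> c w)" if "z \<in> Q a b" "w \<in> Q a b" for z w a b
  proof (rule odd_winding_const[of "\<Phi> c ` Q a b"])
    have "Q a b = ball 0 1 \<inter> {z. inner (of_real a) z > 0} \<inter> {z. inner (b * \<i>) z > 0}"
      by (auto simp: Q_def inner_complex_def)
    then have "convex (Q a b)" by (simp add: convex_Int convex_halfspace_gt)
    moreover have "Q a b \<subseteq> cball 0 1" by (auto simp: Q_def)
    ultimately show "connected (\<Phi> c ` Q a b)"
      using chart_cont[OF c] by (meson connected_continuous_image continuous_on_subset convex_connected)
    show "\<Phi> c ` Q a b \<inter> shadow D = {}"
      using chart_in_shadow_iff[OF c] by (auto simp: Q_def)
  qed (use that in auto)
  have n16: "x \<in> {1/3,2/3} \<Longrightarrow> norm (of_real x + \<i>/16) < 1" "x \<in> {1/3,2/3} \<Longrightarrow> norm (of_real x - \<i>/16) < 1" for x :: real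
    using norm_triangle_ineq[of "of_real x :: complex" "\<i>/16"] norm_triangle_ineq4[of "of_real x :: complex" "\<i>/16"]
    by (auto simp: norm_divide)
  have flip1: "odd_winding (\<Phi> c z) \<noteq> odd_winding (\<Phi> c w)" if "z \<in> Q 1 1" "w \<in> Q 1 (-1)" for z w
  proof -
    obtain x :: real where x: "x \<in> {1/3, 2/3}"
      "odd_winding (\<Phi> c (1 * (of_real x + \<i>/16))) \<noteq> odd_winding (\<Phi> c (1 * (of_real x - \<i>/16)))"
      using half_axis_flip[OF c, of 1] by blast
    have "1 * (of_real x + \<i>/16) \<in> Q 1 1" "1 * (of_real x - \<i>/16) \<in> Q 1 (-1)"
      using x(1) n16[OF x(1)] by (auto simp: Q_def)
    then show ?thesis using x(2) const that by blast
  qed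
  have flip2: "odd_winding (\<Phi> c z) \<noteq> odd_winding (\<Phi> c w)" if "z \<in> Q 1 1" "w \<in> Q (-1) 1" for z w
  proof -
    obtain x :: real where x: "x \<in> {1/3, 2/3}"
      "odd_winding (\<Phi> c (\<i> * (of_real x + \<i>/16))) \<noteq> odd_winding (\<Phi> c (\<i> * (of_real x - \<i>/16)))"
      using half_axis_flip[OF c, of \<i>] by blast
    have "\<i> * (of_real x + \<i>/16) \<in> Q (-1) 1" "\<i> * (of_real x - \<i>/16) \<in> Q 1 1"
      using x(1) n16[OF x(1)] by (auto simp: Q_def norm_mult)
    then show ?thesis using x(2) const that by metis
  qed
  have flip3: "odd_winding (\<Phi> c z) \<noteq> odd_winding (\<Phi> c w)" if "z \<in> Q (-1) 1" "w \<in> Q (-1) (-1)" for z w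
  proof -
    obtain x :: real where x: "x \<in> {1/3, 2/3}"
      "odd_winding (\<Phi> c (-1 * (of_real x + \<i>/16))) \<noteq> odd_winding (\<Phi> c (-1 * (of_real x - \<i>/16)))"
      using half_axis_flip[OF c, of "-1"] by blast
    have "-1 * (of_real x + \<i>/16) \<in> Q (-1) (-1)" "-1 * (of_real x - \<i>/16) \<in> Q (-1) 1"
      using x(1) n16[OF x(1)] by (auto simp: Q_def norm_minus_commute simp flip: norm_minus_cancel[of "_ + _"])
    then show ?thesis using x(2) const that by metis
  qed
  let ?z = "\<lambda>a b. Complex (a/2) (b/2)"
  have z: "?z a b \<in> Q a b" if "a \<in> {1,-1}" "b \<in> {1,-1}" for a b
  proof -
    have "norm (?z a b) \<le> 1/2 + 1/2 \<and> (norm (?z a b))\<^sup>2 = 1/2"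
      using that by (auto simp: cmod_power2 power_divide intro!: order_trans[OF cmod_le])
    then have "norm (?z a b) \<noteq> 1" by auto
    then have "norm (?z a b) < 1" using \<open>norm (?z a b) \<le> 1/2 + 1/2 \<and> _\<close> by linarith
    then show ?thesis using that by (auto simp: Q_def)
  qed
  show ?thesis
  proof (rule that[of "odd_winding (\<Phi> c (?z 1 1))"])
    fix z assume zz: "z \<in> ball 0 1" "Re z * Im z > 0"
    then consider "z \<in> Q 1 1" | "z \<in> Q (-1) (-1)"
      by (auto simp: Q_def zero_less_mult_iff)
    then show "odd_winding (\<Phi> c z) = odd_winding (\<Phi> c (?z 1 1))"
    proof cases
      case 1 then show ?thesis using const z by blast
    next
      case 2
      then show ?thesis using flip3[OF z[of "-1" 1] 2] flip2[OF z[of 1 1] z[of "-1" 1]] by auto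
    qed
  next
    fix z assume zz: "z \<in> ball 0 1" "Re z * Im z < 0"
    then consider "z \<in> Q 1 (-1)" | "z \<in> Q (-1) 1"
      by (auto simp: Q_def mult_less_0_iff)
    then show "odd_winding (\<Phi> c z) \<noteq> odd_winding (\<Phi> c (?z 1 1))"
      using flip1[OF z[of 1 1]] flip2[OF z[of 1 1]] by cases auto
  qed
qed

definition diamond :: "complex set" where
  "diamond = {z. \<bar>Re z\<bar> + \<bar>Im z\<bar> \<le> 1}"

text \<open>
For a split crossing, the component of the complement of the local picture, within the open disc,
that contains the crossing and the two corners merged by the splitting.
\<close>

definition joined :: "crossing_state \<Rightarrow> complex set" where
  "joined s = {z \<in> ball 0 1. \<bar>Re z\<bar> + \<bar>Im z\<bar> < 1 \<or> (if s = Split_pos then Re z * Im z < 0 else Re z * Im z > 0)}"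

lemma diamond_cball: "diamond \<subseteq> cball 0 1"
proof
  fix z assume "z \<in> diamond"
  then show "z \<in> cball 0 1" using cmod_le[of z] by (simp add: diamond_def)
qed

lemma compact_diamond: "compact diamond"
proof -
  have "closed diamond" unfolding diamond_def
    by (intro closed_Collect_le continuous_intros)
  then show ?thesis using diamond_cball bounded_subset[OF bounded_cball] by (metis compact_eq_bounded_closed)
qed

lemma open_joined: "open (joined s)"
proof -
  have "joined s = ball 0 1 \<inter> ({z. \<bar>Re z\<bar> + \<bar>Im z\<bar> < 1} \<union> (if s = Split_pos then {z. Re z * Im z < 0} else {z. Re z * Im z > 0}))"
    by (auto simp: joined_def)
  moreover have "open {z. \<bar>Re z\<bar> + \<bar>Im z\<bar> < 1}" "open {z. Re z * Im z < 0}" "open {z. Re z * Im z > 0}"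
    by (intro open_Collect_less continuous_intros)+
  ultimately show ?thesis by (auto intro!: open_Int open_Un)
qed

lemma axis_in_diamond: "z \<in> cball 0 1 \<Longrightarrow> Re z = 0 \<or> Im z = 0 \<Longrightarrow> z \<in> diamond"
  using abs_Re_le_cmod[of z] abs_Im_le_cmod[of z] by (auto simp: diamond_def)

lemma diamond_rim: "z \<in> diamond \<Longrightarrow> norm z = 1 \<Longrightarrow> Re z = 0 \<or> Im z = 0"
proof -
  assume "z \<in> diamond" "norm z = 1"
  then have "\<bar>Re z\<bar> + \<bar>Im z\<bar> = 1" using cmod_le[of z] by (auto simp: diamond_def)
  then have "z \<in> local_picture Split_pos \<or> z \<in> local_picture Split_neg" by auto
  then show ?thesis using rim_local_picture[OF \<open>norm z = 1\<close>] by blast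
qed

text \<open>
The checkerboard colouring of the diagram extends to the split diagram: at a split crossing, the
diamond joins two opposite corners, which have the same parity, and it receives that parity. The two
colour classes \<open>E True\<close> and \<open>E False\<close> are open and disjoint and cover the complement of the split
diagram, so a region lies in one of them, whereas adjacent corners of an unsplit crossing belong to
different classes.
\<close>

lemma region_avoids_adjacent_corners:
  assumes R: "R \<in> regions (split \<sigma>)" and c: "c \<in> crossings D" and un: "\<sigma> c = Unsplit"
    and z: "z \<in> ball 0 1" "Re z * Im z > 0" "\<Phi> c z \<in> R"
    and w: "w \<in> ball 0 1" "Re w * Im w < 0" "\<Phi> c w \<in> R"
  shows False
proof -
  have "\<forall>c. \<exists>q. c \<in> crossings D \<longrightarrow>
      (\<forall>z\<in>ball 0 1. (Re z * Im z > 0 \<longrightarrow> odd_winding (\<Phi> c z) = q) \<and> (Re z * Im z < 0 \<longrightarrow> odd_winding (\<Phi> c z) \<noteq> q))"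
    by (metis quadrant_winding)
  from choice[OF this] obtain q where
    q: "\<And>c z. c \<in> crossings D \<Longrightarrow> z \<in> ball 0 1 \<Longrightarrow> Re z * Im z > 0 \<Longrightarrow> odd_winding (\<Phi> c z) = q c"
       "\<And>c z. c \<in> crossings D \<Longrightarrow> z \<in> ball 0 1 \<Longrightarrow> Re z * Im z < 0 \<Longrightarrow> odd_winding (\<Phi> c z) \<noteq> q c"
    by blast
  define X where "X = {d \<in> crossings D. \<sigma> d \<noteq> Unsplit}"
  \<comment> \<open>The common parity of the two corners that are merged at \<open>d\<close>.\<close>
  define jc where "jc d = (if \<sigma> d = Split_pos then \<not> q d else q d)" for d
  have jq: "odd_winding (\<Phi> d v) = jc d" if "d \<in> X" "v \<in> joined (\<sigma> d)" "v \<notin> diamond" for d v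
    using that q[of d v] by (auto simp: X_def jc_def joined_def diamond_def split: if_splits)
  define E where "E b = {x. x \<notin> shadow D \<and> odd_winding x = b} \<inter> - (\<Union>d\<in>X. \<Phi> d ` diamond)
     \<union> (\<Union>d\<in>{d\<in>X. jc d = b}. \<Phi> d ` joined (\<sigma> d))" for b
  have finX: "finite X" by (simp add: X_def)
  have opE: "open (E b)" for b
  proof -
    have "compact (\<Union>d\<in>X. \<Phi> d ` diamond)"
      using finX compact_chart_image[OF _ compact_diamond diamond_cball] by (intro compact_UN) (auto simp: X_def)
    have "open (\<Phi> d ` joined (\<sigma> d))" if "d \<in> X" for d
    proof (rule open_chart_image[OF _ open_joined])
      show "joined (\<sigma> d) \<subseteq> ball 0 1" unfolding joined_def by blast
    qed (use that in \<open>simp add: X_def\<close>)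
    then show ?thesis unfolding E_def
      using open_Compl[OF compact_imp_closed[OF \<open>compact (\<Union>d\<in>X. \<Phi> d ` diamond)\<close>]]
      by (intro open_Un open_Int open_odd_winding open_UN) blast+
  qed
  have disj: "E True \<inter> E False = {}"
  proof -
    have 1: False if "x \<notin> shadow D" "x \<notin> (\<Union>d\<in>X. \<Phi> d ` diamond)" "d \<in> X" "x = \<Phi> d v" "v \<in> joined (\<sigma> d)"
      "odd_winding x = (\<not> jc d)" for x d v
      using that jq[of d v] by auto
    have 2: False if "d \<in> X" "e \<in> X" "v \<in> joined (\<sigma> d)" "y \<in> joined (\<sigma> e)" "\<Phi> d v = \<Phi> e y" "jc d \<noteq> jc e" for d e v y
      using that disc_unique[of d e v y] by (auto simp: X_def joined_def)
    show ?thesis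
    proof (rule ccontr)
      assume "E True \<inter> E False \<noteq> {}"
      then obtain x where x: "x \<in> E True" "x \<in> E False" by blast
      then show False using 1 2 unfolding E_def by blast
    qed
  qed
  have cover: "- split \<sigma> \<subseteq> E True \<union> E False"
  proof
    fix x assume x: "x \<in> - split \<sigma>"
    have main: "x \<in> E (odd_winding x)" if "x \<notin> shadow D" "x \<notin> (\<Union>d\<in>X. \<Phi> d ` diamond)"
      using that by (auto simp: E_def)
    show "x \<in> E True \<union> E False"
    proof (cases rule: disc_cases[of x])
      case 1
      then have xs: "x \<notin> shadow D" using x split_off_discs by blast
      have "x \<noteq> \<Phi> d v" if "d \<in> X" "v \<in> diamond" for d v
      proof
        assume eq: "x = \<Phi> d v"
        have d: "d \<in> crossings D" "v \<in> cball 0 1" using that diamond_cball by (auto simp: X_def)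
        then have "norm v = 1" using 1 eq chart_in_disc_iff[OF d] by auto
        then show False using xs eq diamond_rim[OF that(2)] chart_in_shadow_iff[OF d] by blast
      qed
      then have "x \<in> E (odd_winding x)" using xs by (intro main) blast+
      then show ?thesis by (cases "odd_winding x") auto
    next
      case (2 d v)
      then have v: "v \<in> cball 0 1" by auto
      then have nl: "v \<notin> local_picture (\<sigma> d)" using x 2 chart_in_split_iff by auto
      show ?thesis
      proof (cases "d \<in> X \<and> v \<in> diamond")
        case True
        then have "v \<in> joined (\<sigma> d)"
          using nl 2(2) by (cases "\<sigma> d") (auto simp: X_def joined_def diamond_def)
        then have "x \<in> E (jc d)" using True 2(3) by (auto simp: E_def)
        then show ?thesis by (cases "jc d") auto
      next
        case False
        have "Re v \<noteq> 0 \<and> Im v \<noteq> 0"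
        proof (cases "d \<in> X")
          case True then show ?thesis using False axis_in_diamond[OF v] by blast
        next
          case False
          then have "\<sigma> d = Unsplit" using 2(1) by (simp add: X_def)
          then show ?thesis using nl v by (auto simp: horizontal_def vertical_def)
        qed
        then have "x \<notin> shadow D" using chart_in_shadow_iff[OF 2(1) v] 2(3) by blast
        moreover have "x \<noteq> \<Phi> e y" if "e \<in> X" "y \<in> diamond" for e y
          using disc_unique[of d e v y] False that 2 v diamond_cball by (auto simp: X_def)
        ultimately have "x \<in> E (odd_winding x)" by (intro main) blast+
        then show ?thesis by (cases "odd_winding x") auto
      qed
    qed
  qed
  have "connected R" "R \<subseteq> - split \<sigma>"
    using R in_components_connected in_components_subset unfolding regions_def by blast+
  then have "R \<inter> E True = {} \<or> R \<inter> E False = {}"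
    using connectedD[of R "E True" "E False"] opE disj cover by blast
  moreover have notX: "\<Phi> c v \<notin> (\<Union>d\<in>X. \<Phi> d ` diamond)" if "v \<in> ball 0 1" for v
  proof
    assume "\<Phi> c v \<in> (\<Union>d\<in>X. \<Phi> d ` diamond)"
    then obtain d y where "d \<in> X" "y \<in> diamond" "\<Phi> c v = \<Phi> d y" by blast
    then show False using disc_unique[of c d v y] that c un diamond_cball by (auto simp: X_def)
  qed
  moreover have "\<Phi> c z \<notin> shadow D" "\<Phi> c w \<notin> shadow D"
    using chart_in_shadow_iff[OF c, of z] chart_in_shadow_iff[OF c, of w] z w by auto
  ultimately have "\<Phi> c z \<in> R \<inter> E (q c)" "\<Phi> c w \<in> R \<inter> E (\<not> q c)"
    using q[OF c z(1)] q[OF c w(1)] z w by (auto simp: E_def)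
  then show False using \<open>R \<inter> E True = {} \<or> R \<inter> E False = {}\<close> by (cases "q c") auto
qed

end

section \<open>The circuits of the colouring procedure\<close>

lemma convex_open_diamond: "convex {z. \<bar>Re z\<bar> + \<bar>Im z\<bar> < 1}"
proof -
  have "{z. \<bar>Re z\<bar> + \<bar>Im z\<bar> < 1} =
     {z. inner (Complex 1 1) z < 1} \<inter> {z. inner (Complex 1 (-1)) z < 1} \<inter>
     {z. inner (Complex (-1) 1) z < 1} \<inter> {z. inner (Complex (-1) (-1)) z < 1}"
    by (auto simp: inner_complex_def abs_if)
  then show ?thesis by (simp add: convex_Int convex_halfspace_lt)
qed

lemma open_diamond: "open {z. \<bar>Re z\<bar> + \<bar>Im z\<bar> < 1}"
  by (intro open_Collect_less continuous_intros)

lemma open_diamond_ball: "{z. \<bar>Re z\<bar> + \<bar>Im z\<bar> < 1} \<subseteq> ball 0 1"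
proof
  fix z assume "z \<in> {z. \<bar>Re z\<bar> + \<bar>Im z\<bar> < 1}"
  then show "z \<in> ball 0 1" using cmod_le[of z] by simp
qed

lemma radial_segment:
  assumes "z \<in> ball (0::complex) 1" "z \<noteq> 0" "y \<in> closed_segment z (sgn z)"
  obtains r where "r \<ge> 1" "y = of_real r * z" "norm y \<le> 1"
proof -
  obtain u where u: "0 \<le> u" "u \<le> 1" "y = (1 - u) *\<^sub>R z + u *\<^sub>R sgn z"
    using assms(3) by (auto simp: closed_segment_def)
  define r where "r = (1 - u) + u / norm z"
  have n: "0 < norm z" "norm z < 1" using assms by auto
  have y: "y = of_real r * z"
    using u(3) by (simp add: r_def scaleR_conv_of_real sgn_eq algebra_simps)
  have "u \<le> u / norm z" using n u(1) by (simp add: pos_le_divide_eq mult_left_le)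
  then have "r \<ge> 1" by (simp add: r_def)
  moreover have "norm y \<le> 1"
  proof -
    have "r * norm z = (1 - u) * norm z + u" using n by (simp add: r_def field_simps)
    also have "\<dots> \<le> (1 - u) * 1 + u" using u n by (intro add_right_mono mult_left_mono) auto
    finally show ?thesis using y \<open>r \<ge> 1\<close> by (simp add: norm_mult)
  qed
  ultimately show ?thesis using y that by blast
qed

lemma escape_ray:
  assumes z: "z \<in> ball 0 1" and
    far: "(Re z \<noteq> 0 \<and> Im z \<noteq> 0 \<and> s = Unsplit) \<or> (s \<noteq> Unsplit \<and> \<bar>Re z\<bar> + \<bar>Im z\<bar> > 1) \<or>
      (s = Split_pos \<and> Re z * Im z < 0) \<or> (s = Split_neg \<and> Re z * Im z > 0)"
  shows "closed_segment z (sgn z) \<subseteq> cball 0 1 - local_picture s" and "norm (sgn z) = 1"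
proof -
  have nz: "z \<noteq> 0" using far by auto
  then show "norm (sgn z) = 1" by (simp add: norm_sgn)
  show "closed_segment z (sgn z) \<subseteq> cball 0 1 - local_picture s"
  proof
    fix y assume "y \<in> closed_segment z (sgn z)"
    then obtain r where r: "r \<ge> 1" "y = of_real r * z" "norm y \<le> 1" using radial_segment[OF z nz] by blast
    have 1: "Re y = r * Re z" "Im y = r * Im z" using r(2) by auto
    have 2: "Re y * Im y = r\<^sup>2 * (Re z * Im z)" using 1 by (simp add: power2_eq_square)
    have 3: "\<bar>Re y\<bar> + \<bar>Im y\<bar> = r * (\<bar>Re z\<bar> + \<bar>Im z\<bar>)" using 1 r(1) by (simp add: abs_mult distrib_left)
    have 4: "\<bar>Re y\<bar> + \<bar>Im y\<bar> > 1" if "\<bar>Re z\<bar> + \<bar>Im z\<bar> > 1"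
      unfolding 3 using less_1_mult'[OF that r(1)] by (simp add: mult.commute)
    have 5: "Re y * Im y < 0 \<longleftrightarrow> Re z * Im z < 0" "Re y * Im y > 0 \<longleftrightarrow> Re z * Im z > 0"
      unfolding 2 using r(1) by (auto simp: mult_less_0_iff zero_less_mult_iff)
    show "y \<in> cball 0 1 - local_picture s"
    proof (cases s)
      case Unsplit
      then show ?thesis using r(1,3) 1 far by (auto simp: horizontal_def vertical_def)
    next
      case Split_pos
      then show ?thesis using r(3) 4 5 far by auto
    next
      case Split_neg
      then show ?thesis using r(3) 4 5 far by auto
    qed
  qed
qed

text \<open>
At an unsplit crossing the radius through \<open>z\<close> stays in its quadrant. At a split crossing the radius works
beyond the diamond and in the merged corners; any other point is first moved through the convex
open diamond into a merged corner.
\<close>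

lemma escape_to_rim:
  assumes z: "z \<in> ball 0 1" "z \<notin> local_picture s"
  obtains T w where "connected T" "T \<subseteq> cball 0 1 - local_picture s" "z \<in> T" "w \<in> T" "norm w = 1"
proof -
  consider (ray) "(Re z \<noteq> 0 \<and> Im z \<noteq> 0 \<and> s = Unsplit) \<or> (s \<noteq> Unsplit \<and> \<bar>Re z\<bar> + \<bar>Im z\<bar> > 1) \<or>
      (s = Split_pos \<and> Re z * Im z < 0) \<or> (s = Split_neg \<and> Re z * Im z > 0)"
    | (near) "s \<noteq> Unsplit" "\<bar>Re z\<bar> + \<bar>Im z\<bar> < 1"
  proof (cases s)
    case Unsplit
    then show ?thesis using z ray by (auto simp: horizontal_def vertical_def)
  next
    case Split_pos
    then show ?thesis using z(2) ray near by (cases "\<bar>Re z\<bar> + \<bar>Im z\<bar>" "1::real" rule: linorder_cases) auto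
  next
    case Split_neg
    then show ?thesis using z(2) ray near by (cases "\<bar>Re z\<bar> + \<bar>Im z\<bar>" "1::real" rule: linorder_cases) auto
  qed
  then show ?thesis
  proof cases
    case ray
    show ?thesis
      by (rule that[of "closed_segment z (sgn z)" "sgn z"]) (use escape_ray[OF z(1) ray] in auto)
  next
    case near
    define w where "w = Complex (if s = Split_pos then -1/4 else 1/4) (1/4)"
    have w: "\<bar>Re w\<bar> + \<bar>Im w\<bar> < 1" "w \<in> ball 0 1"
      "(Re w \<noteq> 0 \<and> Im w \<noteq> 0 \<and> s = Unsplit) \<or> (s \<noteq> Unsplit \<and> \<bar>Re w\<bar> + \<bar>Im w\<bar> > 1) \<or>
      (s = Split_pos \<and> Re w * Im w < 0) \<or> (s = Split_neg \<and> Re w * Im w > 0)"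
    proof -
      show *: "\<bar>Re w\<bar> + \<bar>Im w\<bar> < 1" by (auto simp: w_def)
      then show "w \<in> ball 0 1" using open_diamond_ball by blast
    qed (use near(1) in \<open>cases s; auto simp: w_def\<close>)
    have nd: "{z. \<bar>Re z\<bar> + \<bar>Im z\<bar> < 1} \<inter> local_picture s = {}" using near(1) by (cases s) auto
    show ?thesis
    proof (rule that[of "{z. \<bar>Re z\<bar> + \<bar>Im z\<bar> < 1} \<union> closed_segment w (sgn w)" "sgn w"])
      show "connected ({z. \<bar>Re z\<bar> + \<bar>Im z\<bar> < 1} \<union> closed_segment w (sgn w))"
        using w(1) ends_in_segment(1)[of w "sgn w"]
        by (intro connected_Un convex_connected[OF convex_open_diamond] connected_segment) blast
      show "{z. \<bar>Re z\<bar> + \<bar>Im z\<bar> < 1} \<union> closed_segment w (sgn w) \<subseteq> cball 0 1 - local_picture s"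
        using escape_ray(1)[OF w(2,3)] nd open_diamond_ball ball_subset_cball by blast
    qed (use near escape_ray(2)[OF w(2,3)] in auto)
  qed
qed

lemma split_boundary_unchanged:
  "\<sigma> c \<noteq> Unsplit \<Longrightarrow> split_boundary D \<Phi> R \<sigma> c = \<sigma> c"
  "c \<notin> frontier R \<Longrightarrow> split_boundary D \<Phi> R \<sigma> c = \<sigma> c"
  by (auto simp: split_boundary_def)

lemma split_boundary_Unsplit:
  assumes "split_boundary D \<Phi> R \<sigma> c = Unsplit"
  shows "\<sigma> c = Unsplit" and "c \<in> crossings D \<Longrightarrow> c \<notin> frontier R"
  using assms by (auto simp: split_boundary_def split: if_splits)

context split_diagram
begin

lemma open_region: "R \<in> regions (split \<sigma>) \<Longrightarrow> open R"
  unfolding regions_def using compact_split compact_imp_closed open_components by blast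

lemma region_disjoint: "R \<in> regions (split \<sigma>) \<Longrightarrow> R \<inter> split \<sigma> = {}"
  unfolding regions_def using in_components_subset by blast

lemma closure_region: "R \<in> regions (split \<sigma>) \<Longrightarrow> closure R \<subseteq> R \<union> split \<sigma>"
  using frontier_of_components_closed_complement[OF compact_imp_closed[OF compact_split], of R \<sigma>] open_region[of R \<sigma>]
  unfolding regions_def frontier_def by (auto simp: interior_open)

lemma region_absorbs:
  "\<lbrakk>R \<in> regions (split \<sigma>); connected T; T \<inter> split \<sigma> = {}; R \<inter> T \<noteq> {}\<rbrakk> \<Longrightarrow> T \<subseteq> R"
  unfolding regions_def using components_maximal by blast

text \<open>
A region cannot be hidden inside a splitting disc, as it reaches the rim. Hence the condition
\<open>core D \<Phi> F \<subseteq> X\<close>, which expresses that \<open>F\<close> lies in \<open>X\<close> up to trimmed corners, never holds vacuously.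
\<close>

lemma core_region_nonempty:
  assumes R: "R \<in> regions (split \<sigma>)"
  shows "core D \<Phi> R \<noteq> {}"
proof -
  obtain x where x: "x \<in> R" using R in_components_nonempty unfolding regions_def by blast
  show ?thesis
  proof (cases rule: disc_cases[of x])
    case 1 then show ?thesis using x by (auto simp: core_eq)
  next
    case (2 c z)
    then have "z \<notin> local_picture (\<sigma> c)"
      using x region_disjoint[OF R] chart_in_split_iff[OF 2(1), of z \<sigma>] by auto
    then obtain T w where T: "connected T" "T \<subseteq> cball 0 1 - local_picture (\<sigma> c)" "z \<in> T" "w \<in> T" "norm w = 1"
      using escape_to_rim 2(2) by blast
    have "connected (\<Phi> c ` T)"
      using T(1,2) chart_cont[OF 2(1)] by (meson connected_continuous_image continuous_on_subset Diff_subset subset_trans)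
    moreover have "\<Phi> c ` T \<inter> split \<sigma> = {}"
      using T(2) chart_in_split_iff[OF 2(1)] by blast
    moreover have "R \<inter> \<Phi> c ` T \<noteq> {}" using x 2(3) T(3) by blast
    ultimately have "\<Phi> c ` T \<subseteq> R" using region_absorbs[OF R] by blast
    then have "\<Phi> c w \<in> core D \<Phi> R" using T(2,4,5) chart_in_disc_iff[OF 2(1), of w] by (auto simp: core_eq)
    then show ?thesis by blast
  qed
qed

text \<open>
Let \<open>U\<close> be \<open>R\<close> without the diamonds of the crossings that are split now. It is open, and it turns out
to be closed relative to the complement of the new split diagram: the boundary of \<open>R\<close> survives outside
the diamonds, and inside \<open>R\<close> the trimmed corners are cut off by arcs of the new diagram, because
\<open>R\<close> has no corner adjacent to a trimmed one. The connected set \<open>R'\<close> meets \<open>U\<close> and is thus contained in it.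
\<close>

lemma coloured_region_shrinks:
  assumes R: "R \<in> regions (split \<sigma>)" and \<sigma>': "\<sigma>' = split_boundary D \<Phi> R \<sigma>"
    and R': "R' \<in> regions (split \<sigma>')" and core: "core D \<Phi> R \<subseteq> R'"
  shows "R' \<subseteq> R"
proof -
  define X where "X = {c \<in> crossings D. \<sigma> c = Unsplit \<and> c \<in> frontier R}"
  have finX: "finite X" by (simp add: X_def)
  define U where "U = R - (\<Union>c\<in>X. \<Phi> c ` diamond)"
  have "compact (\<Union>c\<in>X. \<Phi> c ` diamond)"
    using finX compact_chart_image[OF _ compact_diamond diamond_cball] by (intro compact_UN) (auto simp: X_def)
  then have "open U" unfolding U_def using open_region[OF R] by (intro open_Diff compact_imp_closed)
  \<comment> \<open>Points in the interior of a removed diamond are not limits of \<open>U\<close>.\<close>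
  have near: "\<Phi> c z \<notin> closure U" if "c \<in> X" "\<bar>Re z\<bar> + \<bar>Im z\<bar> < 1" for c z
  proof -
    have "open (\<Phi> c ` {z. \<bar>Re z\<bar> + \<bar>Im z\<bar> < 1})"
      using that by (intro open_chart_image open_diamond open_diamond_ball) (simp add: X_def)
    moreover have "\<Phi> c ` {z. \<bar>Re z\<bar> + \<bar>Im z\<bar> < 1} \<inter> U = {}"
    proof -
      have "{z. \<bar>Re z\<bar> + \<bar>Im z\<bar> < 1} \<subseteq> diamond" by (auto simp: diamond_def)
      then show ?thesis using that(1) unfolding U_def by blast
    qed
    ultimately have "\<Phi> c ` {z. \<bar>Re z\<bar> + \<bar>Im z\<bar> < 1} \<inter> closure U = {}"
      by (simp add: open_Int_closure_eq_empty)
    then show ?thesis using that(2) by blast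
  qed
  have main: "x \<in> U" if x: "x \<in> R'" "x \<in> closure U" for x
  proof -
    have xs: "x \<notin> split \<sigma>'" using x(1) region_disjoint[OF R'] by blast
    have "x \<in> closure R" using x(2) closure_mono[of U R] by (auto simp: U_def)
    show ?thesis
    proof (cases "x \<in> R")
      case True
      have "x \<notin> \<Phi> c ` diamond" if c: "c \<in> X" for c
      proof
        assume "x \<in> \<Phi> c ` diamond"
        then obtain z where z: "z \<in> diamond" "x = \<Phi> c z" by blast
        have cc: "c \<in> crossings D" "\<sigma> c = Unsplit" "c \<in> frontier R" using c by (auto simp: X_def)
        have zc: "z \<in> cball 0 1" using z diamond_cball by blast
        have "\<not> \<bar>Re z\<bar> + \<bar>Im z\<bar> < 1" using near[OF c] z(2) x(2) by blast
        then have one: "\<bar>Re z\<bar> + \<bar>Im z\<bar> = 1" using z(1) by (simp add: diamond_def)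
        have nl: "z \<notin> local_picture (\<sigma>' c)" using xs z(2) chart_in_split_iff[OF cc(1) zc] by blast
        have zb: "z \<in> ball 0 1"
        proof (rule ccontr)
          assume "z \<notin> ball 0 1"
          then have "norm z = 1" using zc by auto
          then show False using nl rim_local_picture diamond_rim[OF z(1)] by blast
        qed
        show False
        proof (cases "R \<inter> \<Phi> c ` {z \<in> ball 0 1. Re z * Im z > 0} = {}")
          case True
          then have "\<sigma>' c = Split_neg" using cc by (simp add: \<sigma>' split_boundary_def)
          then have "Re z * Im z > 0" using nl one by auto
          then show False using True z(2) zb \<open>x \<in> R\<close> by blast
        next
          case False
          then have "\<sigma>' c = Split_pos" using cc by (simp add: \<sigma>' split_boundary_def)
          then have "Re z * Im z < 0" using nl one by auto
          moreover obtain y where "y \<in> ball 0 1" "Re y * Im y > 0" "\<Phi> c y \<in> R" using False by blast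
          ultimately show False
            using region_avoids_adjacent_corners[OF R cc(1,2), of y z] z(2) zb \<open>x \<in> R\<close> by blast
        qed
      qed
      then show ?thesis using True by (auto simp: U_def)
    next
      case False
      then have xs2: "x \<in> split \<sigma>" using \<open>x \<in> closure R\<close> closure_region[OF R] by blast
      then have "in_disc x" using xs split_off_discs by blast
      then obtain c z where cz: "c \<in> crossings D" "z \<in> ball 0 1" "x = \<Phi> c z" using disc_cases by blast
      have zc: "z \<in> cball 0 1" using cz(2) by auto
      have l: "z \<in> local_picture (\<sigma> c)" "z \<notin> local_picture (\<sigma>' c)"
        using xs xs2 cz(3) chart_in_split_iff[OF cz(1) zc] by auto
      then have "\<sigma>' c \<noteq> \<sigma> c" by auto
      then have "\<sigma> c = Unsplit" "c \<in> frontier R" using \<sigma>' split_boundary_unchanged by blast+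
      then have "c \<in> X" using cz(1) by (simp add: X_def)
      moreover have "\<bar>Re z\<bar> + \<bar>Im z\<bar> < 1"
        using l(1) \<open>\<sigma> c = Unsplit\<close> cz(2) abs_Re_le_cmod[of z] abs_Im_le_cmod[of z]
        by (auto simp: horizontal_def vertical_def)
      ultimately show ?thesis using near cz(3) x(2) by blast
    qed
  qed
  obtain y where y: "y \<in> core D \<Phi> R" using core_region_nonempty[OF R] by blast
  have "y \<in> U"
  proof -
    have "y \<in> R" "\<not> in_disc y" using y by (auto simp: core_eq)
    have "y \<noteq> \<Phi> c z" if "c \<in> X" "z \<in> diamond" for c z
    proof
      assume eq: "y = \<Phi> c z"
      have c: "c \<in> crossings D" "z \<in> cball 0 1" "\<sigma> c = Unsplit" using that diamond_cball by (auto simp: X_def)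
      then have "norm z = 1" using chart_in_disc_iff[OF c(1,2)] \<open>\<not> in_disc y\<close> eq by auto
      then have "z \<in> local_picture (\<sigma> c)" using diamond_rim[OF that(2)] rim_local_picture by blast
      then have "y \<in> split \<sigma>" using eq chart_in_split_iff[OF c(1,2)] by blast
      then show False using \<open>y \<in> R\<close> region_disjoint[OF R] by blast
    qed
    then show ?thesis using \<open>y \<in> R\<close> unfolding U_def by blast
  qed
  then have ne: "R' \<inter> U \<noteq> {}" using y core by blast
  have "connected R'" using R' in_components_connected unfolding regions_def by blast
  moreover have "R' \<inter> U = R' \<inter> closure U" using main closure_subset by blast
  ultimately have "R' \<subseteq> U" using connected_within_clopen[OF _ ne \<open>open U\<close> closed_closure] by blast
  then show ?thesis by (auto simp: U_def)
qed

text \<open>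
A crossing on \<open>C\<close> that is still unsplit would lie on the boundary of \<open>R\<close>, where all crossings have
just been split.
\<close>

lemma circuit_has_no_unsplit_crossing:
  assumes R: "R \<in> regions (split \<sigma>)" and \<sigma>': "\<sigma>' = split_boundary D \<Phi> R \<sigma>"
    and "R' \<subseteq> R" "C \<subseteq> frontier R'" and c: "c \<in> crossings D" "c \<in> C"
  shows "\<sigma>' c \<noteq> Unsplit"
proof
  assume "\<sigma>' c = Unsplit"
  then have un: "\<sigma> c = Unsplit" "c \<notin> frontier R"
    using \<sigma>' split_boundary_Unsplit c(1) by blast+
  have "c \<in> closure R"
    using assms(3,4) c(2) closure_mono[of R' R] by (auto simp: frontier_def)
  moreover have "c \<in> split \<sigma>"
    using chart_in_split_iff[OF c(1), of 0 \<sigma>] chart_zero[OF c(1)] un(1) by (auto simp: horizontal_def)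
  ultimately have "c \<in> frontier R"
    using region_disjoint[OF R] open_region[OF R] by (auto simp: frontier_def interior_open)
  then show False using un(2) by blast
qed

text \<open>
Further splittings take place in discs of unsplit crossings. The local picture of such a disc is
connected and contains its crossing, so a component \<open>K\<close> that meets the disc contains the crossing.
\<close>

lemma circuit_persists:
  assumes K: "K \<in> components (split \<sigma>)" and un: "\<And>c. c \<in> crossings D \<Longrightarrow> c \<in> K \<Longrightarrow> \<sigma> c \<noteq> Unsplit"
    and \<sigma>': "\<sigma>' = split_boundary D \<Phi> R \<sigma>"
  shows "K \<in> components (split \<sigma>')"
proof -
  define X where "X = {c \<in> crossings D. \<sigma> c = Unsplit}"
  define L where "L = (\<Union>c\<in>X. \<Phi> c ` cball 0 1)"
  have "compact L" unfolding L_def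
    using compact_chart_image[OF _ compact_cball order_refl] by (intro compact_UN) (auto simp: X_def)
  have "K \<inter> L = {}"
  proof (rule ccontr)
    assume "K \<inter> L \<noteq> {}"
    then obtain c z where cz: "c \<in> crossings D" "\<sigma> c = Unsplit" "z \<in> cball 0 1" "\<Phi> c z \<in> K"
      by (auto simp: L_def X_def)
    have "\<Phi> c z \<in> split \<sigma>" using cz(4) in_components_subset[OF K] by blast
    then have z: "z \<in> horizontal \<union> vertical" using chart_in_split_iff[OF cz(1,3)] cz(2) by simp
    have hv: "horizontal \<union> vertical \<subseteq> cball 0 1" by (auto simp: horizontal_def vertical_def)
    have 0: "0 \<in> horizontal" "0 \<in> vertical" by (auto simp: horizontal_def vertical_def)
    have "horizontal = cball 0 1 \<inter> {z. Im z = 0}" "vertical = cball 0 1 \<inter> {z. Re z = 0}"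
      by (auto simp: horizontal_def vertical_def)
    moreover have "convex {z. Im z = 0}" "convex {z. Re z = 0}" by (auto simp: convex_alt)
    ultimately have "convex horizontal" "convex vertical" by (metis convex_Int convex_cball)+
    then have "connected (horizontal \<union> vertical)"
      using 0 by (intro connected_Un convex_connected) auto
    then have "connected (\<Phi> c ` (horizontal \<union> vertical))"
      using chart_cont[OF cz(1)] hv by (meson connected_continuous_image continuous_on_subset)
    moreover have "\<Phi> c ` (horizontal \<union> vertical) \<subseteq> split \<sigma>"
      using chart_in_split_iff[OF cz(1)] hv cz(2) by fastforce
    ultimately have "\<Phi> c ` (horizontal \<union> vertical) \<subseteq> K"
      using components_maximal[OF K] cz(4) z by blast
    then have "c \<in> K" using 0(1) chart_zero[OF cz(1)] by (metis UnI1 image_eqI subsetD)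
    then show False using un[OF cz(1)] cz(2) by blast
  qed
  moreover have "split \<sigma> - L = split \<sigma>' - L"
  proof -
    have "x \<in> split \<sigma> \<longleftrightarrow> x \<in> split \<sigma>'" if x: "x \<notin> L" for x
    proof (cases rule: disc_cases[of x])
      case 1 then show ?thesis by (simp add: split_off_discs)
    next
      case (2 c z)
      then have "c \<notin> X" using x ball_subset_cball unfolding L_def by blast
      then have "\<sigma>' c = \<sigma> c" using 2(1) \<sigma>' split_boundary_unchanged(1) by (simp add: X_def)
      then show ?thesis using chart_in_split_iff[OF 2(1), of z] 2 by simp
    qed
    then show ?thesis by blast
  qed
  ultimately show ?thesis
    using component_persists[OF compact_split K compact_imp_closed[OF \<open>compact L\<close>]] by blast
qed

text \<open>
The invariant of the colouring procedure: \<open>C k\<close> is the circuit that bounds the region with colour \<open>k\<close>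
on the outside. The last two clauses identify the region that receives colour \<open>0\<close>.
\<close>

definition circuits_for ::
  "(nat \<Rightarrow> complex set) \<Rightarrow> (complex \<Rightarrow> crossing_state) \<Rightarrow> complex set list \<Rightarrow> complex set \<Rightarrow> bool" where
  "circuits_for C \<sigma> Rs R \<longleftrightarrow>
     R \<in> regions (split \<sigma>) \<and>
     (\<forall>k<length Rs. C k \<in> components (split \<sigma>) \<and> (\<forall>c\<in>crossings D. c \<in> C k \<longrightarrow> \<sigma> c \<noteq> Unsplit) \<and>
        center D \<in> inside (C k) \<and> Rs ! k \<subseteq> inside (C k) \<and> R \<subseteq> outside (C k)) \<and>
     (\<forall>k<length Rs. \<forall>j<k. C j \<inter> C k = {} \<and> Rs ! k \<subseteq> outside (C j)) \<and>
     (Rs = [] \<longrightarrow> R \<in> regions (shadow D) \<and> center D \<in> R) \<and>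
     (\<forall>F. Rs \<noteq> [] \<longrightarrow> F \<in> regions (shadow D) \<longrightarrow> center D \<in> F \<longrightarrow> core D \<Phi> F \<subseteq> Rs ! 0)"

lemma compact_circuit: "K \<in> components (split \<sigma>) \<Longrightarrow> compact K"
  using compact_components[OF compact_split] .

lemma coloring_circuits: "coloring D \<Phi> \<sigma> Rs R \<Longrightarrow> \<exists>C. circuits_for C \<sigma> Rs R"
proof (induction rule: coloring.induct)
  case (start R)
  then show ?case by (auto simp: circuits_for_def split_Unsplit)
next
  case (advance \<sigma> Rs R \<sigma>' R' C N)
  then obtain K where K: "circuits_for K \<sigma> Rs R" by blast
  define n where "n = length Rs"
  have R: "R \<in> regions (split \<sigma>)" using K by (simp add: circuits_for_def)
  have R'R: "R' \<subseteq> R"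
    using coloured_region_shrinks[OF R] advance by blast
  have old: "K k \<in> components (split \<sigma>')" "center D \<in> inside (K k)" "R \<subseteq> outside (K k)"
     "\<And>c. c \<in> crossings D \<Longrightarrow> c \<in> K k \<Longrightarrow> \<sigma>' c \<noteq> Unsplit" if "k < n" for k
  proof -
    have *: "K k \<in> components (split \<sigma>)" "\<And>c. c \<in> crossings D \<Longrightarrow> c \<in> K k \<Longrightarrow> \<sigma> c \<noteq> Unsplit"
      using K that by (auto simp: circuits_for_def n_def)
    show "K k \<in> components (split \<sigma>')" by (rule circuit_persists[OF * advance.hyps(3)])
    show "center D \<in> inside (K k)" "R \<subseteq> outside (K k)"
      using K that by (auto simp: circuits_for_def n_def)
    show "\<sigma>' c \<noteq> Unsplit" if "c \<in> crossings D" "c \<in> K k" for c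
      using *(2)[OF that] advance.hyps(3) split_boundary_unchanged(1) by metis
  qed
  have ne: "R' \<noteq> {}" using advance.hyps(4) in_components_nonempty unfolding regions_def by blast
  have disj: "K k \<inter> C = {}" if "k < n" for k
  proof (rule ccontr)
    assume "K k \<inter> C \<noteq> {}"
    then have "K k = C" using components_eq[OF old(1)[OF that] advance.hyps(6)] by blast
    then have "R' \<subseteq> inside C \<inter> outside C" using advance.hyps(8) R'R old(3)[OF that] by blast
    then show False using ne inside_Int_outside by blast
  qed
  have out: "outside C \<subseteq> outside (K k)" if "k < n" for k
  proof -
    note Kk = old(1)[OF that]
    have cK: "compact (K k)" "connected (K k)"
      using compact_circuit[OF Kk] in_components_connected[OF Kk] .
    have "C \<subseteq> closure (outside (K k))"
      using advance.hyps(7) R'R old(3)[OF that] closure_mono[of R' "outside (K k)"] by (auto simp: frontier_def)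
    also have "\<dots> \<subseteq> outside (K k) \<union> K k"
      using frontier_outside_subset[OF compact_imp_closed[OF cK(1)]] interior_subset by (auto simp: frontier_def)
    finally have "C \<subseteq> outside (K k)" using disj[OF that] by blast
    then show ?thesis
      using outside_nested[OF cK(1) compact_circuit[OF advance.hyps(6)] cK(2) disj[OF that] _ old(2)[OF that] advance.hyps(9)]
      by blast
  qed
  have core0: "core D \<Phi> F \<subseteq> (Rs @ [R']) ! 0" if F: "F \<in> regions (shadow D)" "center D \<in> F" for F
  proof (cases "Rs = []")
    case True
    then have "R \<in> regions (shadow D)" "center D \<in> R" using K by (auto simp: circuits_for_def)
    then have "F = R" using F components_eq[of F "- shadow D" R] unfolding regions_def by blast
    then show ?thesis using True advance.hyps(5) by simp
  next
    case False
    then show ?thesis using K F by (auto simp: circuits_for_def nth_append)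
  qed
  have "circuits_for (K(n := C)) \<sigma>' (Rs @ [R']) N"
    unfolding circuits_for_def
  proof (intro conjI allI impI ballI)
    show "N \<in> regions (split \<sigma>')" by fact
  next
    fix k assume k: "k < length (Rs @ [R'])"
    show "(K(n := C)) k \<in> components (split \<sigma>')"
      using k old(1) advance.hyps(6) by (auto simp: n_def less_Suc_eq)
    show "\<sigma>' c \<noteq> Unsplit" if "c \<in> crossings D" "c \<in> (K(n := C)) k" for c
      using k old(4)[of k c] that circuit_has_no_unsplit_crossing[OF R advance.hyps(3) R'R advance.hyps(7)]
      by (auto simp: n_def less_Suc_eq split: if_splits)
    show "center D \<in> inside ((K(n := C)) k)"
      using k old(2) advance.hyps(9) by (auto simp: n_def less_Suc_eq)
    show "(Rs @ [R']) ! k \<subseteq> inside ((K(n := C)) k)"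
      using k K advance.hyps(8) by (auto simp: n_def less_Suc_eq nth_append circuits_for_def)
    show "N \<subseteq> outside ((K(n := C)) k)"
      using k out[of k] advance.hyps(12) by (auto simp: n_def less_Suc_eq)
    fix j assume j: "j < k"
    have prev: "K j \<inter> K k = {}" "Rs ! k \<subseteq> outside (K j)" if "k < n"
      using K j that unfolding circuits_for_def n_def by blast+
    show "(K(n := C)) j \<inter> (K(n := C)) k = {}"
      using k j prev disj[of j] by (cases "k < n") (simp_all add: n_def less_Suc_eq)
    show "(Rs @ [R']) ! k \<subseteq> outside ((K(n := C)) j)"
      using k j prev old(3)[of j] R'R by (cases "k < n") (auto simp: n_def less_Suc_eq nth_append)
  qed (use core0 in auto)
  then show ?case by blast
qed

end

section \<open>Arcs with prescribed ends\<close>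

text \<open>
Near its start the arc \<open>\<alpha>\<close> is far from \<open>K\<close>. If \<open>H\<close> missed a point of \<open>\<alpha>\<close> there, it would be
disconnected, one part being near the start and the other one reaching \<open>K\<close>.
\<close>

lemma agrees_with_initial_arc:
  fixes \<alpha> :: "real \<Rightarrow> complex"
  assumes "connected H" "arc \<alpha>" "compact K" and pK: "pathstart \<alpha> \<notin> K"
    and H: "pathstart \<alpha> \<in> H" "H \<inter> K \<noteq> {}" "H \<subseteq> path_image \<alpha> \<union> K"
  shows "\<exists>r>0. H \<inter> ball (pathstart \<alpha>) r = path_image \<alpha> \<inter> ball (pathstart \<alpha>) r"
proof -
  define p where "p = pathstart \<alpha>"
  have p0: "\<alpha> 0 = p" by (simp add: p_def pathstart_def)
  have cont: "continuous_on {0..1} \<alpha>" and inj: "inj_on \<alpha> {0..1}"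
    using \<open>arc \<alpha>\<close> by (auto simp: arc_def path_def)
  have cpt: "compact (\<alpha> ` {a..b})" if "0 \<le> a" "b \<le> 1" for a b
    by (rule compact_continuous_image[OF continuous_on_subset[OF cont]]) (use that in auto)
  have "open (- K)" using \<open>compact K\<close> compact_imp_closed by blast
  then obtain r0 where r0: "r0 > 0" "ball p r0 \<subseteq> - K"
    using pK p_def open_contains_ball by (metis ComplI)
  obtain d where d: "d > 0" "\<And>s. s \<in> {0..1} \<Longrightarrow> dist s 0 < d \<Longrightarrow> dist (\<alpha> s) (\<alpha> 0) < r0"
    using cont r0(1) unfolding continuous_on_iff by (metis atLeastAtMost_iff order_refl zero_le_one)
  define s0 where "s0 = min 1 (d/2)"
  have s0: "0 < s0" "s0 \<le> 1" "s0 < d" using d(1) by (auto simp: s0_def)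
  have near: "\<alpha> ` {0..s0} \<subseteq> ball p r0"
  proof
    fix y assume "y \<in> \<alpha> ` {0..s0}"
    then obtain s where "s \<in> {0..s0}" "y = \<alpha> s" by blast
    then show "y \<in> ball p r0" using d(2)[of s] s0 p0 by (simp add: dist_commute)
  qed
  have inH: "\<alpha> s \<in> H" if s: "s \<in> {0..s0}" for s
  proof (rule ccontr)
    assume no: "\<alpha> s \<notin> H"
    define A B where "A = \<alpha> ` {0..s}" and "B = \<alpha> ` {s..1}"
    have "closed A" "closed (B \<union> K)"
      using cpt[of 0 s] cpt[of s 1] s s0 \<open>compact K\<close> unfolding A_def B_def
      by (auto intro!: compact_imp_closed closed_Un)
    moreover have "H \<subseteq> A \<union> (B \<union> K)"
    proof -
      have "{0..1} = {0..s} \<union> {s..1}" using s s0 by auto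
      then have "path_image \<alpha> = A \<union> B" unfolding A_def B_def path_image_def by (metis image_Un)
      then show ?thesis using H(3) by blast
    qed
    moreover have "A \<inter> (B \<union> K) \<inter> H = {}"
    proof -
      have "A \<subseteq> \<alpha> ` {0..s0}" unfolding A_def using s by (intro image_mono) auto
      then have "A \<inter> K = {}" using near r0(2) by blast
      moreover have "A \<inter> B \<subseteq> {\<alpha> s}"
      proof
        fix y assume "y \<in> A \<inter> B"
        then obtain u v where uv: "u \<in> {0..s}" "v \<in> {s..1}" "y = \<alpha> u" "y = \<alpha> v"
          unfolding A_def B_def by blast
        then have "u = v" using inj_onD[OF inj, of u v] s s0 by auto
        then have "u = s" using uv by auto
        then show "y \<in> {\<alpha> s}" using uv by simp
      qed
      ultimately show ?thesis using no by blast
    qed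
    moreover have "A \<inter> H \<noteq> {}"
    proof -
      have "p \<in> A" unfolding A_def using p0 s by (intro image_eqI[of _ _ 0]) auto
      then show ?thesis using H(1) p_def by blast
    qed
    moreover have "(B \<union> K) \<inter> H \<noteq> {}" using H(2) by blast
    ultimately show False using \<open>connected H\<close> unfolding connected_closed by blast
  qed
  have "p \<notin> \<alpha> ` {s0..1}"
  proof
    assume "p \<in> \<alpha> ` {s0..1}"
    then obtain s where "s \<in> {s0..1}" "\<alpha> 0 = \<alpha> s" using p0 by auto
    then show False using inj_onD[OF inj, of 0 s] s0 by auto
  qed
  moreover have "open (- \<alpha> ` {s0..1})"
    using s0 by (intro open_Compl compact_imp_closed cpt) auto
  ultimately obtain r1 where r1: "r1 > 0" "ball p r1 \<subseteq> - \<alpha> ` {s0..1}"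
    using open_contains_ball by (metis ComplI)
  define r where "r = min r0 r1"
  have "H \<inter> ball p r = path_image \<alpha> \<inter> ball p r"
  proof
    show "H \<inter> ball p r \<subseteq> path_image \<alpha> \<inter> ball p r"
      using H(3) r0(2) by (auto simp: r_def subset_iff)
    show "path_image \<alpha> \<inter> ball p r \<subseteq> H \<inter> ball p r"
    proof
      fix y assume y: "y \<in> path_image \<alpha> \<inter> ball p r"
      then obtain s where s: "s \<in> {0..1}" "y = \<alpha> s" by (auto simp: path_image_def)
      have "y \<in> ball p r1" using y by (simp add: r_def)
      then have "s \<notin> {s0..1}" using r1(2) s(2) by blast
      then show "y \<in> H \<inter> ball p r" using inH[of s] s y by auto
    qed
  qed
  then show ?thesis using r0(1) r1(1) by (auto simp: r_def p_def intro!: exI[of _ "min r0 r1"])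
qed

text \<open>
Join the far ends of \<open>\<alpha>\<close> and \<open>\<beta>\<close> by a path in \<open>F\<close> and extract an arc from the resulting path. Near a
start point outside \<open>F\<close> no other piece of the path is present, so the extracted arc follows
\<open>\<alpha>\<close> or \<open>\<beta>\<close>. This control near the end points is what gives transversality later.
\<close>

lemma arc_through_region:
  fixes F :: "complex set"
  assumes "open F" "connected F" and \<alpha>: "arc \<alpha>" "\<alpha> ` {0<..1} \<subseteq> F" and \<beta>: "arc \<beta>" "\<beta> ` {0<..1} \<subseteq> F"
    and ne: "pathstart \<alpha> \<noteq> pathstart \<beta>"
  shows "\<exists>h. arc h \<and> pathstart h = pathstart \<alpha> \<and> pathfinish h = pathstart \<beta> \<and> h ` {0<..<1} \<subseteq> F \<and>
    (pathstart \<alpha> \<notin> F \<longrightarrow> (\<exists>r>0. path_image h \<inter> ball (pathstart \<alpha>) r = path_image \<alpha> \<inter> ball (pathstart \<alpha>) r)) \<and>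
    (pathstart \<beta> \<notin> F \<longrightarrow> (\<exists>r>0. path_image h \<inter> ball (pathstart \<beta>) r = path_image \<beta> \<inter> ball (pathstart \<beta>) r))"
proof -
  have im: "path_image \<gamma> \<subseteq> insert (pathstart \<gamma>) F" if "\<gamma> ` {0<..1} \<subseteq> F" for \<gamma> :: "real \<Rightarrow> complex"
  proof
    fix y assume "y \<in> path_image \<gamma>"
    then obtain s where "s \<in> {0..1}" "y = \<gamma> s" by (auto simp: path_image_def)
    then show "y \<in> insert (pathstart \<gamma>) F"
    proof (cases "s = 0")
      case False
      then have "\<gamma> s \<in> \<gamma> ` {0<..1}" using \<open>s \<in> {0..1}\<close> by (intro imageI) auto
      then show ?thesis using that \<open>y = \<gamma> s\<close> by blast
    qed (simp add: pathstart_def)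
  qed
  have "pathfinish \<alpha> \<in> F" "pathfinish \<beta> \<in> F"
    using \<alpha>(2) \<beta>(2) by (auto simp: pathfinish_def)
  then obtain g where g: "path g" "path_image g \<subseteq> F" "pathstart g = pathfinish \<alpha>" "pathfinish g = pathfinish \<beta>"
    using connected_open_path_connected[OF assms(1,2)] unfolding path_connected_def by blast
  define P where "P = \<alpha> +++ g +++ reversepath \<beta>"
  have P: "path P" "pathstart P = pathstart \<alpha>" "pathfinish P = pathstart \<beta>"
    "path_image P = path_image \<alpha> \<union> (path_image g \<union> path_image \<beta>)"
    using g \<alpha>(1) \<beta>(1) by (auto simp: P_def path_image_join arc_imp_path)
  obtain h where h: "arc h" "path_image h \<subseteq> path_image P" "pathstart h = pathstart \<alpha>" "pathfinish h = pathstart \<beta>"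
    using path_contains_arc[OF P(1,2,3) ne] by blast
  have mid: "h ` {0<..<1} \<subseteq> F"
  proof
    fix y assume "y \<in> h ` {0<..<1}"
    then obtain s where s: "s \<in> {0<..<1}" "y = h s" by blast
    have inj: "inj_on h {0..1}" using h(1) by (simp add: arc_def)
    have "y \<noteq> h 0" "y \<noteq> h 1"
      using inj_onD[OF inj, of s 0] inj_onD[OF inj, of s 1] s by auto
    then have "y \<noteq> pathstart \<alpha>" "y \<noteq> pathstart \<beta>"
      using h(3,4) by (auto simp: pathstart_def pathfinish_def)
    moreover have "y \<in> path_image P"
      using h(2) s by (auto simp: path_image_def)
    ultimately show "y \<in> F" using P(4) g(2) im[OF \<alpha>(2)] im[OF \<beta>(2)] by blast
  qed
  have cpt: "compact (path_image g \<union> path_image \<beta>)" "compact (path_image g \<union> path_image \<alpha>)"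
    using g(1) \<alpha>(1) \<beta>(1) by (auto intro!: compact_Un compact_path_image arc_imp_path)
  have ch: "connected (path_image h)" using h(1) arc_imp_path connected_path_image by blast
  have "\<exists>r>0. path_image h \<inter> ball (pathstart \<alpha>) r = path_image \<alpha> \<inter> ball (pathstart \<alpha>) r"
    if "pathstart \<alpha> \<notin> F"
  proof (rule agrees_with_initial_arc[OF ch \<alpha>(1) cpt(1)])
    show "pathstart \<alpha> \<notin> path_image g \<union> path_image \<beta>" using that g(2) im[OF \<beta>(2)] ne by blast
    show "pathstart \<alpha> \<in> path_image h" using h(3) by (metis pathstart_in_path_image)
    show "path_image h \<inter> (path_image g \<union> path_image \<beta>) \<noteq> {}"
      using h(4) by (metis IntI UnI2 empty_iff pathfinish_in_path_image pathstart_in_path_image)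
    show "path_image h \<subseteq> path_image \<alpha> \<union> (path_image g \<union> path_image \<beta>)" using h(2) P(4) by blast
  qed
  moreover have "\<exists>r>0. path_image h \<inter> ball (pathstart \<beta>) r = path_image \<beta> \<inter> ball (pathstart \<beta>) r"
    if "pathstart \<beta> \<notin> F"
  proof (rule agrees_with_initial_arc[OF ch \<beta>(1) cpt(2)])
    show "pathstart \<beta> \<notin> path_image g \<union> path_image \<alpha>" using that g(2) im[OF \<alpha>(2)] ne[symmetric] by blast
    show "pathstart \<beta> \<in> path_image h" using h(4) by (metis pathfinish_in_path_image)
    show "path_image h \<inter> (path_image g \<union> path_image \<alpha>) \<noteq> {}"
      using pathstart_in_path_image[of h] pathstart_in_path_image[of \<alpha>] unfolding h(3) by blast
    show "path_image h \<subseteq> path_image \<beta> \<union> (path_image g \<union> path_image \<alpha>)" using h(2) P(4) by blast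
  qed
  ultimately show ?thesis using h mid by blast
qed

lemma short_arc:
  fixes F :: "complex set"
  assumes "open F" "x \<in> F"
  obtains \<alpha> where "arc \<alpha>" "pathstart \<alpha> = x" "\<alpha> ` {0<..1} \<subseteq> F"
proof -
  obtain e where e: "e > 0" "ball x e \<subseteq> F" using assms open_contains_ball by blast
  let ?\<alpha> = "linepath x (x + of_real (e/2))"
  have "path_image ?\<alpha> \<subseteq> ball x e"
    using e(1) closed_segment_subset[of x "ball x e" "x + of_real (e/2)"] by (simp add: dist_norm)
  then have "?\<alpha> ` {0<..1} \<subseteq> F" using e(2) unfolding path_image_def by fastforce
  moreover have "arc ?\<alpha>" using e(1) by (intro arc_linepath) auto
  ultimately show ?thesis using that by simp
qed

lemma concatenate_arcs:
  fixes h :: "nat \<Rightarrow> real \<Rightarrow> complex"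
  assumes "\<And>i. i \<le> N \<Longrightarrow> arc (h i) \<and> pathstart (h i) = q i \<and> pathfinish (h i) = q (Suc i) \<and> h i ` {0<..<1} \<subseteq> F i"
    and "\<And>i j. i < j \<Longrightarrow> j \<le> N \<Longrightarrow> path_image (h i) \<inter> path_image (h j) \<subseteq> {q j}"
  shows "\<exists>m t. arc m \<and> pathstart m = q 0 \<and> pathfinish m = q (Suc N) \<and> t 0 = (0::real) \<and> t (Suc N) = 1 \<and>
    (\<forall>i\<le>N. t i < t (Suc i) \<and> m ` {t i<..<t (Suc i)} \<subseteq> F i) \<and> (\<forall>i\<le>Suc N. t i \<in> {0..1} \<and> m (t i) = q i) \<and>
    path_image m = (\<Union>i\<le>N. path_image (h i))"
  using assms
proof (induction N)
  case 0
  then have h0: "arc (h 0)" "pathstart (h 0) = q 0" "pathfinish (h 0) = q 1" "h 0 ` {0<..<1} \<subseteq> F 0" by auto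
  show ?case
    by (rule exI[of _ "h 0"], rule exI[of _ "\<lambda>i. real i"])
      (use h0 in \<open>auto simp: le_Suc_eq pathstart_def pathfinish_def\<close>)
next
  case (Suc N)
  obtain m t where m: "arc m" "pathstart m = q 0" "pathfinish m = q (Suc N)"
    and t: "t 0 = (0::real)" "t (Suc N) = 1"
      "\<And>i. i \<le> N \<Longrightarrow> t i < t (Suc i) \<and> m ` {t i<..<t (Suc i)} \<subseteq> F i"
      "\<And>i. i \<le> Suc N \<Longrightarrow> t i \<in> {0..1} \<and> m (t i) = q i"
    and im: "path_image m = (\<Union>i\<le>N. path_image (h i))"
  proof -
    have "\<exists>m t. arc m \<and> pathstart m = q 0 \<and> pathfinish m = q (Suc N) \<and> t 0 = (0::real) \<and> t (Suc N) = 1 \<and>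
      (\<forall>i\<le>N. t i < t (Suc i) \<and> m ` {t i<..<t (Suc i)} \<subseteq> F i) \<and> (\<forall>i\<le>Suc N. t i \<in> {0..1} \<and> m (t i) = q i) \<and>
      path_image m = (\<Union>i\<le>N. path_image (h i))"
      using Suc.prems by (intro Suc.IH) auto
    then show ?thesis using that by blast
  qed
  let ?g = "h (Suc N)"
  have g: "arc ?g" "pathstart ?g = q (Suc N)" "pathfinish ?g = q (Suc (Suc N))" "?g ` {0<..<1} \<subseteq> F (Suc N)"
    using Suc.prems(1)[of "Suc N"] by auto
  define m' where "m' = m +++ ?g"
  define t' where "t' i = (if i \<le> Suc N then t i / 2 else 1)" for i
  have "path_image m \<inter> path_image ?g \<subseteq> {pathstart ?g}"
  proof -
    have "path_image (h i) \<inter> path_image ?g \<subseteq> {q (Suc N)}" if "i \<le> N" for i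
      using Suc.prems(2)[of i "Suc N"] that by simp
    then show ?thesis unfolding im g(2) by blast
  qed
  then have "arc m'" unfolding m'_def using m g by (intro arc_join) auto
  have lo: "m' (x/2) = m x" if "x \<le> 1" for x using that by (simp add: m'_def joinpaths_def)
  have hi: "m' x = ?g (2*x - 1)" if "x > 1/2" for x using that by (simp add: m'_def joinpaths_def)
  have seg: "t' i < t' (Suc i) \<and> m' ` {t' i<..<t' (Suc i)} \<subseteq> F i" if i: "i \<le> Suc N" for i
  proof (cases "i \<le> N")
    case True
    have "m' x \<in> F i" if "x \<in> {t i/2<..<t (Suc i)/2}" for x
    proof -
      have "2*x \<in> {t i<..<t (Suc i)}" using that by auto
      moreover from this have "2*x \<le> 1" using t(4)[of "Suc i"] True by auto
      ultimately show ?thesis using lo[of "2*x"] t(3)[OF True] by auto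
    qed
    then show ?thesis using True t(3)[OF True] by (auto simp: t'_def)
  next
    case False
    then have i: "i = Suc N" using i by simp
    have "m' x \<in> F i" if "x \<in> {1/2<..<1}" for x
    proof -
      have "2*x - 1 \<in> {0<..<1}" using that by auto
      then show ?thesis using hi[of x] g(4) that i by auto
    qed
    then show ?thesis using t(2) i by (auto simp: t'_def)
  qed
  have val: "t' i \<in> {0..1} \<and> m' (t' i) = q i" if "i \<le> Suc (Suc N)" for i
  proof (cases "i \<le> Suc N")
    case True
    then show ?thesis using t(4)[OF True] lo[of "t i"] by (auto simp: t'_def)
  next
    case False
    then have "i = Suc (Suc N)" using that by simp
    then show ?thesis using hi[of 1] g(3) by (simp add: t'_def pathfinish_def)
  qed
  have "path_image m' = (\<Union>i\<le>Suc N. path_image (h i))"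
    unfolding m'_def using m g by (simp add: path_image_join im atMost_Suc Un_commute)
  then show ?case
    using \<open>arc m'\<close> m g t seg val
    by (intro exI[of _ m'] exI[of _ t']) (simp add: m'_def t'_def)
qed

text \<open>
Agreement with the vertical axis in a round ball suffices for transversality: the chart can be
restricted to a concentric disc whose image lies in the ball.
\<close>

lemma transverse_at_shrink:
  assumes \<phi>: "disc_chart p \<phi>" and A: "A \<inter> \<phi> ` cball 0 1 = \<phi> ` horizontal"
    and "r > 0" and B: "B \<inter> ball p r = \<phi> ` vertical \<inter> ball p r"
  shows "transverse_at A B p"
proof -
  have cont: "continuous_on (cball 0 1) \<phi>" and inj: "inj_on \<phi> (cball 0 1)" and zero: "\<phi> 0 = p"
    using \<phi> by (auto simp: disc_chart_def)
  obtain d where d: "d > 0" "\<And>z. z \<in> cball 0 1 \<Longrightarrow> dist z 0 < d \<Longrightarrow> dist (\<phi> z) (\<phi> 0) < r"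
    using cont \<open>r > 0\<close> unfolding continuous_on_iff by (metis centre_in_cball zero_le_one)
  define e where "e = min 1 (d/2)"
  have e: "0 < e" "e \<le> 1" "e < d" using d(1) by (auto simp: e_def)
  define \<psi> where "\<psi> z = \<phi> (of_real e * z)" for z
  have small: "of_real e * z \<in> cball 0 1" "norm (of_real e * z) < d" if "z \<in> cball 0 1" for z :: complex
  proof -
    have "e * norm z \<le> e * 1" using that e by (intro mult_left_mono) auto
    then have "e * norm z \<le> e" by simp
    then have "e * norm z \<le> 1" "e * norm z < d" using e by linarith+
    then show "of_real e * z \<in> cball 0 1" "norm (of_real e * z) < d" using e by (auto simp: norm_mult)
  qed
  have eq: "\<phi> (of_real e * z) = \<phi> w \<longleftrightarrow> of_real e * z = w" if "z \<in> cball 0 1" "w \<in> cball 0 1" for z w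
    using inj_on_eq_iff[OF inj small(1)[OF that(1)] that(2)] .
  have in_ball: "\<psi> z \<in> ball p r" if "z \<in> cball 0 1" for z
    using d(2)[OF small(1)[OF that]] small(2)[OF that] zero by (simp add: \<psi>_def dist_commute)
  have "disc_chart p \<psi>"
    unfolding disc_chart_def
  proof (intro conjI)
    show "continuous_on (cball 0 1) \<psi>" unfolding \<psi>_def
    proof (rule continuous_on_compose2[OF cont])
      show "continuous_on (cball 0 1) (\<lambda>z. complex_of_real e * z)" by (intro continuous_intros)
      show "(\<lambda>z. complex_of_real e * z) ` cball 0 1 \<subseteq> cball 0 1" using small(1) by blast
    qed
    show "inj_on \<psi> (cball 0 1)"
    proof (rule inj_onI)
      fix z w assume "z \<in> cball 0 1" "w \<in> cball 0 1" "\<psi> z = \<psi> w"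
      then show "z = w" using eq[of z "of_real e * w"] small(1) e by (auto simp: \<psi>_def)
    qed
    show "\<psi> 0 = p" using zero by (simp add: \<psi>_def)
  qed
  moreover have "A \<inter> \<psi> ` cball 0 1 = \<psi> ` horizontal"
  proof -
    have "\<psi> z \<in> A \<longleftrightarrow> Im z = 0" if "z \<in> cball 0 1" for z
    proof -
      have "\<psi> z \<in> A \<longleftrightarrow> \<psi> z \<in> \<phi> ` horizontal" using A small(1)[OF that] unfolding \<psi>_def by blast
      also have "\<dots> \<longleftrightarrow> of_real e * z \<in> horizontal"
        unfolding \<psi>_def by (rule inj_on_image_mem_iff[OF inj small(1)[OF that]]) (auto simp: horizontal_def)
      also have "\<dots> \<longleftrightarrow> Im z = 0" using small(1)[OF that] e by (auto simp: horizontal_def)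
      finally show ?thesis .
    qed
    then show ?thesis by (auto simp: horizontal_def)
  qed
  moreover have "B \<inter> \<psi> ` cball 0 1 = \<psi> ` vertical"
  proof -
    have "\<psi> z \<in> B \<longleftrightarrow> Re z = 0" if "z \<in> cball 0 1" for z
    proof -
      have "\<psi> z \<in> B \<longleftrightarrow> \<psi> z \<in> \<phi> ` vertical" using B in_ball[OF that] by blast
      also have "\<dots> \<longleftrightarrow> of_real e * z \<in> vertical"
        unfolding \<psi>_def by (rule inj_on_image_mem_iff[OF inj small(1)[OF that]]) (auto simp: vertical_def)
      also have "\<dots> \<longleftrightarrow> Re z = 0" using small(1)[OF that] e by (auto simp: vertical_def)
      finally show ?thesis .
    qed
    then show ?thesis by (auto simp: vertical_def)
  qed
  ultimately show ?thesis unfolding transverse_at_def by blast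
qed

text \<open>
The sign \<open>e\<close> selects the upper or the lower half of the vertical axis.
\<close>

lemma chart_half_axis:
  assumes \<phi>: "disc_chart p \<phi>" and e: "e = 1 \<or> e = -1"
    and side: "\<phi> ` {z \<in> cball 0 1. e * Im z > 0} \<subseteq> F"
  shows "arc (\<lambda>s. \<phi> (of_real (e * s) * \<i>))" "pathstart (\<lambda>s. \<phi> (of_real (e * s) * \<i>)) = p"
    "(\<lambda>s. \<phi> (of_real (e * s) * \<i>)) ` {0<..1} \<subseteq> F"
    "path_image (\<lambda>s. \<phi> (of_real (e * s) * \<i>)) = \<phi> ` {z \<in> vertical. e * Im z \<ge> 0}"
proof -
  have cont: "continuous_on (cball 0 1) \<phi>" and inj: "inj_on \<phi> (cball 0 1)" and zero: "\<phi> 0 = p"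
    using \<phi> by (auto simp: disc_chart_def)
  have into: "of_real (e * s) * \<i> \<in> cball 0 1" if "s \<in> {0..1}" for s
    using that e by (auto simp: norm_mult)
  show "arc (\<lambda>s. \<phi> (of_real (e * s) * \<i>))"
    unfolding arc_def path_def
  proof
    show "continuous_on {0..1} (\<lambda>s. \<phi> (of_real (e * s) * \<i>))"
    proof (rule continuous_on_compose2[OF cont])
      show "continuous_on {0..1} (\<lambda>s. complex_of_real (e * s) * \<i>)" by (intro continuous_intros)
      show "(\<lambda>s. complex_of_real (e * s) * \<i>) ` {0..1} \<subseteq> cball 0 1" using into by blast
    qed
    show "inj_on (\<lambda>s. \<phi> (of_real (e * s) * \<i>)) {0..1}"
    proof (rule inj_onI)
      fix s u :: real assume su: "s \<in> {0..1}" "u \<in> {0..1}" "\<phi> (of_real (e * s) * \<i>) = \<phi> (of_real (e * u) * \<i>)"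
      then have "of_real (e * s) * \<i> = of_real (e * u) * \<i>" using inj_onD[OF inj su(3)] into by blast
      then show "s = u" using e by (auto simp: complex_eq_iff)
    qed
  qed
  show "pathstart (\<lambda>s. \<phi> (of_real (e * s) * \<i>)) = p" using zero by (simp add: pathstart_def)
  show "(\<lambda>s. \<phi> (of_real (e * s) * \<i>)) ` {0<..1} \<subseteq> F"
  proof
    fix y assume "y \<in> (\<lambda>s. \<phi> (of_real (e * s) * \<i>)) ` {0<..1}"
    then obtain s where s: "s \<in> {0<..1}" "y = \<phi> (of_real (e * s) * \<i>)" by blast
    have "of_real (e * s) * \<i> \<in> {z \<in> cball 0 1. e * Im z > 0}" using s into[of s] e by auto
    then show "y \<in> F" using side s(2) by blast
  qed
  have "(\<lambda>s. of_real (e * s) * \<i>) ` {0..1} = {z \<in> vertical. e * Im z \<ge> 0}"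
  proof (intro equalityI subsetI)
    fix z assume z: "z \<in> {z \<in> vertical. e * Im z \<ge> 0}"
    then have "\<bar>Im z\<bar> \<le> 1" using abs_Im_le_cmod[of z] by (auto simp: vertical_def)
    then show "z \<in> (\<lambda>s. of_real (e * s) * \<i>) ` {0..1}"
      using z e by (intro image_eqI[of _ _ "e * Im z"]) (auto simp: vertical_def complex_eq_iff)
  qed (use into e in \<open>auto simp: vertical_def\<close>)
  then show "path_image (\<lambda>s. \<phi> (of_real (e * s) * \<i>)) = \<phi> ` {z \<in> vertical. e * Im z \<ge> 0}"
    unfolding path_image_def by (metis image_image)
qed

context split_diagram
begin

lemma region_shadow: "F \<in> regions (shadow D) \<Longrightarrow> F \<in> regions (split (\<lambda>_. Unsplit))"
  by (simp add: split_Unsplit)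

lemma regions_disjoint: "F \<in> regions (shadow D) \<Longrightarrow> G \<in> regions (shadow D) \<Longrightarrow> F \<noteq> G \<Longrightarrow> F \<inter> G = {}"
  unfolding regions_def using components_eq by blast

text \<open>
The two open half discs of a flat chart at \<open>p\<close> lie in one region each, and every region with \<open>p\<close> on its
boundary contains one of them. So two different such regions are the two sides, and there is no
third. The chart is turned by \<open>z \<mapsto> - z\<close> if \<open>F\<close> is the lower side.
\<close>

lemma wall_chart:
  assumes p: "p \<in> shadow D - crossings D"
    and F: "F \<in> regions (shadow D)" "p \<in> frontier F" and G: "G \<in> regions (shadow D)" "p \<in> frontier G"
    and ne: "F \<noteq> G"
  obtains \<phi> where "disc_chart p \<phi>" "shadow D \<inter> \<phi> ` cball 0 1 = \<phi> ` horizontal"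
    "\<phi> ` {z \<in> cball 0 1. Im z > 0} \<subseteq> F" "\<phi> ` {z \<in> cball 0 1. Im z < 0} \<subseteq> G"
    "\<And>H. H \<in> regions (shadow D) \<Longrightarrow> p \<in> frontier H \<Longrightarrow> H = F \<or> H = G"
proof -
  have "flat_at (shadow D) p" using p knot by (simp add: knot_diagram_def)
  then obtain \<phi> where \<phi>: "disc_chart p \<phi>" and flat: "shadow D \<inter> \<phi> ` cball 0 1 = \<phi> ` horizontal"
    unfolding flat_at_def by blast
  have cont: "continuous_on (cball 0 1) \<phi>" and inj: "inj_on \<phi> (cball 0 1)" and zero: "\<phi> 0 = p"
    using \<phi> by (auto simp: disc_chart_def)
  define U where "U = {z::complex \<in> cball 0 1. Im z > 0}"
  define L where "L = {z::complex \<in> cball 0 1. Im z < 0}"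
  have sh: "\<phi> z \<in> shadow D \<longleftrightarrow> Im z = 0" if "z \<in> cball 0 1" for z
  proof -
    have "\<phi> z \<in> shadow D \<longleftrightarrow> \<phi> z \<in> \<phi> ` horizontal" using flat that by blast
    also have "\<dots> \<longleftrightarrow> z \<in> horizontal"
      by (rule inj_on_image_mem_iff[OF inj that]) (auto simp: horizontal_def)
    finally show ?thesis using that by (simp add: horizontal_def)
  qed
  have UL: "connected (\<phi> ` U)" "connected (\<phi> ` L)" "\<phi> ` U \<inter> shadow D = {}" "\<phi> ` L \<inter> shadow D = {}"
  proof -
    have "U = cball 0 1 \<inter> {z. Im z > 0}" "L = cball 0 1 \<inter> {z. Im z < 0}" by (auto simp: U_def L_def)
    then have "convex U" "convex L"
      by (simp_all add: convex_Int convex_halfspace_Im_gt convex_halfspace_Im_lt)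
    moreover have sub: "U \<subseteq> cball 0 1" "L \<subseteq> cball 0 1" by (auto simp: U_def L_def)
    ultimately show "connected (\<phi> ` U)" "connected (\<phi> ` L)"
      using cont by (meson connected_continuous_image continuous_on_subset convex_connected)+
    show "\<phi> ` U \<inter> shadow D = {}" "\<phi> ` L \<inter> shadow D = {}"
      using sh by (auto simp: U_def L_def)
  qed
  have absorb: "T \<subseteq> H" if "H \<in> regions (shadow D)" "connected T" "T \<inter> shadow D = {}" "H \<inter> T \<noteq> {}" for H T
    using region_absorbs[OF region_shadow] that split_Unsplit by blast
  have side: "\<phi> ` U \<subseteq> H \<or> \<phi> ` L \<subseteq> H" if H: "H \<in> regions (shadow D)" "p \<in> frontier H" for H
  proof -
    have "open (\<phi> ` ball 0 1)" by (rule open_inj_image[OF cont inj]) auto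
    moreover have "p \<in> \<phi> ` ball 0 1" using zero by (intro image_eqI[of _ _ 0]) auto
    moreover have "p \<in> closure H" using H(2) by (simp add: frontier_def)
    ultimately obtain x where x: "x \<in> H" "x \<in> \<phi> ` ball 0 1"
      by (meson closure_iff_nhds_not_empty disjoint_iff order_refl)
    then obtain z where z: "z \<in> ball 0 1" "x = \<phi> z" by blast
    have "x \<notin> shadow D" using x(1) H(1) in_components_subset unfolding regions_def by blast
    then have "Im z \<noteq> 0" using sh[of z] z by auto
    then have "z \<in> U \<or> z \<in> L" using z(1) by (auto simp: U_def L_def)
    then show ?thesis using absorb[OF H(1) UL(1,3)] absorb[OF H(1) UL(2,4)] x(1) z(2) by blast
  qed
  have half: "\<i> \<in> U" "-\<i> \<in> L" by (auto simp: U_def L_def)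
  have same: "H = K" if "H \<in> regions (shadow D)" "K \<in> regions (shadow D)"
     "\<phi> ` U \<subseteq> H \<and> \<phi> ` U \<subseteq> K \<or> \<phi> ` L \<subseteq> H \<and> \<phi> ` L \<subseteq> K" for H K
    using regions_disjoint[OF that(1,2)] that(3) half by blast
  have two: "H = F \<or> H = G" if "H \<in> regions (shadow D)" "p \<in> frontier H" for H
    using side[OF that] side[OF F] side[OF G] same[OF that(1) F(1)] same[OF that(1) G(1)] same[OF F(1) G(1)] ne
    by blast
  show ?thesis
  proof (cases "\<phi> ` U \<subseteq> F")
    case True
    then have "\<phi> ` L \<subseteq> G" using side[OF G] same[OF F(1) G(1)] ne by blast
    then show ?thesis using that[OF \<phi> flat] True two by (simp add: U_def L_def)
  next
    case False
    then have FG: "\<phi> ` L \<subseteq> F" "\<phi> ` U \<subseteq> G" using side[OF F] side[OF G] same[OF F(1) G(1)] ne by blast+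
    define \<psi> where "\<psi> z = \<phi> (- z)" for z
    have im: "\<psi> ` A = \<phi> ` (uminus ` A)" for A by (simp add: \<psi>_def image_image)
    have neg: "uminus ` cball (0::complex) 1 = cball 0 1" "uminus ` horizontal = horizontal"
       "uminus ` {z \<in> cball 0 1. Im z > 0} = L" "uminus ` {z \<in> cball 0 1. Im z < 0} = U"
      by (auto simp: horizontal_def U_def L_def image_iff intro!: bexI[of _ "- _"] exI[of _ "- _"])
    have "continuous_on (cball 0 1) \<psi>" unfolding \<psi>_def
      by (rule continuous_on_compose2[OF cont]) (auto intro!: continuous_intros)
    moreover have "inj_on \<psi> (cball 0 1)"
    proof (rule inj_onI)
      fix z w :: complex assume "z \<in> cball 0 1" "w \<in> cball 0 1" "\<psi> z = \<psi> w"
      then show "z = w" using inj_onD[OF inj, of "-z" "-w"] by (simp add: \<psi>_def)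
    qed
    ultimately have "disc_chart p \<psi>" using zero by (simp add: disc_chart_def \<psi>_def)
    then show ?thesis
    proof (rule that)
      show "shadow D \<inter> \<psi> ` cball 0 1 = \<psi> ` horizontal" using flat unfolding im neg .
      show "\<psi> ` {z \<in> cball 0 1. Im z > 0} \<subseteq> F" "\<psi> ` {z \<in> cball 0 1. Im z < 0} \<subseteq> G"
        using FG unfolding im neg by auto
    qed (rule two)
  qed
qed

end

section \<open>Paths of the directed graph\<close>

lemma partition_strict:
  fixes t :: "nat \<Rightarrow> real"
  assumes "\<And>i. i < N \<Longrightarrow> t i < t (Suc i)" and "i < j" "j \<le> N"
  shows "t i < t j"
  using assms(2,3)
proof (induction j)
  case (Suc j)
  then show ?case using assms(1)[of j] by (cases "i = j") force+
qed simp

lemma partition_cases: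
  fixes t :: "nat \<Rightarrow> real"
  assumes "t 0 \<le> x" "x \<le> t N"
  shows "(\<exists>i\<le>N. x = t i) \<or> (\<exists>i<N. t i < x \<and> x < t (Suc i))"
  using assms(2)
proof (induction N)
  case 0
  then show ?case using assms(1) by auto
next
  case (Suc N)
  consider "x \<le> t N" | "t N < x" "x < t (Suc N)" | "x = t (Suc N)" using Suc.prems by linarith
  then show ?case
  proof cases
    case 1
    then show ?thesis using Suc.IH by (meson le_SucI less_SucI)
  qed auto
qed

context split_diagram
begin

lemma coloured_region_bounded:
  assumes C: "circuits_for C \<sigma> Rs R" and F: "has_color D \<Phi> Rs F k"
  shows "bounded F"
proof -
  have k: "k < length Rs" "core D \<Phi> F \<subseteq> Rs ! k" using F by (auto simp: has_color_def)
  then have "C k \<in> components (split \<sigma>)" "Rs ! k \<subseteq> inside (C k)" using C by (auto simp: circuits_for_def)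
  then have "bounded (Rs ! k)"
    using compact_circuit compact_imp_bounded bounded_inside bounded_subset by metis
  moreover have "F \<subseteq> core D \<Phi> F \<union> {x. in_disc x}" by (auto simp: core_eq)
  ultimately show ?thesis using k(2) bounded_discs bounded_subset by (metis bounded_Un)
qed

text \<open>
The region with the larger colour lies outside the circuit that encloses the region with the smaller one.
\<close>

lemma color_unique:
  assumes C: "circuits_for C \<sigma> Rs R" and F: "has_color D \<Phi> Rs F j" "has_color D \<Phi> Rs F k"
  shows "j = k"
proof -
  have False if "j < k" "has_color D \<Phi> Rs F j" "has_color D \<Phi> Rs F k" for j k
  proof -
    have "Rs ! k \<subseteq> outside (C j)" "Rs ! j \<subseteq> inside (C j)"
      using C that by (auto simp: circuits_for_def has_color_def)
    then have "core D \<Phi> F = {}"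
      using that(2,3) inside_Int_outside unfolding has_color_def by blast
    then show False using core_region_nonempty[OF region_shadow] that(2) by (auto simp: has_color_def)
  qed
  then show ?thesis using F by (meson linorder_neqE_nat)
qed

text \<open>
The exterior has no colour, so the first backward step leads to the last colour \<open>length Rs - 1\<close>; from
there on all regions are bounded, and every step lowers the unique colour by one.
\<close>

lemma path_colors:
  assumes C: "circuits_for C \<sigma> Rs R" and path: "reversed_path D \<Phi> Rs Fs es" and i: "i < length es"
  shows "i < length Rs \<and> has_color D \<Phi> Rs (Fs ! Suc i) (length Rs - Suc i)"
  using i
proof (induction i)
  case 0
  have "\<not> bounded (Fs ! 0)"
    using path 0 by (auto simp: reversed_path_def hd_conv_nth simp flip: length_greater_0_conv)
  moreover have "method2_edge D \<Phi> Rs (Fs ! Suc 0) (es ! 0) (Fs ! 0)"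
    using path 0 by (auto simp: reversed_path_def)
  then obtain k where k: "has_color D \<Phi> Rs (Fs ! Suc 0) k"
      "has_color D \<Phi> Rs (Fs ! 0) (Suc k) \<or> Suc k = length Rs"
    by (auto simp: method2_edge_def)
  ultimately have "Suc k = length Rs" using coloured_region_bounded[OF C] by blast
  then have "k = length Rs - Suc 0" "0 < length Rs" by auto
  then show ?case using k by simp
next
  case (Suc i)
  then have IH: "i < length Rs" "has_color D \<Phi> Rs (Fs ! Suc i) (length Rs - Suc i)" by auto
  have "method2_edge D \<Phi> Rs (Fs ! Suc (Suc i)) (es ! Suc i) (Fs ! Suc i)"
    using path Suc.prems by (auto simp: reversed_path_def)
  then obtain k where k: "has_color D \<Phi> Rs (Fs ! Suc (Suc i)) k"
      "has_color D \<Phi> Rs (Fs ! Suc i) (Suc k) \<or> \<not> bounded (Fs ! Suc i)"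
    by (auto simp: method2_edge_def)
  then have "Suc k = length Rs - Suc i"
    using coloured_region_bounded[OF C IH(2)] color_unique[OF C IH(2)] by auto
  then have "k = length Rs - Suc (Suc i)" "Suc i < length Rs" by auto
  then show ?case using k(1) by simp
qed

text \<open>
The region of the center has colour \<open>0\<close>, which is reached after exactly \<open>length Rs\<close> edges.
\<close>

lemma path_length:
  assumes C: "circuits_for C \<sigma> Rs R" and path: "reversed_path D \<Phi> Rs Fs es"
  shows "length es = length Rs"
proof -
  have len: "length Fs = Suc (length es)" "\<not> bounded (hd Fs)" "center D \<in> last Fs" "set Fs \<subseteq> regions (shadow D)"
    using path by (auto simp: reversed_path_def)
  have ne: "Fs \<noteq> []" using len(1) by auto
  have last: "last Fs = Fs ! length es" using ne len(1) by (simp add: last_conv_nth)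
  have "last Fs \<in> regions (shadow D)" using ne len(4) by auto
  then have zero: "has_color D \<Phi> Rs (last Fs) 0" if "Rs \<noteq> []"
    using C that len(3) by (auto simp: circuits_for_def has_color_def)
  show ?thesis
  proof (cases "length es")
    case 0
    then have "hd Fs = last Fs" using last ne by (simp add: hd_conv_nth)
    then have "Rs = []" using zero coloured_region_bounded[OF C] len(2) by auto
    then show ?thesis using 0 by simp
  next
    case (Suc n)
    then have "n < length Rs" "has_color D \<Phi> Rs (last Fs) (length Rs - Suc n)"
      using path_colors[OF C path, of n] last by auto
    moreover from this have "Rs \<noteq> []" by auto
    ultimately have "length Rs - Suc n = 0" using color_unique[OF C _ zero] by blast
    then show ?thesis using Suc \<open>n < length Rs\<close> by simp
  qed
qed

lemma path_regions_distinct: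
  assumes C: "circuits_for C \<sigma> Rs R" and path: "reversed_path D \<Phi> Rs Fs es" 
    and ij: "i < j" "j < length Fs"
  shows "Fs ! i \<noteq> Fs ! j"
proof
  assume eq: "Fs ! i = Fs ! j"
  have len: "length Fs = Suc (length es)" "\<not> bounded (hd Fs)" using path by (auto simp: reversed_path_def)
  obtain j' where j: "j = Suc j'" using ij by (cases j) auto
  have J: "j' < length Rs" "has_color D \<Phi> Rs (Fs ! j) (length Rs - j)"
    using path_colors[OF C path, of j'] ij len(1) j by auto
  show False
  proof (cases i)
    case 0
    have "Fs \<noteq> []" using len(1) by auto
    then have "hd Fs = Fs ! j" using eq 0 by (simp add: hd_conv_nth)
    then show False using coloured_region_bounded[OF C J(2)] len(2) by simp
  next
    case (Suc i')
    then have "has_color D \<Phi> Rs (Fs ! i) (length Rs - i)"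
      using path_colors[OF C path, of i'] ij len(1) by auto
    then have "length Rs - i = length Rs - j" using color_unique[OF C] J(2) eq by metis
    then show False using ij(1) J(1) j by simp
  qed
qed

lemma arc_of_path_meridian:
  assumes path: "reversed_path D \<Phi> Rs Fs es" and m: "arc_of_path D Fs es m"
  shows "card (path_image m \<inter> shadow D) = length es" and "meridian D (reversepath m)"
proof -
  have len: "length Fs = Suc (length es)" "\<not> bounded (hd Fs)" "set Fs \<subseteq> regions (shadow D)"
    using path by (auto simp: reversed_path_def)
  have arc: "arc m" and st: "pathstart m \<in> hd Fs" and fin: "pathfinish m = center D" using m by (auto simp: arc_of_path_def)
  obtain t :: "nat \<Rightarrow> real" where t: "t 0 = 0" "t (length Fs) = 1"
      "\<And>i. i < length Fs \<Longrightarrow> t i < t (Suc i) \<and> m ` {t i<..<t (Suc i)} \<subseteq> Fs ! i"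
      "\<And>i. i < length es \<Longrightarrow> m (t (Suc i)) \<in> es ! i \<and> transverse_at (shadow D) (path_image m) (m (t (Suc i)))"
    using m unfolding arc_of_path_def by blast
  have off: "F \<inter> shadow D = {}" if "F \<in> set Fs" for F
    using that len(3) in_components_subset unfolding regions_def by blast
  have hd: "hd Fs \<in> set Fs" using len(1) by (cases Fs) auto
  have wall: "m (t (Suc i)) \<in> shadow D - crossings D" if "i < length es" for i
  proof -
    have "es ! i \<in> walls D" using path that by (auto simp: reversed_path_def method2_edge_def)
    then have "es ! i \<subseteq> shadow D - crossings D" unfolding walls_def by (rule in_components_subset)
    then show ?thesis using t(4)[OF that] by blast
  qed
  have lt: "t i < t j" if "i < j" "j \<le> length Fs" for i j
    using partition_strict[of "length Fs" t i j] t(3) that by blast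
  have t01: "t i \<in> {0..1}" if "i \<le> length Fs" for i
    using lt[of 0 i] lt[of i "length Fs"] that t(1,2)
    by (cases "i = 0"; cases "i = length Fs") auto
  have eq: "path_image m \<inter> shadow D = (\<lambda>i. m (t (Suc i))) ` {..<length es}"
  proof
    show "path_image m \<inter> shadow D \<subseteq> (\<lambda>i. m (t (Suc i))) ` {..<length es}"
    proof
      fix p assume p: "p \<in> path_image m \<inter> shadow D"
      then obtain x where x: "0 \<le> x" "x \<le> 1" "p = m x" by (auto simp: path_image_def)
      have "(\<exists>i\<le>length Fs. x = t i) \<or> (\<exists>i<length Fs. t i < x \<and> x < t (Suc i))"
        using partition_cases[of t x "length Fs"] t(1,2) x by simp
      then show "p \<in> (\<lambda>i. m (t (Suc i))) ` {..<length es}"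
      proof (elim disjE exE conjE)
        fix i assume i: "i \<le> length Fs" "x = t i"
        have "i \<noteq> 0"
        proof
          assume "i = 0"
          then have "p = pathstart m" using i t(1) x(3) by (simp add: pathstart_def)
          then show False using st p off[OF hd] by blast
        qed
        moreover have "i \<noteq> length Fs"
        proof
          assume "i = length Fs"
          then have "p = pathfinish m" using i t(2) x(3) by (simp add: pathfinish_def)
          then show False using fin p center_not_shadow by auto
        qed
        ultimately obtain k where "i = Suc k" "k < length es" using i(1) len(1) by (cases i) auto
        then show ?thesis using x(3) i(2) by auto
      next
        fix i assume i: "i < length Fs" "t i < x" "x < t (Suc i)"
        then have "m x \<in> Fs ! i" using t(3)[OF i(1)] by auto
        then show ?thesis using p x(3) off[of "Fs ! i"] nth_mem[OF i(1)] by blast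
      qed
    qed
    show "(\<lambda>i. m (t (Suc i))) ` {..<length es} \<subseteq> path_image m \<inter> shadow D"
      using wall t01 len(1) by (auto simp: path_image_def)
  qed
  have "inj_on (\<lambda>i. m (t (Suc i))) {..<length es}"
  proof (rule linorder_inj_onI')
    fix i j assume ij: "i \<in> {..<length es}" "j \<in> {..<length es}" "i < j"
    then have "t (Suc i) < t (Suc j)" using lt len(1) by auto
    moreover have "inj_on m {0..1}" using arc by (simp add: arc_def)
    ultimately show "m (t (Suc i)) \<noteq> m (t (Suc j))"
      using inj_onD[of m "{0..1}" "t (Suc i)" "t (Suc j)"] t01[of "Suc i"] t01[of "Suc j"] ij len(1) by force
  qed
  then show "card (path_image m \<inter> shadow D) = length es" unfolding eq by (simp add: card_image)
  have "pathstart m \<in> outside (shadow D)"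
  proof -
    have H: "hd Fs \<in> components (- shadow D)" using hd len(3) by (auto simp: regions_def)
    then have "hd Fs \<subseteq> connected_component_set (- shadow D) (pathstart m)"
      using st in_components_connected in_components_subset by (metis connected_component_maximal)
    then have "\<not> bounded (connected_component_set (- shadow D) (pathstart m))"
      using len(2) bounded_subset by blast
    then show ?thesis using st off[OF hd] by (auto simp: outside_def)
  qed
  then show "meridian D (reversepath m)"
    unfolding meridian_def path_image_reversepath pathstart_reversepath pathfinish_reversepath
    using arc fin wall t(4) by (auto simp: eq arc_reversepath)
qed

text \<open>
Choose a point \<open>p i\<close> on each wall and a chart there whose upper side is \<open>Fs ! i\<close> and whose lower side is
\<open>Fs ! Suc i\<close>. The points \<open>q i\<close> are the start point, the points on the walls and the center, and the arc
\<open>h i\<close> leads from \<open>q i\<close> to \<open>q (Suc i)\<close> through \<open>Fs ! i\<close>. Since the regions are pairwise different, each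
\<open>p i\<close> lies on the boundary of two of them only, so the \<open>q i\<close> are pairwise different and arcs with
different indices meet at most in the common end point of consecutive ones.
\<close>

lemma arc_of_path_exists:
  assumes C: "circuits_for C \<sigma> Rs R" and path: "reversed_path D \<Phi> Rs Fs es"
  shows "\<exists>m. arc_of_path D Fs es m"
proof -
  define n where "n = length es"
  have len: "length Fs = Suc n" "\<not> bounded (hd Fs)" "center D \<in> last Fs" "set Fs \<subseteq> regions (shadow D)"
    and edge: "\<And>i. i < n \<Longrightarrow> method2_edge D \<Phi> Rs (Fs ! Suc i) (es ! i) (Fs ! i)"
    using path by (auto simp: reversed_path_def n_def)
  have ne: "Fs \<noteq> []" using len(1) by auto
  have hl: "hd Fs = Fs ! 0" "last Fs = Fs ! n" using ne len(1) by (auto simp: hd_conv_nth last_conv_nth)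
  have reg: "Fs ! i \<in> regions (shadow D)" if "i \<le> n" for i using that len(1,4) nth_mem[of i Fs] by auto
  have F: "open (Fs ! i)" "connected (Fs ! i)" "Fs ! i \<inter> shadow D = {}" "Fs ! i \<noteq> {}" if "i \<le> n" for i
    using open_region[OF region_shadow[OF reg[OF that]]] reg[OF that] in_components_connected in_components_subset in_components_nonempty
    unfolding regions_def by blast+
  have distinct: "Fs ! i \<noteq> Fs ! j" if "i \<noteq> j" "i \<le> n" "j \<le> n" for i j
    using path_regions_distinct[OF C path, of i j] path_regions_distinct[OF C path, of j i] that len(1)
    by (metis le_imp_less_Suc linorder_neqE_nat)
  have disj: "Fs ! i \<inter> Fs ! j = {}" if "i \<noteq> j" "i \<le> n" "j \<le> n" for i j
    using regions_disjoint[OF reg reg distinct] that by blast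
  define crosses where "crosses i p \<phi> \<longleftrightarrow> p \<in> es ! i \<and> p \<in> shadow D \<and> disc_chart p \<phi> \<and>
     shadow D \<inter> \<phi> ` cball 0 1 = \<phi> ` horizontal \<and>
     \<phi> ` {z \<in> cball 0 1. Im z > 0} \<subseteq> Fs ! i \<and> \<phi> ` {z \<in> cball 0 1. Im z < 0} \<subseteq> Fs ! Suc i \<and>
     p \<in> frontier (Fs ! Suc i) \<and> (\<forall>j\<le>n. p \<in> frontier (Fs ! j) \<longrightarrow> j = i \<or> j = Suc i)" for i p \<phi>
  have "\<exists>p \<phi>. crosses i p \<phi>" if i: "i < n" for i
  proof -
    have e: "es ! i \<in> components (shadow D - crossings D)" "es ! i \<subseteq> frontier (Fs ! i)" "es ! i \<subseteq> frontier (Fs ! Suc i)"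
      using edge[OF i] by (auto simp: method2_edge_def walls_def)
    obtain p where p: "p \<in> es ! i" using in_components_nonempty[OF e(1)] by blast
    have pf: "p \<in> shadow D - crossings D" "p \<in> frontier (Fs ! i)" "p \<in> frontier (Fs ! Suc i)"
      using p e in_components_subset[OF e(1)] by blast+
    have ii: "i \<le> n" "Suc i \<le> n" "i \<noteq> Suc i" using i by auto
    obtain \<phi> where \<phi>: "disc_chart p \<phi>" "shadow D \<inter> \<phi> ` cball 0 1 = \<phi> ` horizontal"
      "\<phi> ` {z \<in> cball 0 1. Im z > 0} \<subseteq> Fs ! i" "\<phi> ` {z \<in> cball 0 1. Im z < 0} \<subseteq> Fs ! Suc i"
      and two: "\<And>H. H \<in> regions (shadow D) \<Longrightarrow> p \<in> frontier H \<Longrightarrow> H = Fs ! i \<or> H = Fs ! Suc i"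
      using wall_chart[OF pf(1) reg[OF ii(1)] pf(2) reg[OF ii(2)] pf(3) distinct[OF ii(3,1,2)]] by blast
    have "j = i \<or> j = Suc i" if "j \<le> n" "p \<in> frontier (Fs ! j)" for j
      using two[OF reg[OF that(1)] that(2)] distinct[OF _ that(1) ii(1)] distinct[OF _ that(1) ii(2)] by blast
    then have "crosses i p \<phi>" unfolding crosses_def using p pf(1) pf(3) \<phi> by auto
    then show ?thesis by blast
  qed
  then have "\<forall>i. \<exists>x. i < n \<longrightarrow> crosses i (fst x) (snd x)" by simp
  from choice[OF this] obtain x where "\<And>i. i < n \<Longrightarrow> crosses i (fst (x i)) (snd (x i))" by blast
  then have cr': "\<And>i. i < n \<Longrightarrow> crosses i ((fst \<circ> x) i) ((snd \<circ> x) i)" by simp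
  define p \<phi> where "p = fst \<circ> x" and "\<phi> = snd \<circ> x"
  have cr: "crosses i (p i) (\<phi> i)" if "i < n" for i
    using cr'[OF that] by (simp only: p_def \<phi>_def)
  have p: "p i \<in> es ! i" "p i \<in> shadow D" "p i \<in> frontier (Fs ! Suc i)"
      "\<And>j. j \<le> n \<Longrightarrow> p i \<in> frontier (Fs ! j) \<Longrightarrow> j = i \<or> j = Suc i"
    and \<phi>: "disc_chart (p i) (\<phi> i)" "shadow D \<inter> \<phi> i ` cball 0 1 = \<phi> i ` horizontal"
      "\<phi> i ` {z \<in> cball 0 1. Im z > 0} \<subseteq> Fs ! i" "\<phi> i ` {z \<in> cball 0 1. Im z < 0} \<subseteq> Fs ! Suc i"
    if "i < n" for i
    using cr[OF that] by (simp_all add: crosses_def)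
  obtain x0 where x0: "x0 \<in> Fs ! 0" "x0 \<noteq> center D"
  proof -
    have "infinite (Fs ! 0)" using len(2) hl finite_imp_bounded by metis
    then have "Fs ! 0 - {center D} \<noteq> {}" by (metis finite.emptyI finite_insert finite_Diff2 finite.insertI)
    then show ?thesis using that by blast
  qed
  define q where "q i = (if i = 0 then x0 else if i \<le> n then p (i - 1) else center D)" for i
  have qs: "q i \<in> shadow D" if "0 < i" "i \<le> n" for i using that p(2)[of "i - 1"] by (simp add: q_def)
  have q0: "q 0 = x0" "q (Suc n) = center D" "\<And>i. i < n \<Longrightarrow> q (Suc i) = p i" by (auto simp: q_def)
  have x0s: "x0 \<notin> shadow D" using x0(1) F(3)[of 0] by auto
  have pne: "p i \<noteq> p j" if "i < j" "j < n" for i j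
    using p(3)[of j] p(4)[of i "Suc j"] that by auto
  have qne: "q i \<noteq> q j" if "i < j" "j \<le> Suc n" for i j
  proof (cases "j = Suc n")
    case True
    then show ?thesis using qs[of i] q0 x0(2) center_not_shadow that by (cases "i = 0") force+
  next
    case False
    then have j: "q j \<in> shadow D" using qs[of j] that by auto
    show ?thesis
    proof (cases "i = 0")
      case True then show ?thesis using j q0 x0s by auto
    next
      case i: False
      then have "q i = p (i - 1)" "q j = p (j - 1)" using that False by (auto simp: q_def)
      then show ?thesis using pne[of "i - 1" "j - 1"] that False i by auto
    qed
  qed
  define \<alpha>v where "\<alpha>v i = (\<lambda>s. \<phi> i (of_real (-1 * s) * \<i>))" for i
  define \<beta>v where "\<beta>v i = (\<lambda>s. \<phi> i (of_real (1 * s) * \<i>))" for i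
  have av: "arc (\<alpha>v i)" "pathstart (\<alpha>v i) = p i" "\<alpha>v i ` {0<..1} \<subseteq> Fs ! Suc i"
    "path_image (\<alpha>v i) = \<phi> i ` {z \<in> vertical. Im z \<le> 0}" if i: "i < n" for i
    using chart_half_axis[OF \<phi>(1)[OF i], of "-1" "Fs ! Suc i"] \<phi>(4)[OF i] unfolding \<alpha>v_def by simp_all
  have bv: "arc (\<beta>v i)" "pathstart (\<beta>v i) = p i" "\<beta>v i ` {0<..1} \<subseteq> Fs ! i"
    "path_image (\<beta>v i) = \<phi> i ` {z \<in> vertical. Im z \<ge> 0}" if i: "i < n" for i
    using chart_half_axis[OF \<phi>(1)[OF i], of 1 "Fs ! i"] \<phi>(3)[OF i] unfolding \<beta>v_def by simp_all
  obtain \<alpha>0 where a0: "arc \<alpha>0" "pathstart \<alpha>0 = x0" "\<alpha>0 ` {0<..1} \<subseteq> Fs ! 0"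
    using short_arc[OF F(1) x0(1)] by auto
  obtain \<beta>0 where b0: "arc \<beta>0" "pathstart \<beta>0 = center D" "\<beta>0 ` {0<..1} \<subseteq> Fs ! n"
    using short_arc[OF F(1)[of n], of "center D"] len(3) hl by auto
  define \<alpha> where "\<alpha> i = (if i = 0 then \<alpha>0 else \<alpha>v (i - 1))" for i
  define \<beta> where "\<beta> i = (if i < n then \<beta>v i else \<beta>0)" for i
  have \<alpha>: "arc (\<alpha> i)" "pathstart (\<alpha> i) = q i" "\<alpha> i ` {0<..1} \<subseteq> Fs ! i" if "i \<le> n" for i
    using a0 av[of "i - 1"] that by (cases i; simp add: \<alpha>_def q_def)+
  have \<beta>: "arc (\<beta> i)" "pathstart (\<beta> i) = q (Suc i)" "\<beta> i ` {0<..1} \<subseteq> Fs ! i" if "i \<le> n" for i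
    using b0 bv[of i] that by (cases "i < n"; simp add: \<beta>_def q_def)+
  define joins where "joins i h \<longleftrightarrow> arc h \<and> pathstart h = q i \<and> pathfinish h = q (Suc i) \<and> h ` {0<..<1} \<subseteq> Fs ! i \<and>
    (q i \<notin> Fs ! i \<longrightarrow> (\<exists>r>0. path_image h \<inter> ball (q i) r = path_image (\<alpha> i) \<inter> ball (q i) r)) \<and>
    (q (Suc i) \<notin> Fs ! i \<longrightarrow> (\<exists>r>0. path_image h \<inter> ball (q (Suc i)) r = path_image (\<beta> i) \<inter> ball (q (Suc i)) r))"
    for i h
  have "\<exists>h. joins i h" if i: "i \<le> n" for i
    using arc_through_region[OF F(1,2)[OF i] \<alpha>(1,3)[OF i] \<beta>(1,3)[OF i]] qne[of i "Suc i"] i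
    unfolding \<alpha>(2)[OF i] \<beta>(2)[OF i] joins_def by simp
  then have "\<forall>i. \<exists>h. i \<le> n \<longrightarrow> joins i h" by blast
  from choice[OF this] obtain h where jn: "\<And>i. i \<le> n \<Longrightarrow> joins i (h i)" by blast
  have h: "arc (h i) \<and> pathstart (h i) = q i \<and> pathfinish (h i) = q (Suc i) \<and> h i ` {0<..<1} \<subseteq> Fs ! i"
    and h\<alpha>: "q i \<notin> Fs ! i \<Longrightarrow> \<exists>r>0. path_image (h i) \<inter> ball (q i) r = path_image (\<alpha> i) \<inter> ball (q i) r"
    and h\<beta>: "q (Suc i) \<notin> Fs ! i \<Longrightarrow>
      \<exists>r>0. path_image (h i) \<inter> ball (q (Suc i)) r = path_image (\<beta> i) \<inter> ball (q (Suc i)) r"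
    if "i \<le> n" for i
    using jn[OF that] by (simp_all add: joins_def)
  have him: "path_image (h i) \<subseteq> Fs ! i \<union> {q i, q (Suc i)}" if i: "i \<le> n" for i
  proof
    fix y assume "y \<in> path_image (h i)"
    then obtain s where s: "s \<in> {0..1}" "y = h i s" by (auto simp: path_image_def)
    consider "s = 0" | "s = 1" | "s \<in> {0<..<1}" using s(1) by fastforce
    then show "y \<in> Fs ! i \<union> {q i, q (Suc i)}"
    proof cases
      case 3
      then have "h i s \<in> h i ` {0<..<1}" by (rule imageI)
      then show ?thesis using h[OF i] s(2) by blast
    qed (use h[OF i] s in \<open>auto simp: pathstart_def pathfinish_def\<close>)
  qed
  have meet: "path_image (h i) \<inter> path_image (h j) \<subseteq> {q j}" if ij: "i < j" "j \<le> n" for i j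
  proof
    fix y assume y: "y \<in> path_image (h i) \<inter> path_image (h j)"
    have yi: "y \<in> Fs ! i \<or> y = q i \<or> y = q (Suc i)" and yj: "y \<in> Fs ! j \<or> y = q j \<or> y = q (Suc j)"
      using y him[of i] him[of j] ij by auto
    have notj: "q i \<notin> Fs ! j" "q (Suc i) \<notin> Fs ! j"
    proof -
      show "q i \<notin> Fs ! j"
        using qs[of i] F(3)[of j] disj[of 0 j] x0(1) q0(1) ij by (cases "i = 0") auto
      show "q (Suc i) \<notin> Fs ! j" using qs[of "Suc i"] F(3)[of j] ij by auto
    qed
    have noti: "q j \<notin> Fs ! i" "q (Suc j) \<notin> Fs ! i"
    proof -
      show "q j \<notin> Fs ! i" using qs[of j] F(3)[of i] ij by auto
      show "q (Suc j) \<notin> Fs ! i"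
        using qs[of "Suc j"] F(3)[of i] disj[of n i] len(3) hl q0(2) ij by (cases "j = n") auto
    qed
    have "y \<notin> Fs ! i \<or> y \<notin> Fs ! j" using disj[of i j] ij by auto
    then have "y = q i \<or> y = q (Suc i)" "y = q j \<or> y = q (Suc j)" using yi yj notj noti by auto
    then show "y \<in> {q j}"
      using qne[of i j] qne[of i "Suc j"] qne[of "Suc i" "Suc j"] qne[of "Suc i" j] ij by (cases "Suc i = j") auto
  qed
  obtain m t where m: "arc m" "pathstart m = q 0" "pathfinish m = q (Suc n)" and t: "t 0 = (0::real)" "t (Suc n) = 1"
    "\<And>i. i \<le> n \<Longrightarrow> t i < t (Suc i) \<and> m ` {t i<..<t (Suc i)} \<subseteq> Fs ! i"
    "\<And>i. i \<le> Suc n \<Longrightarrow> m (t i) = q i"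
    and im: "path_image m = (\<Union>i\<le>n. path_image (h i))"
    using concatenate_arcs[of n h q "\<lambda>i. Fs ! i", OF h meet] by blast
  have trans: "transverse_at (shadow D) (path_image m) (p i)" if i: "i < n" for i
  proof -
    have pq: "q (Suc i) = p i" "p i \<in> shadow D" using q0(3)[OF i] p(2)[OF i] by auto
    have notF: "p i \<notin> Fs ! j" if "j \<le> n" for j using F(3)[OF that] pq(2) by blast
    obtain r1 where r1: "r1 > 0" "path_image (h i) \<inter> ball (p i) r1 = path_image (\<beta> i) \<inter> ball (p i) r1"
      using h\<beta>[of i] i notF[of i] pq(1) by auto
    obtain r2 where r2: "r2 > 0" "path_image (h (Suc i)) \<inter> ball (p i) r2 = path_image (\<alpha> (Suc i)) \<inter> ball (p i) r2"
      using h\<alpha>[of "Suc i"] i notF[of "Suc i"] pq(1) by auto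
    define K where "K = (\<Union>j\<in>{..n} - {i, Suc i}. path_image (h j))"
    have "compact K" unfolding K_def using h by (intro compact_UN) (auto intro: compact_path_image arc_imp_path)
    have "p i \<notin> K"
    proof
      assume "p i \<in> K"
      then obtain j where j: "j \<le> n" "j \<noteq> i" "j \<noteq> Suc i" "p i \<in> path_image (h j)" by (auto simp: K_def)
      then have "q (Suc i) = q j \<or> q (Suc i) = q (Suc j)" using him[OF j(1)] notF[OF j(1)] pq(1) by auto
      then show False
        using qne[of "Suc i" j] qne[of j "Suc i"] qne[of "Suc i" "Suc j"] qne[of "Suc j" "Suc i"] j i
        by (metis Suc_inject Suc_le_mono less_or_eq_imp_le linorder_neqE_nat le_SucI Suc_leI)
    qed
    then obtain r3 where r3: "r3 > 0" "ball (p i) r3 \<subseteq> - K"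
      using open_contains_ball[of "- K"] \<open>compact K\<close> compact_imp_closed by (metis ComplI open_Compl)
    define r where "r = min r1 (min r2 r3)"
    have "r > 0" using r1 r2 r3 by (simp add: r_def)
    have sub: "ball (p i) r \<subseteq> ball (p i) r1" "ball (p i) r \<subseteq> ball (p i) r2" "ball (p i) r \<subseteq> ball (p i) r3"
      by (auto simp: r_def)
    have "{..n} = {i, Suc i} \<union> ({..n} - {i, Suc i})" using i by auto
    then have "path_image m = path_image (h i) \<union> path_image (h (Suc i)) \<union> K"
      unfolding im K_def by (metis (no_types, lifting) UN_Un UN_insert UN_empty Un_empty_right)
    then have "path_image m \<inter> ball (p i) r = (path_image (\<beta> i) \<union> path_image (\<alpha> (Suc i))) \<inter> ball (p i) r"
      using r1(2) r2(2) r3(2) sub by blast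
    also have "path_image (\<beta> i) \<union> path_image (\<alpha> (Suc i)) = \<phi> i ` vertical"
    proof -
      have "vertical = {z \<in> vertical. Im z \<ge> 0} \<union> {z \<in> vertical. Im z \<le> 0}" by auto
      then have "\<phi> i ` vertical = \<phi> i ` {z \<in> vertical. Im z \<ge> 0} \<union> \<phi> i ` {z \<in> vertical. Im z \<le> 0}"
        by (metis image_Un)
      then show ?thesis using av(4)[OF i] bv(4)[OF i] i by (simp add: \<alpha>_def \<beta>_def)
    qed
    finally show ?thesis using transverse_at_shrink[OF \<phi>(1,2)[OF i] \<open>r > 0\<close>] by blast
  qed
  have "arc_of_path D Fs es m"
    unfolding arc_of_path_def
  proof (intro conjI exI[of _ t] allI impI)
    show "pathstart m \<in> hd Fs" using m(2) q0(1) x0(1) hl by simp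
    show "pathfinish m = center D" using m(3) q0(2) by simp
    show "t (length Fs) = 1" using t(2) len(1) by simp
    show "t i < t (Suc i)" "m ` {t i<..<t (Suc i)} \<subseteq> Fs ! i" if "i < length Fs" for i
      using t(3)[of i] that len(1) by auto
    show "m (t (Suc i)) \<in> es ! i" "transverse_at (shadow D) (path_image m) (m (t (Suc i)))" if "i < length es" for i
      using t(4)[of "Suc i"] q0(3)[of i] p(1)[of i] trans[of i] that by (auto simp: n_def)
  qed (use m t in auto)
  then show ?thesis by blast
qed

end

theorem theorem1:
  fixes D :: annular_diagram
    and \<Phi> :: "complex \<Rightarrow> complex \<Rightarrow> complex"
    and \<sigma> :: "complex \<Rightarrow> crossing_state"
    and Rs Fs es :: "complex set list"
  assumes "knot_diagram D"
    and "method1 D \<Phi> \<sigma> Rs"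
    and "reversed_path D \<Phi> Rs Fs es"
  shows "(\<exists>m. arc_of_path D Fs es m) \<and>
    (\<forall>m. arc_of_path D Fs es m \<longrightarrow>
       minimal_meridian D (reversepath m) \<and>
       card (path_image m \<inter> shadow D) = wrapping_number D)"
proof -
  interpret split_diagram D \<Phi>
    using assms(1,2) by (unfold_locales) (auto simp: method1_def)
  obtain R where "coloring D \<Phi> \<sigma> Rs R" using assms(2) by (auto simp: method1_def)
  then obtain C where C: "circuits_for C \<sigma> Rs R" using coloring_circuits by blast
  have lower: "length es \<le> card (path_image m' \<inter> shadow D)" if "meridian D m'" for m'
    unfolding path_length[OF C assms(3)]
    using meridian_card_ge[OF that, of "length Rs" C \<sigma>] C by (auto simp: circuits_for_def)
  have "minimal_meridian D (reversepath m) \<and> card (path_image m \<inter> shadow D) = wrapping_number D"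
    if m: "arc_of_path D Fs es m" for m
  proof
    note m' = arc_of_path_meridian[OF assms(3) m]
    show "minimal_meridian D (reversepath m)"
      using m' lower by (simp add: minimal_meridian_def)
    show "card (path_image m \<inter> shadow D) = wrapping_number D"
      unfolding wrapping_number_def m'(1)
      by (rule Least_equality[symmetric]) (use m' lower in \<open>auto intro!: exI[of _ "reversepath m"]\<close>)
  qed
  then show ?thesis using arc_of_path_exists[OF C assms(3)] by blast
qed

end
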